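(* Let $S$ be a closed, non-negative, densely defined symmetric operator on a separable Hilbert space $\mathcal H$ with finite and equal defect numbers $(n,n)$, and let $(\mathcal K,\Gamma_0,\Gamma_1)$ be a boundary triplet for $S$. Let $H_F$ be the Friedrichs extension of $S$ with corresponding Lagrangian plane $\mathcal F$, and let $H$ be the self-adjoint extension of $S$ specified by a Lagrangian plane $\mathcal L$. Then the Morse index of $H$ is $$n_-(H)=\iota\big(\mathcal M(0-),\mathcal L,\mathcal F\big),$$ where $\mathcal M(0-)=\lim_{s\to0-}\mathcal M(s)$ is the left-hand limit at $0$ of the Cauchy data space $\mathcal M(s)=\{(\Gamma_0f,\Gamma_1f):f\in\ker(S^*-s)\}$. Furthermore, if $\operatorname{dom}(H_F)=\ker\Gamma_0$ and $\mathcal M(0-)$ is the graph of an operator $M_0:\mathcal K\to\mathcal K$, then $$n_-(H)=n_+(PM_0P-\Theta),$$ where $(P,\ P\Theta P+P-I)$ is a Lagrangian frame for $\mathcal L$, with $P:\mathcal K\to\mathcal K$ an orthogonal projector and $\Theta:\operatorname{ran}P\to\operatorname{ran}P$ self-adjoint.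
   Context: All inner products are linear in the second argument. A boundary triplet $(\mathcal K,\Gamma_0,\Gamma_1)$ for $S$ consists of an $n$-dimensional complex Hilbert space $\mathcal K$ and linear maps $\Gamma_0,\Gamma_1:\operatorname{dom}(S^* )\to\mathcal K$ such that $\mathbf\Gamma f:=(\Gamma_0f,\Gamma_1f)$ defines a surjection $\operatorname{dom}(S^* )\to\mathcal K\oplus\mathcal K$ and $\langle f,S^*g\rangle_{\mathcal H}-\langle S^*f,g\rangle_{\mathcal H}=\langle\Gamma_0f,\Gamma_1g\rangle_{\mathcal K}-\langle\Gamma_1f,\Gamma_0g\rangle_{\mathcal K}$ for all $f,g\in\operatorname{dom}(S^* )$. The symplectic form on $\mathcal K\oplus\mathcal K$ is $\omega(u,v)=\langle u_0,v_1\rangle_{\mathcal K}-\langle u_1,v_0\rangle_{\mathcal K}$. A subspace $\mathcal L$ is a Lagrangian plane if $\mathcal L=\{u:\omega(u,v)=0\ \forall v\in\mathcal L\}$. Self-adjoint extensions $H$ of $S$ are in one-to-one correspondence with Lagrangian planes $\mathcal L$ via $\operatorname{dom}(H)=\{f\in\operatorname{dom}(S^* ):\mathbf\Gamma f\in\mathcal L\}$; in particular $\mathcal F=\mathbf\Gamma(\operatorname{dom}(H_F))$. A frame for a Lagrangian plane $\mathcal L$ is an injective linear map $(X,Y):\mathcal K\to\mathcal K\oplus\mathcal K$, $\kappa\mapsto(X\kappa,Y\kappa)$, with range $\mathcal L$; every Lagrangian plane has a frame of the form $(P,P\Theta P+P-I)$. The limit $\mathcal M(0-)$ is taken over real $s<0$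 in the strong graph sense: it consists of all $u\in\mathcal K\oplus\mathcal K$ for which there are $u_s\in\mathcal M(s)$ with $u_s\to u$ as $s\to0-$; it exists and is a Lagrangian plane. The Morse index $n_-(H)$ is the number of eigenvalues of $H$ in $(-\infty,0)$ counted with multiplicity; $n_+(\cdot)$ is the number of positive eigenvalues, with $PM_0P-\Theta$ regarded as an operator on $\operatorname{ran}P$. Duistermaat index: for Lagrangian planes $\alpha,\beta,\gamma$ with $\alpha\cap\beta=0=\beta\cap\gamma$, $\gamma$ is the graph $\{u+Lu:u\in\alpha\}$ of a linear map $L:\alpha\to\beta$; let $Q(\alpha,\beta;\gamma)$ be the Hermitian form $(u_1,u_2)\mapsto\omega(u_1,Lu_2)$ on $\alpha$, and let $n_-$ of a Hermitian form be the maximal dimension of a subspace on which it is negative definite. For arbitrary Lagrangian planes $\mathcal L_1,\mathcal L_2,\mathcal L_3$, choose a Lagrangian plane $\hat{\mathcal L}$ transversal to all three and set $\iota(\mathcal L_1,\mathcal L_2,\mathcal L_3):=n_-(Q(\mathcal L_2,\hat{\mathcal L};\mathcal L_3))-n_-(Q(\mathcal L_1,\hat{\mathcal L};\mathcal L_3))+n_-(Q(\mathcal L_1,\hat{\mathcal L};\mathcal L_2))$, which does not depend on the choice of $\hat{\mathcal L}$. *)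

theory Defs
  imports "HOL-Analysis.Analysis" "HOL-Library.Extended_Nat"
begin

section \<open>Complex Hilbert spaces\<close>

text \<open>
  The inner product is linear in the second argument. Positivity and definiteness are contained in
  \<open>cinner_self\<close>, completeness in the superclass. The zero space is not excluded.
\<close>

class chilbert_space = banach +
  fixes scaleC :: "complex \<Rightarrow> 'a \<Rightarrow> 'a" (infixr "*\<^sub>C" 75)
    and cinner :: "'a \<Rightarrow> 'a \<Rightarrow> complex"
  assumes scaleC_add_right: "c *\<^sub>C (x + y) = c *\<^sub>C x + c *\<^sub>C y"
    and scaleC_add_left: "(c + d) *\<^sub>C x = c *\<^sub>C x + d *\<^sub>C x"
    and scaleC_scaleC: "c *\<^sub>C d *\<^sub>C x = (c * d) *\<^sub>C x"
    and scaleC_of_real: "complex_of_real r *\<^sub>C x = r *\<^sub>R x"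
    and cinner_commute: "cinner x y = cnj (cinner y x)"
    and cinner_add_right: "cinner x (y + z) = cinner x y + cinner x z"
    and cinner_scaleC_right: "cinner x (c *\<^sub>C y) = c * cinner x y"
    and cinner_self: "cinner x x = complex_of_real ((norm x)\<^sup>2)"

lemma scaleC_one [simp]: "1 *\<^sub>C (x :: 'a :: chilbert_space) = x"
  using scaleC_of_real[of 1 x] by simp

global_interpretation complex_vector:
    vector_space "scaleC :: complex \<Rightarrow> 'a \<Rightarrow> 'a :: chilbert_space"
  defines csubspace = complex_vector.subspace
    and cspan = complex_vector.span
    and cdependent = complex_vector.dependent
    and cdim = complex_vector.dim
  by unfold_locales (simp_all add: scaleC_add_right scaleC_add_left scaleC_scaleC)

abbreviation clinear :: "('a :: chilbert_space \<Rightarrow> 'b :: chilbert_space) \<Rightarrow> bool" where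
  "clinear \<equiv> Vector_Spaces.linear scaleC scaleC"

definition clinear_on :: "'a :: chilbert_space set \<Rightarrow> ('a \<Rightarrow> 'b :: chilbert_space) \<Rightarrow> bool" where
  "clinear_on V f \<longleftrightarrow>
     (\<forall>x\<in>V. \<forall>y\<in>V. f (x + y) = f x + f y) \<and> (\<forall>c. \<forall>x\<in>V. f (c *\<^sub>C x) = c *\<^sub>C f x)"

text \<open>The library's dimension is \<open>0\<close> on infinite-dimensional spaces; this one is \<open>\<infinity>\<close> there.\<close>

definition ecdim :: "'a :: chilbert_space set \<Rightarrow> enat" where
  "ecdim V = (if \<exists>B. finite B \<and> V \<subseteq> cspan B then enat (cdim V) else \<infinity>)"

instantiation prod :: (chilbert_space, chilbert_space) chilbert_space
begin

definition scaleC_prod :: "complex \<Rightarrow> 'a \<times> 'b \<Rightarrow> 'a \<times> 'b" where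
  "c *\<^sub>C u = (c *\<^sub>C fst u, c *\<^sub>C snd u)"

definition cinner_prod :: "'a \<times> 'b \<Rightarrow> 'a \<times> 'b \<Rightarrow> complex" where
  "cinner u v = cinner (fst u) (fst v) + cinner (snd u) (snd v)"

instance
proof
  fix c d :: complex and r :: real and x y z :: "'a \<times> 'b"
  show "c *\<^sub>C (x + y) = c *\<^sub>C x + c *\<^sub>C y"
    by (simp add: scaleC_prod_def scaleC_add_right)
  show "(c + d) *\<^sub>C x = c *\<^sub>C x + d *\<^sub>C x"
    by (simp add: scaleC_prod_def scaleC_add_left)
  show "c *\<^sub>C d *\<^sub>C x = (c * d) *\<^sub>C x"
    by (simp add: scaleC_prod_def scaleC_scaleC)
  show "complex_of_real r *\<^sub>C x = r *\<^sub>R x"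
    by (simp add: scaleC_prod_def scaleC_of_real scaleR_prod_def)
  show "cinner x y = cnj (cinner y x)"
    using cinner_commute[of "fst x" "fst y"] cinner_commute[of "snd x" "snd y"]
    by (simp add: cinner_prod_def)
  show "cinner x (y + z) = cinner x y + cinner x z"
    by (simp add: cinner_prod_def cinner_add_right)
  show "cinner x (c *\<^sub>C y) = c * cinner x y"
    by (simp add: cinner_prod_def scaleC_prod_def cinner_scaleC_right distrib_left)
  show "cinner x x = complex_of_real ((norm x)\<^sup>2)"
    by (simp add: cinner_prod_def cinner_self norm_prod_def)
qed

end


section \<open>Unbounded operators\<close>

text \<open>
  An unbounded operator in \<open>'h\<close> is represented by its graph, a set of pairs; its domain is the
  relational \<open>Domain\<close>, extension of operators is inclusion, and an operator is closed iff its
  graph is closed in the product topology.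
\<close>

definition linear_operator :: "('h :: chilbert_space \<times> 'h) set \<Rightarrow> bool" where
  "linear_operator T \<longleftrightarrow> csubspace T \<and> single_valued T"

definition op_val :: "('h \<times> 'h) set \<Rightarrow> 'h \<Rightarrow> 'h" where
  "op_val T f = (THE g. (f, g) \<in> T)"

definition densely_defined :: "('h :: chilbert_space \<times> 'h) set \<Rightarrow> bool" where
  "densely_defined T \<longleftrightarrow> closure (Domain T) = UNIV"

definition adj :: "('h :: chilbert_space \<times> 'h) set \<Rightarrow> ('h \<times> 'h) set" where
  "adj T = {(g, h). \<forall>(f, f')\<in>T. cinner f' g = cinner f h}"

definition symmetric_op :: "('h :: chilbert_space \<times> 'h) set \<Rightarrow> bool" where
  "symmetric_op T \<longleftrightarrow> (\<forall>(f, f')\<in>T. \<forall>(g, g')\<in>T. cinner f g' = cinner f' g)"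

definition nonnegative_op :: "('h :: chilbert_space \<times> 'h) set \<Rightarrow> bool" where
  "nonnegative_op T \<longleftrightarrow> (\<forall>(f, f')\<in>T. Re (cinner f f') \<ge> 0)"

definition eigenspace :: "('h :: chilbert_space \<times> 'h) set \<Rightarrow> complex \<Rightarrow> 'h set" where
  "eigenspace T z = {f. (f, z *\<^sub>C f) \<in> T}"

definition has_defect_numbers :: "('h :: chilbert_space \<times> 'h) set \<Rightarrow> nat \<Rightarrow> nat \<Rightarrow> bool" where
  "has_defect_numbers S m n \<longleftrightarrow>
     ecdim (eigenspace (adj S) \<i>) = enat m \<and> ecdim (eigenspace (adj S) (- \<i>)) = enat n"

text \<open>
  Number of real eigenvalues in \<open>J\<close>, counted with (geometric) multiplicity. It is \<open>\<infinity>\<close> if there are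
  infinitely many of them or one of them has infinite multiplicity.
\<close>

definition eigenvalue_count :: "('h :: chilbert_space \<times> 'h) set \<Rightarrow> real set \<Rightarrow> enat" where
  "eigenvalue_count T J =
     (let E = {\<mu>\<in>J. eigenspace T (complex_of_real \<mu>) \<noteq> {0}}
      in if finite E then \<Sum>\<mu>\<in>E. ecdim (eigenspace T (complex_of_real \<mu>)) else \<infinity>)"

definition morse_index :: "('h :: chilbert_space \<times> 'h) set \<Rightarrow> enat" where
  "morse_index T = eigenvalue_count T {..<0}"

text \<open>Number of positive eigenvalues of \<open>A\<close> regarded as an operator on the subspace \<open>V\<close>.\<close>

definition n_plus_on :: "'k :: chilbert_space set \<Rightarrow> ('k \<Rightarrow> 'k) \<Rightarrow> enat" where
  "n_plus_on V A = eigenvalue_count ((\<lambda>x. (x, A x)) ` V) {0<..}"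


section \<open>Friedrichs extension\<close>

text \<open>
  The operator associated with the closure of the form \<open>(h, f) \<mapsto> \<langle>h, S f\<rangle>\<close> on \<open>dom S\<close>.
  \<open>form_approx S \<phi> f\<close> says that \<open>\<phi>\<close> is a sequence in \<open>dom S\<close> which converges to \<open>f\<close> and is Cauchy
  for the form; the form domain consists of the limits of such sequences, and the closed form is
  the limit of the values of the form along them.
\<close>

definition form_approx :: "('h :: chilbert_space \<times> 'h) set \<Rightarrow> (nat \<Rightarrow> 'h) \<Rightarrow> 'h \<Rightarrow> bool" where
  "form_approx S \<phi> f \<longleftrightarrow>
     range \<phi> \<subseteq> Domain S \<and> \<phi> \<longlonglongrightarrow> f \<and>
     (\<forall>e>0. \<exists>N. \<forall>j\<ge>N. \<forall>k\<ge>N. Re (cinner (\<phi> j - \<phi> k) (op_val S (\<phi> j - \<phi> k))) < e)"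

definition form_domain :: "('h :: chilbert_space \<times> 'h) set \<Rightarrow> 'h set" where
  "form_domain S = {f. \<exists>\<phi>. form_approx S \<phi> f}"

definition closed_form :: "('h :: chilbert_space \<times> 'h) set \<Rightarrow> 'h \<Rightarrow> 'h \<Rightarrow> complex" where
  "closed_form S h f =
     (THE z. \<forall>\<psi> \<phi>. form_approx S \<psi> h \<longrightarrow> form_approx S \<phi> f \<longrightarrow>
                (\<lambda>k. cinner (\<psi> k) (op_val S (\<phi> k))) \<longlonglongrightarrow> z)"

definition friedrichs :: "('h :: chilbert_space \<times> 'h) set \<Rightarrow> ('h \<times> 'h) set" where
  "friedrichs S =
     {(f, g). f \<in> form_domain S \<and> (\<forall>h\<in>form_domain S. closed_form S h f = cinner h g)}"


section \<open>Lagrangian planes and the Duistermaat index\<close>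

definition sympl :: "'k :: chilbert_space \<times> 'k \<Rightarrow> 'k \<times> 'k \<Rightarrow> complex" where
  "sympl u v = cinner (fst u) (snd v) - cinner (snd u) (fst v)"

definition lagrangian :: "('k :: chilbert_space \<times> 'k) set \<Rightarrow> bool" where
  "lagrangian L \<longleftrightarrow> csubspace L \<and> L = {u. \<forall>v\<in>L. sympl u v = 0}"

definition lagrangian_frame ::
  "('k :: chilbert_space \<Rightarrow> 'k) \<Rightarrow> ('k \<Rightarrow> 'k) \<Rightarrow> ('k \<times> 'k) set \<Rightarrow> bool" where
  "lagrangian_frame X Y L \<longleftrightarrow>
     lagrangian L \<and> clinear (\<lambda>\<kappa>. (X \<kappa>, Y \<kappa>)) \<and> inj (\<lambda>\<kappa>. (X \<kappa>, Y \<kappa>)) \<and>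
     range (\<lambda>\<kappa>. (X \<kappa>, Y \<kappa>)) = L"

text \<open>
  The form \<open>Q(\<alpha>, \<beta>; \<gamma>)\<close>: if \<open>\<alpha>\<close> and \<open>\<gamma>\<close> are transversal to \<open>\<beta>\<close>, then \<open>\<gamma>\<close> is the graph
  of a linear map from \<open>\<alpha>\<close> to \<open>\<beta>\<close>, and the description below is its value at \<open>u\<^sub>2\<close>.
\<close>

definition lagr_form ::
  "('k :: chilbert_space \<times> 'k) set \<Rightarrow> ('k \<times> 'k) set \<Rightarrow> ('k \<times> 'k) set \<Rightarrow>
   'k \<times> 'k \<Rightarrow> 'k \<times> 'k \<Rightarrow> complex" where
  "lagr_form \<alpha> \<beta> \<gamma> u\<^sub>1 u\<^sub>2 = sympl u\<^sub>1 (THE v. v \<in> \<beta> \<and> u\<^sub>2 + v \<in> \<gamma>)"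

text \<open>Only used for finite-dimensional \<open>V\<close>, where the maximum exists.\<close>

definition form_n_minus ::
  "'a :: chilbert_space set \<Rightarrow> ('a \<Rightarrow> 'a \<Rightarrow> complex) \<Rightarrow> nat" where
  "form_n_minus V q =
     Max {cdim W | W. csubspace W \<and> W \<subseteq> V \<and> (\<forall>u\<in>W. u \<noteq> 0 \<longrightarrow> Re (q u u) < 0)}"

definition duistermaat_via ::
  "('k :: chilbert_space \<times> 'k) set \<Rightarrow> ('k \<times> 'k) set \<Rightarrow> ('k \<times> 'k) set \<Rightarrow> ('k \<times> 'k) set \<Rightarrow> int" where
  "duistermaat_via L' L\<^sub>1 L\<^sub>2 L\<^sub>3 =
     int (form_n_minus L\<^sub>2 (lagr_form L\<^sub>2 L' L\<^sub>3))
     - int (form_n_minus L\<^sub>1 (lagr_form L\<^sub>1 L' L\<^sub>3))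
     + int (form_n_minus L\<^sub>1 (lagr_form L\<^sub>1 L' L\<^sub>2))"

definition duistermaat_index ::
  "('k :: chilbert_space \<times> 'k) set \<Rightarrow> ('k \<times> 'k) set \<Rightarrow> ('k \<times> 'k) set \<Rightarrow> int" where
  "duistermaat_index L\<^sub>1 L\<^sub>2 L\<^sub>3 =
     duistermaat_via
       (SOME L'. lagrangian L' \<and> L' \<inter> L\<^sub>1 = {0} \<and> L' \<inter> L\<^sub>2 = {0} \<and> L' \<inter> L\<^sub>3 = {0}) L\<^sub>1 L\<^sub>2 L\<^sub>3"


section \<open>Boundary triplets\<close>

definition boundary_triplet ::
  "nat \<Rightarrow> ('h :: chilbert_space \<times> 'h) set \<Rightarrow>
   ('h \<Rightarrow> 'k :: chilbert_space) \<Rightarrow> ('h \<Rightarrow> 'k) \<Rightarrow> bool" where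
  "boundary_triplet n S \<Gamma>\<^sub>0 \<Gamma>\<^sub>1 \<longleftrightarrow>
     ecdim (UNIV :: 'k set) = enat n \<and>
     clinear_on (Domain (adj S)) \<Gamma>\<^sub>0 \<and> clinear_on (Domain (adj S)) \<Gamma>\<^sub>1 \<and>
     (\<lambda>f. (\<Gamma>\<^sub>0 f, \<Gamma>\<^sub>1 f)) ` Domain (adj S) = UNIV \<and>
     (\<forall>(f, f')\<in>adj S. \<forall>(g, g')\<in>adj S.
        cinner f g' - cinner f' g = cinner (\<Gamma>\<^sub>0 f) (\<Gamma>\<^sub>1 g) - cinner (\<Gamma>\<^sub>1 f) (\<Gamma>\<^sub>0 g))"

definition extension_of_plane ::
  "('h :: chilbert_space \<times> 'h) set \<Rightarrow> ('h \<Rightarrow> 'k :: chilbert_space) \<Rightarrow> ('h \<Rightarrow> 'k) \<Rightarrow>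
   ('k \<times> 'k) set \<Rightarrow> ('h \<times> 'h) set" where
  "extension_of_plane S \<Gamma>\<^sub>0 \<Gamma>\<^sub>1 L = {(f, g) \<in> adj S. (\<Gamma>\<^sub>0 f, \<Gamma>\<^sub>1 f) \<in> L}"

definition cauchy_data ::
  "('h :: chilbert_space \<times> 'h) set \<Rightarrow> ('h \<Rightarrow> 'k :: chilbert_space) \<Rightarrow> ('h \<Rightarrow> 'k) \<Rightarrow>
   real \<Rightarrow> ('k \<times> 'k) set" where
  "cauchy_data S \<Gamma>\<^sub>0 \<Gamma>\<^sub>1 s =
     (\<lambda>f. (\<Gamma>\<^sub>0 f, \<Gamma>\<^sub>1 f)) ` eigenspace (adj S) (complex_of_real s)"

definition left_graph_limit :: "(real \<Rightarrow> 'a :: chilbert_space set) \<Rightarrow> real \<Rightarrow> 'a set" where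
  "left_graph_limit M a = {u. \<exists>v. (\<forall>s<a. v s \<in> M s) \<and> (v \<longlongrightarrow> u) (at_left a)}"


section \<open>Orthogonal projectors and self-adjoint operators on a subspace\<close>

definition orthogonal_projector :: "('k :: chilbert_space \<Rightarrow> 'k) \<Rightarrow> bool" where
  "orthogonal_projector P \<longleftrightarrow>
     clinear P \<and> (\<forall>x. P (P x) = P x) \<and> (\<forall>x y. cinner (P x) y = cinner x (P y))"

text \<open>Self-adjointness of an everywhere defined operator on the finite-dimensional space \<open>V\<close>.\<close>

definition selfadjoint_on :: "'k :: chilbert_space set \<Rightarrow> ('k \<Rightarrow> 'k) \<Rightarrow> bool" where
  "selfadjoint_on V A \<longleftrightarrow>
     clinear_on V A \<and> A ` V \<subseteq> V \<and> (\<forall>x\<in>V. \<forall>y\<in>V. cinner (A x) y = cinner x (A y))"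

end

theory Submission
  imports Defs
begin

text \<open>
  Every \<open>s < 0\<close> lies in the resolvent set of the Friedrichs extension, so each boundary value \<open>u\<close>
  splits as \<open>u = m s u + fr s u\<close> along \<open>M(s)\<close> and \<open>F\<close>. On \<open>L\<close> the form
  \<open>q s (u, v) = \<omega>(m s u, fr s v)\<close> is Hermitian, its radical is \<open>(L \<inter> M(s)) + (L \<inter> F)\<close>, and it is
  strictly decreasing in \<open>s\<close> off \<open>L \<inter> F\<close>, because \<open>\<omega>\<close> pairs the boundary values of
  \<open>f \<in> ker (S\<^sup>* - s)\<close> and \<open>g \<in> ker (S\<^sup>* - t)\<close> to \<open>(t - s) \<langle>f, g\<rangle>\<close>. The form property of the
  Friedrichs extension makes \<open>q s\<close> nonnegative for \<open>s\<close> near \<open>-\<infinity>\<close>. Hence the negative index of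
  \<open>q s\<close> grows exactly by \<open>dim (L \<inter> M(s)) = dim ker (H - s)\<close> at each \<open>s\<close>, and near \<open>0-\<close> it equals the
  Morse index. It also equals \<open>\<iota>(M(s), L, F)\<close>, since \<open>\<iota>\<close> is the negative index of the Kashiwara form
  up to dimensions that do not involve the auxiliary plane. With \<open>M(s\<^sub>0)\<close> as auxiliary plane the
  path is an increasing bounded family of Hermitian forms on \<open>F\<close>, which yields both the existence
  of \<open>M(0-)\<close> and the continuity of the indices from the left.
\<close>

text \<open>The obstacle is that \<open>M(0-)\<close> may meet both \<open>L\<close> and
  \<open>F\<close>, so the split form need not exist at 0 and the index there is reached only as a
  limit. The comparison is made in the chart of planes transversal to one
  \<open>M(s\<^sub>0)\<close>: strict monotonicity keeps this plane transversal to all later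
  \<open>M(s)\<close>, and taking \<open>s\<^sub>0\<close> below a point where the form on
  \<open>L\<close> is nonnegative keeps it transversal to \<open>L\<close>. Monotonicity rests on
  the identity \<open>q t (u, u) = q s (u, u) - \<omega>(m s u, m t u)\<close>. Nonnegativity near
  \<open>-\<infinity>\<close> is a compactness argument: unit vectors of \<open>L\<close> orthogonal
  to \<open>L \<inter> F\<close> with negative values would accumulate at some \<open>u\<close> with
  \<open>q s (u, u) \<le> 0\<close> for all \<open>s\<close>. Such a \<open>u\<close> lies in
  \<open>F\<close>, because near-minimizers of the energy of \<open>f - \<phi>\<close> over
  \<open>\<phi>\<close> in the domain of \<open>S\<close> are then Cauchy for the form. The spectral
  theorem is avoided throughout: the resolvent comes from minimization, inertia from eliminating one
  vector at a time, and positive eigenvalues of a self-adjoint operator in finite dimension are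
  counted by the same crossing argument.\<close>

section \<open>Complex inner products, norms and subspaces\<close>

lemma cinner_add_left: "cinner (x + y) z = cinner x z + cinner y z"
  by (metis cinner_add_right cinner_commute complex_cnj_add)

lemma cinner_scaleC_left: "cinner (c *\<^sub>C x) y = cnj c * cinner x y"
  by (metis cinner_commute cinner_scaleC_right complex_cnj_mult)

lemma cinner_scaleR_right: "cinner x (r *\<^sub>R y) = r *\<^sub>R cinner x y"
  by (metis cinner_scaleC_right scaleC_of_real scaleR_conv_of_real)

lemma cinner_scaleR_left: "cinner (r *\<^sub>R x) y = r *\<^sub>R cinner x y"
  by (metis cinner_scaleC_left scaleC_of_real scaleR_conv_of_real complex_cnj_complex_of_real)

lemma Re_cinner_self: "Re (cinner x x) = (norm x)\<^sup>2"
  by (simp add: cinner_self)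

lemma cinner_zero_right [simp]: "cinner x 0 = 0"
  using cinner_scaleR_right[of x 0 0] by simp

lemma cinner_zero_left [simp]: "cinner 0 x = 0"
  using cinner_scaleR_left[of 0 0 x] by simp

lemma cinner_minus_right: "cinner x (- y) = - cinner x y"
  using cinner_scaleR_right[of x "-1" y] by simp

lemma cinner_minus_left: "cinner (- x) y = - cinner x y"
  using cinner_scaleR_left[of "-1" x y] by simp

lemma cinner_diff_right: "cinner x (y - z) = cinner x y - cinner x z"
  using cinner_add_right[of x y "- z"] by (simp add: cinner_minus_right)

lemma cinner_diff_left: "cinner (x - y) z = cinner x z - cinner y z"
  using cinner_add_left[of x "- y" z] by (simp add: cinner_minus_left)

lemmas cinner_simps = cinner_add_left cinner_add_right cinner_diff_left cinner_diff_right
  cinner_minus_left cinner_minus_right cinner_scaleC_left cinner_scaleC_right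

lemma cinner_self_eq_zero_iff [simp]: "cinner x x = 0 \<longleftrightarrow> x = 0"
  by (simp add: cinner_self)

text \<open>The class fixes the norm of real multiples only, so complex homogeneity has to come from
  \<open>cinner_self\<close>: the inner square of \<open>c *\<^sub>C x\<close> is
  \<open>c * cnj c\<close> times that of \<open>x\<close>.\<close>

lemma norm_scaleC: "norm (c *\<^sub>C x) = cmod c * norm x" for x :: "'a :: chilbert_space"
proof -
  have "complex_of_real ((norm (c *\<^sub>C x))\<^sup>2) = (c * cnj c) * cinner x x"
    unfolding cinner_self[symmetric] by (simp add: cinner_simps mult_ac)
  also have "\<dots> = complex_of_real ((cmod c * norm x)\<^sup>2)"
    unfolding complex_norm_square[symmetric] by (simp add: cinner_self power_mult_distrib)
  finally have "complex_of_real ((norm (c *\<^sub>C x))\<^sup>2) = complex_of_real ((cmod c * norm x)\<^sup>2)" .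
  then have "(norm (c *\<^sub>C x))\<^sup>2 = (cmod c * norm x)\<^sup>2"
    using of_real_eq_iff by blast
  then show ?thesis
    by (simp add: power2_eq_iff_nonneg)
qed

lemma scaleC_minus_one: "(-1) *\<^sub>C x = - (x :: 'a :: chilbert_space)"
  using scaleC_of_real[of "-1" x] by simp

lemma scaleC_diff_right: "c *\<^sub>C (x - y) = c *\<^sub>C x - c *\<^sub>C (y :: 'a :: chilbert_space)"
  by (rule complex_vector.scale_right_diff_distrib)

text \<open>Stated for three numbers so that it serves the inner product and every nonnegative
  Hermitian form alike: \<open>x\<close>, \<open>y\<close>, \<open>z\<close> stand for the values at
  \<open>(u, u)\<close>, \<open>(u, v)\<close>, \<open>(v, v)\<close>, and the first hypothesis is
  nonnegativity at \<open>u + c v\<close>.\<close>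

lemma semidefinite_Cauchy_Schwarz:
  fixes x y z :: complex
  assumes nonneg: "\<And>c. 0 \<le> Re (x + c * y + cnj c * cnj y + c * cnj c * z)"
    and z: "0 \<le> Re z"
  shows "(cmod y)\<^sup>2 \<le> Re x * Re z"
proof -
  have yy: "y * cnj y = of_real ((cmod y)\<^sup>2)"
    by (simp only: complex_norm_square)
  have *: "0 \<le> Re x - 2 * t * (cmod y)\<^sup>2 + t\<^sup>2 * (cmod y)\<^sup>2 * Re z" for t :: real
  proof -
    \<comment> \<open>This phase turns both mixed terms into the same real number and leaves a real
      quadratic in \<open>t\<close>.\<close>
    define c where "c = - (of_real t * cnj y)"
    have "c * y = - of_real (t * (cmod y)\<^sup>2)" "cnj c * cnj y = - of_real (t * (cmod y)\<^sup>2)"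
      "c * cnj c = of_real (t\<^sup>2 * (cmod y)\<^sup>2)"
      using yy by (simp_all add: c_def mult_ac power2_eq_square)
    then show ?thesis
      using nonneg[of c] by simp
  qed
  consider "y = 0" | "y \<noteq> 0" "Re z = 0" | "y \<noteq> 0" "Re z > 0" using z by linarith
  then show ?thesis
  proof cases
    case 1
    then show ?thesis using *[of 0] z by simp
  next
    case 2
    define d where "d = (cmod y)\<^sup>2"
    have "d > 0" using 2 by (simp add: d_def)
    \<comment> \<open>With \<open>Re z = 0\<close> the quadratic is affine in \<open>t\<close>; this
      \<open>t\<close> gives it the value -1.\<close>
    have "0 \<le> Re x - 2 * ((Re x + 1) / (2 * d)) * d"
      using *[of "(Re x + 1) / (2 * d)"] 2 by (simp add: d_def)
    moreover have "2 * ((Re x + 1) / (2 * d)) * d = Re x + 1"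
      using \<open>d > 0\<close> by (simp add: field_simps)
    ultimately show ?thesis by simp
  next
    case 3
    have "0 \<le> Re x - 2 * (1 / Re z) * (cmod y)\<^sup>2 + (1 / Re z)\<^sup>2 * (cmod y)\<^sup>2 * Re z"
      by (rule *)
    also have "\<dots> = Re x - (cmod y)\<^sup>2 / Re z"
      using 3 by (simp add: field_simps power2_eq_square)
    finally show ?thesis using 3 by (simp add: field_simps)
  qed
qed

lemma cmod_cinner_le: "cmod (cinner x y) \<le> norm x * norm y"
proof -
  have "(cmod (cinner x y))\<^sup>2 \<le> Re (cinner x x) * Re (cinner y y)"
  proof (rule semidefinite_Cauchy_Schwarz)
    fix c
    have "cinner (x + c *\<^sub>C y) (x + c *\<^sub>C y)
        = cinner x x + c * cinner x y + cnj c * cnj (cinner x y) + c * cnj c * cinner y y"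
      by (simp add: cinner_simps cinner_commute[of y x] algebra_simps)
    then show "0 \<le> Re (cinner x x + c * cinner x y + cnj c * cnj (cinner x y) + c * cnj c * cinner y y)"
      by (metis Re_cinner_self zero_le_power2)
  qed (simp add: cinner_self)
  then have "(cmod (cinner x y))\<^sup>2 \<le> (norm x * norm y)\<^sup>2"
    by (simp add: Re_cinner_self power_mult_distrib)
  then show ?thesis
    by (rule power2_le_imp_le) simp
qed

lemma bounded_bilinear_cinner: "bounded_bilinear cinner"
  by (rule bounded_bilinear.intro)
    (auto simp: cinner_simps cinner_scaleR_left cinner_scaleR_right
      intro!: exI[of _ 1] cmod_cinner_le)

lemmas tendsto_cinner = bounded_bilinear.tendsto[OF bounded_bilinear_cinner]

lemma tendsto_scaleC:
  fixes f :: "'b \<Rightarrow> 'a :: chilbert_space"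
  assumes "(g \<longlongrightarrow> c) A" "(f \<longlongrightarrow> x) A"
  shows "((\<lambda>k. g k *\<^sub>C f k) \<longlongrightarrow> c *\<^sub>C x) A"
proof (rule bounded_bilinear.tendsto[OF bounded_bilinear.intro assms])
  show "(r *\<^sub>R a) *\<^sub>C b = r *\<^sub>R (a *\<^sub>C b)" "a *\<^sub>C (r *\<^sub>R b) = r *\<^sub>R (a *\<^sub>C b)" for r a and b :: 'a
    by (simp_all add: scaleC_of_real[symmetric] scaleC_scaleC scaleR_conv_of_real mult.commute)
qed (auto simp: scaleC_add_left scaleC_add_right norm_scaleC intro!: exI[of _ 1])

lemma csubspaceI:
  "0 \<in> V \<Longrightarrow> (\<And>x y. x \<in> V \<Longrightarrow> y \<in> V \<Longrightarrow> x + y \<in> V) \<Longrightarrow>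
    (\<And>c x. x \<in> V \<Longrightarrow> c *\<^sub>C x \<in> V) \<Longrightarrow> csubspace V"
  by (simp add: complex_vector.subspace_def)

lemma csubspaceD:
  assumes "csubspace V"
  shows "0 \<in> V" "x \<in> V \<Longrightarrow> y \<in> V \<Longrightarrow> x + y \<in> V" "x \<in> V \<Longrightarrow> c *\<^sub>C x \<in> V"
    "x \<in> V \<Longrightarrow> y \<in> V \<Longrightarrow> x - y \<in> V" "x \<in> V \<Longrightarrow> - x \<in> V" "x \<in> V \<Longrightarrow> r *\<^sub>R x \<in> V"
  using assms complex_vector.subspace_diff[OF assms] complex_vector.subspace_neg[OF assms]
    scaleC_of_real[of r x]
  by (auto simp: complex_vector.subspace_def) metis


section \<open>Finite-dimensional spaces\<close>

text \<open>A predicate on types rather than a class: finite dimension of the boundary space becomes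
  known only from the boundary triplet.\<close>

definition finite_cdim :: "'a :: chilbert_space itself \<Rightarrow> bool" where
  "finite_cdim _ \<longleftrightarrow> (\<exists>B::'a set. finite B \<and> cspan B = UNIV)"

lemma finite_cdim_locale:
  assumes "finite_cdim TYPE('a :: chilbert_space)"
  obtains B :: "'a :: chilbert_space set" where "finite_dimensional_vector_space scaleC B"
proof -
  obtain C :: "'a set" where C: "finite C" "cspan C = UNIV"
    using assms by (auto simp: finite_cdim_def)
  obtain B :: "'a set" where B: "B \<subseteq> UNIV" "\<not> cdependent B" "UNIV \<subseteq> cspan B"
    by (rule complex_vector.basis_exists[of UNIV]) blast
  have "finite B"
    using complex_vector.independent_span_bound[OF C(1) B(2)] C(2) by auto
  with B have "finite_dimensional_vector_space scaleC B"
    by unfold_locales (auto simp: cdependent_def cspan_def)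
  then show thesis by (rule that)
qed

lemma
  assumes fin: "finite_cdim TYPE('a :: chilbert_space)"
  shows cdim_mono: "V \<subseteq> W \<Longrightarrow> cdim V \<le> cdim (W :: 'a set)"
    and cdim_eq_imp_eq:
      "csubspace V \<Longrightarrow> csubspace W \<Longrightarrow> V \<subseteq> W \<Longrightarrow> cdim W \<le> cdim V \<Longrightarrow> V = (W :: 'a set)"
    and cdim_sums_Int: "csubspace V \<Longrightarrow> csubspace W \<Longrightarrow>
      cdim {x + y |x y. x \<in> V \<and> y \<in> W} + cdim (V \<inter> W) = cdim V + cdim (W :: 'a set)"
    and cdim_eq_0: "cdim V = 0 \<longleftrightarrow> V \<subseteq> {0 :: 'a}"
proof -
  obtain B :: "'a set" where "finite_dimensional_vector_space scaleC B"
    using finite_cdim_locale[OF fin] .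
  then interpret finite_dimensional_vector_space scaleC B .
  show "V \<subseteq> W \<Longrightarrow> cdim V \<le> cdim W" for V W :: "'a set"
    unfolding cdim_def by (rule dim_subset)
  show "csubspace V \<Longrightarrow> csubspace W \<Longrightarrow> V \<subseteq> W \<Longrightarrow> cdim W \<le> cdim V \<Longrightarrow> V = W" for V W :: "'a set"
    unfolding cdim_def csubspace_def by (rule subspace_dim_equal)
  show "csubspace V \<Longrightarrow> csubspace W \<Longrightarrow>
      cdim {x + y |x y. x \<in> V \<and> y \<in> W} + cdim (V \<inter> W) = cdim V + cdim W" for V W :: "'a set"
    unfolding cdim_def csubspace_def by (rule dim_sums_Int)
  show "cdim V = 0 \<longleftrightarrow> V \<subseteq> {0}" for V :: "'a set"
    unfolding cdim_def by (rule dim_eq_0)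
qed

lemma cdim_direct_sum:
  fixes V W :: "'a :: chilbert_space set"
  assumes fin: "finite_cdim TYPE('a :: chilbert_space)"
    and "csubspace V" "csubspace W" "V \<inter> W \<subseteq> {0}"
  shows "cdim {x + y |x y. x \<in> V \<and> y \<in> W} = cdim V + cdim W"
  using cdim_sums_Int[OF assms(1-3)] assms(4) cdim_eq_0[OF fin, of "V \<inter> W"] by simp

lemma cdim_disjoint_le:
  fixes V W X :: "'a :: chilbert_space set"
  assumes fin: "finite_cdim TYPE('a :: chilbert_space)"
    and "csubspace V" "csubspace W" "V \<inter> W \<subseteq> {0}" "csubspace X" "V \<subseteq> X" "W \<subseteq> X"
  shows "cdim V + cdim W \<le> cdim X"
  unfolding cdim_direct_sum[OF assms(1-4), symmetric]
  using assms by (intro cdim_mono[OF fin]) (auto intro: csubspaceD)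

lemma cdim_cover_le:
  fixes V W X :: "'a :: chilbert_space set"
  assumes fin: "finite_cdim TYPE('a :: chilbert_space)"
    and "csubspace V" "csubspace W" "\<And>x. x \<in> X \<Longrightarrow> \<exists>v\<in>V. \<exists>w\<in>W. x = v + w"
  shows "cdim X \<le> cdim V + cdim W"
proof -
  have "cdim X \<le> cdim {x + y |x y. x \<in> V \<and> y \<in> W}"
    using assms(4) by (intro cdim_mono[OF fin]) blast
  then show ?thesis
    using cdim_sums_Int[OF assms(1-3)] by linarith
qed

lemma ecdim_eq: "finite_cdim TYPE('a :: chilbert_space) \<Longrightarrow> ecdim V = enat (cdim V)" for V :: "'a :: chilbert_space set"
  by (auto simp: ecdim_def finite_cdim_def)

lemma csubspace_sums: "csubspace V \<Longrightarrow> csubspace W \<Longrightarrow> csubspace {x + y |x y. x \<in> V \<and> y \<in> W}"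
  by (rule complex_vector.subspace_sums)

text \<open>Boundary maps are linear on a domain only, while the facts on images and spans concern
  total linear maps; prescribing \<open>f\<close> on a basis of \<open>V\<close> provides
  one.\<close>

lemma clinear_on_extend:
  fixes f :: "'a :: chilbert_space \<Rightarrow> 'b :: chilbert_space"
  assumes "csubspace V" "clinear_on V f"
  obtains g where "clinear g" "\<And>x. x \<in> V \<Longrightarrow> g x = f x"
proof -
  interpret vector_space_pair "scaleC :: _ \<Rightarrow> 'a \<Rightarrow> _" "scaleC :: _ \<Rightarrow> 'b \<Rightarrow> _"
    by unfold_locales
  obtain B where B: "B \<subseteq> V" "\<not> cdependent B" "V \<subseteq> cspan B"
    by (rule complex_vector.basis_exists[of V]) blast
  obtain g where g: "clinear g" "\<And>x. x \<in> B \<Longrightarrow> g x = f x"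
    using linear_independent_extend[OF B(2)[unfolded cdependent_def], of f] by blast
  interpret g: Vector_Spaces.linear scaleC scaleC g by (rule g(1))
  have "g x = f x" if "x \<in> V" for x
  proof -
    have "x \<in> cspan B" using that B(3) by blast
    then have "x \<in> V \<and> g x = f x"
    proof (induction rule: complex_vector.span_induct_alt)
      case base
      have "f (0 *\<^sub>C 0) = 0 *\<^sub>C f 0"
        using assms csubspaceD(1) unfolding clinear_on_def by blast
      then show ?case using csubspaceD(1)[OF assms(1)] g.zero by simp
    next
      case (step c b y)
      have "b \<in> V" using step(1) B(1) by blast
      moreover have "c *\<^sub>C b \<in> V" using csubspaceD(3)[OF assms(1)] \<open>b \<in> V\<close> .
      ultimately show ?case
        using step g(2)[of b] assms csubspaceD(2)[OF assms(1), of "c *\<^sub>C b" y]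
        by (simp add: g.add g.scale clinear_on_def)
    qed
    then show ?thesis by simp
  qed
  then show thesis using g(1) that by blast
qed

text \<open>Neither space is assumed finite-dimensional, because the eigenspaces of an extension
  live in the Hilbert space and are measured through their boundary values. So the case
  \<open>ecdim V = \<infinity>\<close> has to be transported as well.\<close>

lemma clinear_on_image:
  fixes f :: "'a :: chilbert_space \<Rightarrow> 'b :: chilbert_space"
  assumes V: "csubspace V" and f: "clinear_on V f" and inj: "inj_on f V"
  shows csubspace_clinear_on_image: "csubspace (f ` V)"
    and cdim_clinear_on_image: "cdim (f ` V) = cdim V"
    and ecdim_clinear_on_image: "ecdim (f ` V) = ecdim V"
proof -
  interpret vector_space_pair "scaleC :: _ \<Rightarrow> 'a \<Rightarrow> _" "scaleC :: _ \<Rightarrow> 'b \<Rightarrow> _"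
    by unfold_locales
  obtain g where g: "clinear g" "\<And>x. x \<in> V \<Longrightarrow> g x = f x"
    using clinear_on_extend[OF V f] by blast
  have im: "f ` V = g ` V" using g(2) by force
  have gin: "inj_on g V" using inj g(2) by (simp add: inj_on_def)
  show "csubspace (f ` V)"
    unfolding im csubspace_def by (rule linear_subspace_image[OF g(1)]) (use V in \<open>simp add: csubspace_def\<close>)
  obtain B where B: "B \<subseteq> V" "\<not> cdependent B" "V \<subseteq> cspan B" "card B = cdim V"
    by (rule complex_vector.basis_exists[of V]) blast
  have sp: "cspan B = V"
    using B V complex_vector.span_minimal[of B V] by blast
  have ind: "\<not> cdependent (g ` B)"
    unfolding cdependent_def
    by (rule linear_independent_injective_image[OF g(1)])
      (use B(2) gin sp in \<open>simp_all add: cdependent_def cspan_def\<close>)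
  have span_g: "cspan (g ` C) = g ` cspan C" for C
    unfolding cspan_def by (rule linear_span_image[OF g(1)])
  have c1: "card (g ` B) = card B"
    using gin B(1) by (metis card_image inj_on_subset)
  show dim: "cdim (f ` V) = cdim V"
  proof -
    have "cdim (g ` V) = card (g ` B)"
      using complex_vector.dim_eq_card[of "g ` B" "g ` V"] ind span_g[of B] sp V
      by (metis complex_vector.span_span)
    then show ?thesis using im c1 B(4) by simp
  qed
  have "(\<exists>C. finite C \<and> V \<subseteq> cspan C) \<longleftrightarrow> (\<exists>C. finite C \<and> g ` V \<subseteq> cspan C)"
  proof
    assume "\<exists>C. finite C \<and> V \<subseteq> cspan C"
    then obtain C where "finite C" "V \<subseteq> cspan C" by blast
    then show "\<exists>C. finite C \<and> g ` V \<subseteq> cspan C"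
      using span_g[of C] by (intro exI[of _ "g ` C"]) auto
  next
    assume "\<exists>C. finite C \<and> g ` V \<subseteq> cspan C"
    then obtain C where C: "finite C" "g ` V \<subseteq> cspan C" by blast
    have "finite (g ` B)"
      using complex_vector.independent_span_bound[OF C(1) ind] B(1) C(2) by blast
    moreover have "inj_on g B" using gin B(1) by (rule inj_on_subset)
    ultimately have "finite B" by (rule finite_imageD)
    then show "\<exists>C. finite C \<and> V \<subseteq> cspan C" using B(3) by blast
  qed
  then show "ecdim (f ` V) = ecdim V"
    using dim im by (simp add: ecdim_def)
qed

lemma csubspace_Times: "csubspace V \<Longrightarrow> csubspace W \<Longrightarrow> csubspace (V \<times> W)"
  by (auto intro!: csubspaceI simp: scaleC_prod_def zero_prod_def csubspaceD)

lemma clinear_on_diff: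
  assumes "csubspace V" "clinear_on V f" "x \<in> V" "y \<in> V"
  shows "f (x - y) = f x - f y"
proof -
  have "f (x + (-1) *\<^sub>C y) = f x + (-1) *\<^sub>C f y"
    using assms csubspaceD(3)[OF assms(1,4), of "-1"] unfolding clinear_on_def by presburger
  then show ?thesis by (simp add: scaleC_minus_one)
qed

lemma cspan_clinear_mem:
  fixes f :: "'a :: chilbert_space \<Rightarrow> 'b :: chilbert_space"
  assumes f: "clinear f" and "f ` A \<subseteq> C" "x \<in> cspan A"
  shows "f x \<in> cspan C"
proof -
  interpret vector_space_pair "scaleC :: _ \<Rightarrow> 'a \<Rightarrow> _" "scaleC :: _ \<Rightarrow> 'b \<Rightarrow> _"
    by unfold_locales
  have "f x \<in> cspan (f ` A)"
    using assms(3) linear_span_image[OF f, of A] unfolding cspan_def by blast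
  then show ?thesis using complex_vector.span_mono[OF assms(2)] by blast
qed

lemma finite_cdim_prod:
  assumes "finite_cdim TYPE('a :: chilbert_space)" "finite_cdim TYPE('b :: chilbert_space)"
  shows "finite_cdim TYPE('a \<times> 'b)"
proof -
  obtain A :: "'a set" where A: "finite A" "cspan A = UNIV" using assms(1) by (auto simp: finite_cdim_def)
  obtain B :: "'b set" where B: "finite B" "cspan B = UNIV" using assms(2) by (auto simp: finite_cdim_def)
  define C where "C = (\<lambda>a. (a, 0::'b)) ` A \<union> (\<lambda>b. (0::'a, b)) ` B"
  have 1: "(a, 0) \<in> cspan C" for a
    by (rule cspan_clinear_mem[of "\<lambda>a. (a, 0)" A])
      (auto simp: C_def A Vector_Spaces.linear_iff complex_vector.vector_space_axioms scaleC_prod_def)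
  have 2: "(0, b) \<in> cspan C" for b
    by (rule cspan_clinear_mem[of "\<lambda>b. (0, b)" B])
      (auto simp: C_def B Vector_Spaces.linear_iff complex_vector.vector_space_axioms scaleC_prod_def)
  have "(a, b) \<in> cspan C" for a b
    using complex_vector.span_add[OF 1[of a] 2[of b]] by simp
  then have "cspan C = UNIV" by auto
  then show ?thesis
    using A B unfolding finite_cdim_def by (intro exI[of _ C]) (simp add: C_def)
qed

lemma cdim_Times:
  assumes "finite_cdim TYPE('a :: chilbert_space)" "finite_cdim TYPE('b :: chilbert_space)"
    and V: "csubspace V" and W: "csubspace W"
  shows "cdim (V \<times> W :: ('a \<times> 'b) set) = cdim V + cdim W"
proof -
  note fin = finite_cdim_prod[OF assms(1,2)]
  have iV: "csubspace ((\<lambda>a. (a, 0::'b)) ` V)" "cdim ((\<lambda>a. (a, 0::'b)) ` V) = cdim V"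
    by (rule clinear_on_image[OF V]; auto simp: clinear_on_def scaleC_prod_def inj_on_def)+
  have iW: "csubspace ((\<lambda>b. (0::'a, b)) ` W)" "cdim ((\<lambda>b. (0::'a, b)) ` W) = cdim W"
    by (rule clinear_on_image[OF W]; auto simp: clinear_on_def scaleC_prod_def inj_on_def)+
  have "V \<times> W = {x + y |x y. x \<in> (\<lambda>a. (a, 0::'b)) ` V \<and> y \<in> (\<lambda>b. (0::'a, b)) ` W}"
    by force
  then show ?thesis
    using cdim_direct_sum[OF fin iV(1) iW(1)] iV(2) iW(2) by (auto simp: zero_prod_def)
qed

section \<open>Hermitian forms\<close>

text \<open>Relative to a subspace, since the split forms below are symmetric on Lagrangian planes
  but in general not on the whole space. Linearity is asked of the second argument only; symmetry
  yields the rest.\<close>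

definition hermitian_on :: "'a :: chilbert_space set \<Rightarrow> ('a \<Rightarrow> 'a \<Rightarrow> complex) \<Rightarrow> bool" where
  "hermitian_on V q \<longleftrightarrow> csubspace V \<and>
     (\<forall>u\<in>V. \<forall>v\<in>V. \<forall>w\<in>V. q u (v + w) = q u v + q u w) \<and>
     (\<forall>c. \<forall>u\<in>V. \<forall>v\<in>V. q u (c *\<^sub>C v) = c * q u v) \<and>
     (\<forall>u\<in>V. \<forall>v\<in>V. q u v = cnj (q v u))"

abbreviation negative_on :: "'a :: chilbert_space set \<Rightarrow> ('a \<Rightarrow> 'a \<Rightarrow> complex) \<Rightarrow> bool" where
  "negative_on W q \<equiv> \<forall>u\<in>W. u \<noteq> 0 \<longrightarrow> Re (q u u) < 0"

abbreviation nonneg_on :: "'a :: chilbert_space set \<Rightarrow> ('a \<Rightarrow> 'a \<Rightarrow> complex) \<Rightarrow> bool" where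
  "nonneg_on U q \<equiv> \<forall>u\<in>U. 0 \<le> Re (q u u)"

lemma hermitian_onD:
  assumes "hermitian_on V q"
  shows "csubspace V"
    and "u \<in> V \<Longrightarrow> v \<in> V \<Longrightarrow> w \<in> V \<Longrightarrow> q u (v + w) = q u v + q u w"
    and "u \<in> V \<Longrightarrow> v \<in> V \<Longrightarrow> q u (c *\<^sub>C v) = c * q u v"
    and "u \<in> V \<Longrightarrow> v \<in> V \<Longrightarrow> q u v = cnj (q v u)"
    and "u \<in> V \<Longrightarrow> v \<in> V \<Longrightarrow> w \<in> V \<Longrightarrow> q (u + v) w = q u w + q v w"
    and "u \<in> V \<Longrightarrow> v \<in> V \<Longrightarrow> q (c *\<^sub>C u) v = cnj c * q u v"
    and "u \<in> V \<Longrightarrow> q u 0 = 0"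
    and "u \<in> V \<Longrightarrow> Im (q u u) = 0"
    and "u \<in> V \<Longrightarrow> v \<in> V \<Longrightarrow> w \<in> V \<Longrightarrow> q u (v - w) = q u v - q u w"
    and "u \<in> V \<Longrightarrow> v \<in> V \<Longrightarrow> w \<in> V \<Longrightarrow> q (u - v) w = q u w - q v w"
    and "u \<in> V \<Longrightarrow> q 0 u = 0"
proof -
  have V: "csubspace V"
    and add: "\<And>u v w. u \<in> V \<Longrightarrow> v \<in> V \<Longrightarrow> w \<in> V \<Longrightarrow> q u (v + w) = q u v + q u w"
    and scale: "\<And>c u v. u \<in> V \<Longrightarrow> v \<in> V \<Longrightarrow> q u (c *\<^sub>C v) = c * q u v"
    and herm: "\<And>u v. u \<in> V \<Longrightarrow> v \<in> V \<Longrightarrow> q u v = cnj (q v u)"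
    using assms unfolding hermitian_on_def by blast+
  note VD = csubspaceD[OF V]
  show "csubspace V" by (rule V)
  show add': "u \<in> V \<Longrightarrow> v \<in> V \<Longrightarrow> w \<in> V \<Longrightarrow> q u (v + w) = q u v + q u w" for u v w by (rule add)
  show scale': "u \<in> V \<Longrightarrow> v \<in> V \<Longrightarrow> q u (c *\<^sub>C v) = c * q u v" for u v c by (rule scale)
  show herm': "u \<in> V \<Longrightarrow> v \<in> V \<Longrightarrow> q u v = cnj (q v u)" for u v by (rule herm)
  show addl: "u \<in> V \<Longrightarrow> v \<in> V \<Longrightarrow> w \<in> V \<Longrightarrow> q (u + v) w = q u w + q v w" for u v w
    using herm[of "u + v" w] herm[of u w] herm[of v w] add[of w u v] VD(2)[of u v] by simp
  show scalel: "u \<in> V \<Longrightarrow> v \<in> V \<Longrightarrow> q (c *\<^sub>C u) v = cnj c * q u v" for u v c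
    using herm[of "c *\<^sub>C u" v] herm[of u v] scale[of v u c] VD(3)[of u c] by simp
  show z: "u \<in> V \<Longrightarrow> q u 0 = 0" for u
    using scale[of u 0 0] VD(1) by simp
  show "u \<in> V \<Longrightarrow> Im (q u u) = 0" for u
    using herm[of u u] by (simp add: complex_eq_iff)
  show d: "u \<in> V \<Longrightarrow> v \<in> V \<Longrightarrow> w \<in> V \<Longrightarrow> q u (v - w) = q u v - q u w" for u v w
    using add[of u v "(-1) *\<^sub>C w"] scale[of u w "-1"] VD(3)[of w "-1"]
    by (simp add: scaleC_minus_one del: complex_vector.scale_minus_left)
  show "u \<in> V \<Longrightarrow> v \<in> V \<Longrightarrow> w \<in> V \<Longrightarrow> q (u - v) w = q u w - q v w" for u v w
    using herm[of "u - v" w] herm[of u w] herm[of v w] d[of w u v] VD(4)[of u v] by simp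
  show "u \<in> V \<Longrightarrow> q 0 u = 0"
    using z[of u] herm[of 0 u] VD(1) by simp
qed

lemmas hermitian_simps = hermitian_onD(1-3,5-)

lemma hermitian_on_subset:
  "hermitian_on V q \<Longrightarrow> csubspace W \<Longrightarrow> W \<subseteq> V \<Longrightarrow> hermitian_on W q"
  unfolding hermitian_on_def by blast

lemma hermitian_on_cinner: "csubspace V \<Longrightarrow> hermitian_on V cinner"
  unfolding hermitian_on_def
  by (intro conjI ballI allI cinner_add_right cinner_scaleC_right cinner_commute)

lemma hermitian_on_minus:
  assumes q: "hermitian_on V q"
  shows "hermitian_on V (\<lambda>u v. - q u v)"
  unfolding hermitian_on_def
proof (intro conjI ballI allI)
  show "- q u v = cnj (- q v u)" if "u \<in> V" "v \<in> V" for u v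
    using hermitian_onD(4)[OF q that] by simp
qed (use q in \<open>simp_all add: hermitian_simps[OF q]\<close>)

text \<open>The induction step of every elimination below: passing to the complement of a single
  non-isotropic vector lowers the dimension, and subtracting a multiple of \<open>v\<close> leads
  into it.\<close>

lemma hermitian_split:
  assumes fin: "finite_cdim TYPE('a :: chilbert_space)"
    and q: "hermitian_on V q" and v: "v \<in> V" and nz: "q v v \<noteq> 0"
  defines "V' \<equiv> {x \<in> V. q v x = 0}"
  shows "csubspace V'" "V' \<subseteq> V" "hermitian_on V' q" "cdim V' < cdim (V :: 'a set)"
    "\<And>x. x \<in> V \<Longrightarrow> x - (q v x / q v v) *\<^sub>C v \<in> V'"
proof -
  note VD = csubspaceD[OF hermitian_onD(1)[OF q]]
  show V': "csubspace V'"
    unfolding V'_def using v q by (auto intro!: csubspaceI simp: VD hermitian_simps[OF q])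
  show sub: "V' \<subseteq> V" by (auto simp: V'_def)
  show "hermitian_on V' q" by (rule hermitian_on_subset[OF q V' sub])
  show "cdim V' < cdim V"
  proof (rule ccontr)
    assume "\<not> ?thesis"
    then have "V' = V"
      using cdim_eq_imp_eq[OF fin V' hermitian_onD(1)[OF q] sub] by simp
    then show False using v nz by (auto simp: V'_def)
  qed
  show "x - (q v x / q v v) *\<^sub>C v \<in> V'" if "x \<in> V" for x
    using that v nz q by (simp add: V'_def VD hermitian_simps[OF q])
qed

text \<open>As long as the form takes a negative value, a vector realizing it is split off into
  \<open>W\<close>; what remains at the end is \<open>U\<close>. The argument works with the form
  alone, without eigenvalues.\<close>

lemma hermitian_diagonalize:
  fixes V :: "'a :: chilbert_space set"
  assumes fin: "finite_cdim TYPE('a)" and q: "hermitian_on V q"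
  shows "\<exists>W U. csubspace W \<and> csubspace U \<and> W \<subseteq> V \<and> U \<subseteq> V \<and>
    (\<forall>x\<in>V. \<exists>w\<in>W. \<exists>u\<in>U. x = w + u) \<and> negative_on W q \<and> nonneg_on U q \<and>
    (\<forall>w\<in>W. \<forall>u\<in>U. q w u = 0)"
  using q
proof (induction "cdim V" arbitrary: V rule: less_induct)
  case less
  note VD = csubspaceD[OF hermitian_onD(1)[OF less(2)]]
  show ?case
  proof (cases "nonneg_on V q")
    case True
    then show ?thesis
      using hermitian_onD(1)[OF less(2)] VD(1) less(2)
      by (intro exI[of _ "{0}"] exI[of _ V])
        (auto simp: hermitian_simps[OF less(2)] complex_vector.subspace_0 intro!: csubspaceI)
  next
    case False
    then obtain v where v: "v \<in> V" "Re (q v v) < 0" by (auto simp: not_le)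
    then have nz: "q v v \<noteq> 0" by auto
    define V' where "V' = {x \<in> V. q v x = 0}"
    note split = hermitian_split[OF fin less(2) v(1) nz, folded V'_def]
    obtain W U where WU': "csubspace W" "csubspace U" "W \<subseteq> V'" "U \<subseteq> V'"
      "\<forall>x\<in>V'. \<exists>w\<in>W. \<exists>u\<in>U. x = w + u" "negative_on W q" "nonneg_on U q"
      "\<forall>w\<in>W. \<forall>u\<in>U. q w u = 0"
      using less(1)[OF split(4,3)] by (elim exE conjE) (rule that)
    note WU = WU'(1-4) bspec[OF WU'(5)] WU'(6,7) bspec[OF bspec[OF WU'(8)]]
    define W1 where "W1 = {w + c *\<^sub>C v |w c. w \<in> W}"
    have WV: "w \<in> V" "q v w = 0" "q w v = 0" if "w \<in> W" for w
    proof -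
      show "w \<in> V" "q v w = 0" using that WU(3) by (auto simp: V'_def)
      then show "q w v = 0" using hermitian_onD(4)[OF less(2), of w v] v(1) by simp
    qed
    have "csubspace W1"
    proof (rule csubspaceI)
      show "0 \<in> W1" using csubspaceD(1)[OF WU(1)] unfolding W1_def by force
    next
      fix x y assume "x \<in> W1" "y \<in> W1"
      then obtain a c b d where "x = a + c *\<^sub>C v" "y = b + d *\<^sub>C v" "a \<in> W" "b \<in> W"
        by (auto simp: W1_def)
      then have "x + y = (a + b) + (c + d) *\<^sub>C v" "a + b \<in> W"
        using csubspaceD(2)[OF WU(1)] by (auto simp: scaleC_add_left)
      then show "x + y \<in> W1" unfolding W1_def by blast
    next
      fix c x assume "x \<in> W1"
      then obtain a d where "x = a + d *\<^sub>C v" "a \<in> W" by (auto simp: W1_def)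
      then have "c *\<^sub>C x = c *\<^sub>C a + (c * d) *\<^sub>C v" "c *\<^sub>C a \<in> W"
        using csubspaceD(3)[OF WU(1)] by (auto simp: scaleC_add_right scaleC_scaleC)
      then show "c *\<^sub>C x \<in> W1" unfolding W1_def by blast
    qed
    moreover have "W1 \<subseteq> V" using WV v(1) VD by (auto simp: W1_def)
    moreover have "U \<subseteq> V" using WU(4) by (auto simp: V'_def)
    moreover have "\<exists>w\<in>W1. \<exists>u\<in>U. x = w + u" if "x \<in> V" for x
    proof -
      define c where "c = q v x / q v v"
      obtain w u where wu: "w \<in> W" "u \<in> U" "x - c *\<^sub>C v = w + u"
        using WU(5)[OF split(5)[OF \<open>x \<in> V\<close>]] unfolding c_def by blast
      have "x = (w + c *\<^sub>C v) + u" using wu(3) by (simp add: algebra_simps)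
      moreover have "w + c *\<^sub>C v \<in> W1" using wu(1) by (auto simp: W1_def)
      ultimately show ?thesis using wu(2) by blast
    qed
    moreover have "negative_on W1 q"
    proof (intro ballI impI)
      fix x assume "x \<in> W1" "x \<noteq> 0"
      then obtain w c where x: "x = w + c *\<^sub>C v" "w \<in> W" by (auto simp: W1_def)
      \<comment> \<open>The mixed terms vanish because \<open>W\<close> lies in the complement of
        \<open>v\<close>.\<close>
      have "q x x = q w w + (c * cnj c) * q v v"
        using x WV[OF x(2)] v(1) less(2) by (simp add: hermitian_simps[OF less(2)] VD)
      then have eq: "Re (q x x) = Re (q w w) + (cmod c)\<^sup>2 * Re (q v v)"
        by (simp add: complex_norm_square[symmetric] del: of_real_power)
      show "Re (q x x) < 0"
      proof (cases "w = 0")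
        case True
        then have "c \<noteq> 0" using \<open>x \<noteq> 0\<close> x(1) by auto
        then show ?thesis
          using eq v(2) True hermitian_onD(7)[OF less(2)] VD(1) by (simp add: mult_pos_neg)
      next
        case False
        then have "Re (q w w) < 0" using WU(6) x(2) by blast
        moreover have "(cmod c)\<^sup>2 * Re (q v v) \<le> 0" using v(2) by (simp add: mult_nonneg_nonpos)
        ultimately show ?thesis using eq by linarith
      qed
    qed
    moreover have "q w u = 0" if wW: "w \<in> W1" and "u \<in> U" for w u
    proof -
      obtain a c where "w = a + c *\<^sub>C v" "a \<in> W" using wW by (auto simp: W1_def)
      moreover have "u \<in> V" "q v u = 0" using that(2) WU(4) by (auto simp: V'_def)
      ultimately show ?thesis
        using WU(8)[of a u] that(2) WV v(1) less(2) by (simp add: hermitian_simps[OF less(2)] VD)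
    qed
    ultimately show ?thesis
      using WU(2,7) by (intro exI[of _ W1] exI[of _ U] conjI) simp_all
  qed
qed

section \<open>The negative index of a Hermitian form\<close>

lemma form_n_minus_finite:
  fixes V :: "'a :: chilbert_space set"
  assumes fin: "finite_cdim TYPE('a)"
  shows "finite {cdim W | W. csubspace W \<and> W \<subseteq> V \<and> negative_on W q}"
proof (rule finite_subset)
  show "{cdim W | W. csubspace W \<and> W \<subseteq> V \<and> negative_on W q} \<subseteq> {..cdim V}"
    by (auto intro: cdim_mono[OF fin])
qed simp

lemma form_n_minus_ge:
  fixes V :: "'a :: chilbert_space set"
  assumes "finite_cdim TYPE('a)" "csubspace W" "W \<subseteq> V" "negative_on W q"
  shows "cdim W \<le> form_n_minus V q"
  unfolding form_n_minus_def
  using assms(2-4) by (intro Max_ge[OF form_n_minus_finite[OF assms(1)]] CollectI exI[of _ W] conjI refl)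

lemma form_n_minus_attained:
  fixes V :: "'a :: chilbert_space set"
  assumes fin: "finite_cdim TYPE('a)" and V: "csubspace V"
  obtains W where "csubspace W" "W \<subseteq> V" "negative_on W q" "form_n_minus V q = cdim W"
proof -
  have "cdim {0::'a} \<in> {cdim W | W. csubspace W \<and> W \<subseteq> V \<and> negative_on W q}"
    using csubspaceD(1)[OF V] by (intro CollectI exI[of _ "{0}"]) (auto intro!: csubspaceI)
  then have "form_n_minus V q \<in> {cdim W | W. csubspace W \<and> W \<subseteq> V \<and> negative_on W q}"
    unfolding form_n_minus_def by (intro Max_in form_n_minus_finite[OF fin]) (metis empty_iff)
  then show thesis by (elim CollectE exE conjE) (rule that)
qed

text \<open>A negative subspace meets a nonnegative one only in 0, so their dimensions add up within
  \<open>V\<close>.\<close>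

lemma form_n_minus_le:
  fixes V :: "'a :: chilbert_space set"
  assumes fin: "finite_cdim TYPE('a)" and V: "csubspace V"
    and U: "csubspace U" "U \<subseteq> V" "nonneg_on U q"
  shows "form_n_minus V q + cdim U \<le> cdim V"
proof -
  obtain W where W: "csubspace W" "W \<subseteq> V" "negative_on W q" "form_n_minus V q = cdim W"
    by (rule form_n_minus_attained[OF fin V])
  have "W \<inter> U \<subseteq> {0}" using W(3) U(3) by fastforce
  then show ?thesis
    using cdim_disjoint_le[OF fin W(1) U(1) _ V W(2) U(2)] W(4) by simp
qed

text \<open>Sylvester's law: the two subspaces bound the index from below and from above, and since
  they span \<open>V\<close> the bounds coincide.\<close>

lemma form_n_minus_eqI:
  fixes V :: "'a :: chilbert_space set"
  assumes fin: "finite_cdim TYPE('a)" and V: "csubspace V"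
    and W: "csubspace W" "W \<subseteq> V" "negative_on W q"
    and U: "csubspace U" "U \<subseteq> V" "nonneg_on U q"
    and cover: "\<And>x. x \<in> V \<Longrightarrow> \<exists>w\<in>W. \<exists>u\<in>U. x = w + u"
  shows "form_n_minus V q = cdim W"
  using form_n_minus_ge[where q = q, OF fin W] form_n_minus_le[where q = q, OF fin V U] cdim_cover_le[OF fin W(1) U(1) cover]
  by fastforce

lemma form_n_minus_decomposition:
  fixes V :: "'a :: chilbert_space set"
  assumes fin: "finite_cdim TYPE('a)" and q: "hermitian_on V q"
  obtains W U where "csubspace W" "csubspace U" "W \<subseteq> V" "U \<subseteq> V"
    "\<forall>x\<in>V. \<exists>w\<in>W. \<exists>u\<in>U. x = w + u" "negative_on W q" "nonneg_on U q"
    "\<forall>w\<in>W. \<forall>u\<in>U. q w u = 0" "form_n_minus V q = cdim W" "W \<inter> U \<subseteq> {0}"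
proof -
  obtain W U where WU: "csubspace W" "csubspace U" "W \<subseteq> V" "U \<subseteq> V"
    "\<forall>x\<in>V. \<exists>w\<in>W. \<exists>u\<in>U. x = w + u" "negative_on W q" "nonneg_on U q"
    "\<forall>w\<in>W. \<forall>u\<in>U. q w u = 0"
    using hermitian_diagonalize[OF fin q] by (elim exE conjE) (rule that)
  note * = WU(1-4) bspec[OF WU(5)] WU(6,7) bspec[OF bspec[OF WU(8)]]
  have "form_n_minus V q = cdim W"
    by (rule form_n_minus_eqI[where q = q, OF fin hermitian_onD(1)[OF q] *(1,3,6,2,4,7,5)])
  moreover have "W \<inter> U \<subseteq> {0}" using *(6,7) by fastforce
  ultimately show thesis by (rule that[OF WU])
qed

lemma form_n_minus_mono:
  fixes V :: "'a :: chilbert_space set"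
  assumes fin: "finite_cdim TYPE('a)" and V: "csubspace V"
    and le: "\<And>u. u \<in> V \<Longrightarrow> Re (p u u) \<le> Re (q u u)"
  shows "form_n_minus V q \<le> form_n_minus V p"
proof -
  obtain W where W: "csubspace W" "W \<subseteq> V" "negative_on W q" "form_n_minus V q = cdim W"
    by (rule form_n_minus_attained[OF fin V])
  have "negative_on W p" using W(2,3) le by (meson le_less_trans subsetD)
  then show ?thesis using form_n_minus_ge[OF fin W(1,2), of p] W(4) by simp
qed

lemma form_n_minus_image_subset:
  fixes V :: "'a :: chilbert_space set" and f :: "'a \<Rightarrow> 'b :: chilbert_space"
  assumes V: "csubspace V" and f: "clinear_on V f" "inj_on f V"
    and neg: "\<And>u. u \<in> V \<Longrightarrow> Re (q u u) < 0 \<Longrightarrow> Re (p (f u) (f u)) < 0"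
  shows "{cdim W | W. csubspace W \<and> W \<subseteq> V \<and> negative_on W q}
    \<subseteq> {cdim W | W. csubspace W \<and> W \<subseteq> f ` V \<and> negative_on W p}"
proof safe
  fix W assume W: "csubspace W" "W \<subseteq> V" "negative_on W q"
  have lin: "clinear_on W f" "inj_on f W"
    using f W(2) by (auto simp: clinear_on_def subset_iff inj_on_def)
  have f0: "f 0 = 0"
    using clinear_on_diff[OF V f(1) csubspaceD(1)[OF V] csubspaceD(1)[OF V]] by simp
  have "negative_on (f ` W) p" using W(2,3) neg f0 by (auto simp: subset_iff)
  then show "\<exists>W'. cdim W = cdim W' \<and> csubspace W' \<and> W' \<subseteq> f ` V \<and> negative_on W' p"
    using clinear_on_image[OF W(1) lin] W by (intro exI[of _ "f ` W"]) auto
qed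

text \<open>Only the signs on the diagonal have to agree. This permits a congruence up to a positive
  factor, and forms that are not Hermitian such as \<open>kashiwara_form\<close>.\<close>

lemma form_n_minus_iso:
  fixes V :: "'a :: chilbert_space set" and f :: "'a \<Rightarrow> 'b :: chilbert_space"
  assumes V: "csubspace V" and f: "clinear_on V f" "inj_on f V"
    and neg: "\<And>u. u \<in> V \<Longrightarrow> Re (p (f u) (f u)) < 0 \<longleftrightarrow> Re (q u u) < 0"
  shows "form_n_minus (f ` V) p = form_n_minus V q"
proof -
  define g where "g = inv_into V f"
  have gf: "g (f x) = x" if "x \<in> V" for x using f(2) that by (simp add: g_def)
  have fV: "csubspace (f ` V)" by (rule csubspace_clinear_on_image[OF V f])
  have "clinear_on (f ` V) g"
    unfolding clinear_on_def
  proof (intro conjI ballI allI)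
    fix x y assume "x \<in> f ` V" "y \<in> f ` V"
    then obtain a b where "x = f a" "y = f b" "a \<in> V" "b \<in> V" by blast
    then show "g (x + y) = g x + g y"
      using f(1) csubspaceD(2)[OF V, of a b] gf unfolding clinear_on_def by metis
  next
    fix c x assume "x \<in> f ` V"
    then obtain a where "x = f a" "a \<in> V" by blast
    then show "g (c *\<^sub>C x) = c *\<^sub>C g x"
      using f(1) csubspaceD(3)[OF V, of a c] gf unfolding clinear_on_def by metis
  qed
  moreover have "inj_on g (f ` V)" using gf by (auto simp: inj_on_def)
  moreover have "g ` f ` V = V" using gf by force
  moreover have "Re (q (g u) (g u)) < 0" if "u \<in> f ` V" "Re (p u u) < 0" for u
    using that neg gf by auto
  ultimately have "{cdim W | W. csubspace W \<and> W \<subseteq> f ` V \<and> negative_on W p}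
      \<subseteq> {cdim W | W. csubspace W \<and> W \<subseteq> V \<and> negative_on W q}"
    using form_n_minus_image_subset[where f = g and p = q and q = p, OF fV] by simp
  moreover have "{cdim W | W. csubspace W \<and> W \<subseteq> V \<and> negative_on W q}
      \<subseteq> {cdim W | W. csubspace W \<and> W \<subseteq> f ` V \<and> negative_on W p}"
    by (rule form_n_minus_image_subset[where p = p and q = q, OF V f]) (simp add: neg)
  ultimately show ?thesis
    unfolding form_n_minus_def by (simp add: subset_antisym)
qed

lemma form_n_minus_Times:
  fixes V\<^sub>1 :: "'a :: chilbert_space set" and V\<^sub>2 :: "'b :: chilbert_space set"
  assumes fin: "finite_cdim TYPE('a)" "finite_cdim TYPE('b)"
    and q: "hermitian_on V\<^sub>1 q\<^sub>1" "hermitian_on V\<^sub>2 q\<^sub>2"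
    and p: "\<And>u v. u \<in> V\<^sub>1 \<Longrightarrow> v \<in> V\<^sub>2 \<Longrightarrow> Re (p (u, v) (u, v)) = Re (q\<^sub>1 u u) + Re (q\<^sub>2 v v)"
  shows "form_n_minus (V\<^sub>1 \<times> V\<^sub>2) p = form_n_minus V\<^sub>1 q\<^sub>1 + form_n_minus V\<^sub>2 q\<^sub>2"
proof -
  obtain W\<^sub>1 U\<^sub>1 where A1: "csubspace W\<^sub>1" "csubspace U\<^sub>1" "W\<^sub>1 \<subseteq> V\<^sub>1" "U\<^sub>1 \<subseteq> V\<^sub>1"
    "\<forall>x\<in>V\<^sub>1. \<exists>w\<in>W\<^sub>1. \<exists>u\<in>U\<^sub>1. x = w + u" "negative_on W\<^sub>1 q\<^sub>1" "nonneg_on U\<^sub>1 q\<^sub>1"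
    "\<forall>w\<in>W\<^sub>1. \<forall>u\<in>U\<^sub>1. q\<^sub>1 w u = 0" "form_n_minus V\<^sub>1 q\<^sub>1 = cdim W\<^sub>1"
    "W\<^sub>1 \<inter> U\<^sub>1 \<subseteq> {0}"
    by (rule form_n_minus_decomposition[OF fin(1) q(1)])
  note 1 = A1(1-4) bspec[OF A1(5)] A1(6-)
  obtain W\<^sub>2 U\<^sub>2 where A2: "csubspace W\<^sub>2" "csubspace U\<^sub>2" "W\<^sub>2 \<subseteq> V\<^sub>2" "U\<^sub>2 \<subseteq> V\<^sub>2"
    "\<forall>x\<in>V\<^sub>2. \<exists>w\<in>W\<^sub>2. \<exists>u\<in>U\<^sub>2. x = w + u" "negative_on W\<^sub>2 q\<^sub>2" "nonneg_on U\<^sub>2 q\<^sub>2"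
    "\<forall>w\<in>W\<^sub>2. \<forall>u\<in>U\<^sub>2. q\<^sub>2 w u = 0" "form_n_minus V\<^sub>2 q\<^sub>2 = cdim W\<^sub>2"
    "W\<^sub>2 \<inter> U\<^sub>2 \<subseteq> {0}"
    by (rule form_n_minus_decomposition[OF fin(2) q(2)])
  note 2 = A2(1-4) bspec[OF A2(5)] A2(6-)
  have "form_n_minus (V\<^sub>1 \<times> V\<^sub>2) p = cdim (W\<^sub>1 \<times> W\<^sub>2)"
  proof (rule form_n_minus_eqI[OF finite_cdim_prod[OF fin], where U = "U\<^sub>1 \<times> U\<^sub>2"])
    show "csubspace (V\<^sub>1 \<times> V\<^sub>2)" "csubspace (W\<^sub>1 \<times> W\<^sub>2)" "csubspace (U\<^sub>1 \<times> U\<^sub>2)"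
      using 1 2 hermitian_onD(1)[OF q(1)] hermitian_onD(1)[OF q(2)] by (auto intro!: csubspace_Times)
    show "W\<^sub>1 \<times> W\<^sub>2 \<subseteq> V\<^sub>1 \<times> V\<^sub>2" "U\<^sub>1 \<times> U\<^sub>2 \<subseteq> V\<^sub>1 \<times> V\<^sub>2" using 1 2 by auto
    show "nonneg_on (U\<^sub>1 \<times> U\<^sub>2) p"
    proof
      fix x assume "x \<in> U\<^sub>1 \<times> U\<^sub>2"
      then obtain a b where ab: "x = (a, b)" "a \<in> U\<^sub>1" "b \<in> U\<^sub>2" by auto
      then show "0 \<le> Re (p x x)"
        using p[OF subsetD[OF 1(4)] subsetD[OF 2(4)]] 1(7) 2(7) by simp
    qed
    show "\<exists>w\<in>W\<^sub>1 \<times> W\<^sub>2. \<exists>u\<in>U\<^sub>1 \<times> U\<^sub>2. x = w + u" if x: "x \<in> V\<^sub>1 \<times> V\<^sub>2" for x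
    proof -
      obtain w\<^sub>1 u\<^sub>1 where "w\<^sub>1 \<in> W\<^sub>1" "u\<^sub>1 \<in> U\<^sub>1" "fst x = w\<^sub>1 + u\<^sub>1" using 1(5)[of "fst x"] x by auto
      moreover obtain w\<^sub>2 u\<^sub>2 where "w\<^sub>2 \<in> W\<^sub>2" "u\<^sub>2 \<in> U\<^sub>2" "snd x = w\<^sub>2 + u\<^sub>2" using 2(5)[of "snd x"] x by auto
      ultimately show ?thesis
        by (intro bexI[of _ "(w\<^sub>1, w\<^sub>2)"] bexI[of _ "(u\<^sub>1, u\<^sub>2)"]) (auto simp: prod_eq_iff)
    qed
    show "negative_on (W\<^sub>1 \<times> W\<^sub>2) p"
    proof (intro ballI impI)
      fix x assume x: "x \<in> W\<^sub>1 \<times> W\<^sub>2" "x \<noteq> 0"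
      obtain a b where ab: "x = (a, b)" "a \<in> W\<^sub>1" "b \<in> W\<^sub>2" using x by auto
      \<comment> \<open>A nonzero pair may vanish in one component, where the form is 0 rather than
        negative.\<close>
      have "Re (q\<^sub>1 a a) < 0 \<or> a = 0 \<and> Re (q\<^sub>1 a a) = 0"
        using 1(3,6) ab(2) q(1) by (cases "a = 0") (auto simp: hermitian_simps[OF q(1)])
      moreover have "Re (q\<^sub>2 b b) < 0 \<or> b = 0 \<and> Re (q\<^sub>2 b b) = 0"
        using 2(3,6) ab(3) q(2) by (cases "b = 0") (auto simp: hermitian_simps[OF q(2)])
      moreover have "a \<noteq> 0 \<or> b \<noteq> 0" using x ab by (auto simp: zero_prod_def)
      ultimately show "Re (p x x) < 0"
        using p[OF subsetD[OF 1(3) ab(2)] subsetD[OF 2(3) ab(3)]] ab(1) by auto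
    qed
  qed
  then show ?thesis
    using cdim_Times[OF fin 1(1) 2(1)] 1(9) 2(9) by simp
qed

lemma nonneg_Cauchy_Schwarz:
  assumes q: "hermitian_on V q" and nn: "nonneg_on V q" and u: "u \<in> V" and v: "v \<in> V"
  shows "(cmod (q u v))\<^sup>2 \<le> Re (q u u) * Re (q v v)"
proof (rule semidefinite_Cauchy_Schwarz)
  note VD = csubspaceD[OF hermitian_onD(1)[OF q]]
  fix c
  have "q (u + c *\<^sub>C v) (u + c *\<^sub>C v)
      = q u u + c * q u v + cnj c * cnj (q u v) + c * cnj c * q v v"
    using q u v hermitian_onD(4)[OF q u v] hermitian_onD(4)[OF q v u]
    by (simp add: hermitian_simps[OF q] VD algebra_simps)
  then show "0 \<le> Re (q u u + c * q u v + cnj c * cnj (q u v) + c * cnj c * q v v)"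
    using nn VD(2,3) u v by metis
qed (use nn v in blast)

lemma nonneg_radical:
  assumes "hermitian_on V q" "nonneg_on V q" "v \<in> V" "Re (q v v) = 0" "u \<in> V"
  shows "q u v = 0"
  using nonneg_Cauchy_Schwarz[OF assms(1,2,5,3)] assms(4) by simp

text \<open>Splitting \<open>- q\<close> once more on the nonnegative part \<open>U\<close> leaves a
  subspace on which both \<open>q\<close> and \<open>- q\<close> are nonnegative. All its vectors
  are isotropic, and \<open>nonneg_radical\<close> identifies it with the radical.\<close>

lemma hermitian_inertia:
  fixes V :: "'a :: chilbert_space set"
  assumes fin: "finite_cdim TYPE('a)" and q: "hermitian_on V q"
  defines "Z \<equiv> {v \<in> V. \<forall>u\<in>V. q u v = 0}"
  obtains W P where "csubspace W" "csubspace P" "W \<subseteq> V" "P \<subseteq> V" "csubspace Z"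
    "negative_on W q" "\<forall>u\<in>P. u \<noteq> 0 \<longrightarrow> 0 < Re (q u u)"
    "form_n_minus V q = cdim W" "form_n_minus V (\<lambda>u v. - q u v) = cdim P"
    "cdim W + cdim P + cdim Z = cdim V"
proof -
  note VD = csubspaceD[OF hermitian_onD(1)[OF q]]
  note qD = hermitian_onD(1-3,5-)[OF q] and qsym = hermitian_onD(4)[OF q]
  obtain W U where WU': "csubspace W" "csubspace U" "W \<subseteq> V" "U \<subseteq> V"
    "\<forall>x\<in>V. \<exists>w\<in>W. \<exists>u\<in>U. x = w + u" "negative_on W q" "nonneg_on U q"
    "\<forall>w\<in>W. \<forall>u\<in>U. q w u = 0" "form_n_minus V q = cdim W" "W \<inter> U \<subseteq> {0}"
    by (rule form_n_minus_decomposition[OF fin q])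
  note WU = WU'(1-4) bspec[OF WU'(5)] WU'(6,7) bspec[OF bspec[OF WU'(8)]] WU'(9-)
  have qU: "hermitian_on U q" by (rule hermitian_on_subset[OF q WU(2,4)])
  obtain P Y where PY': "csubspace P" "csubspace Y" "P \<subseteq> U" "Y \<subseteq> U"
    "\<forall>x\<in>U. \<exists>w\<in>P. \<exists>u\<in>Y. x = w + u" "negative_on P (\<lambda>u v. - q u v)" "nonneg_on Y (\<lambda>u v. - q u v)"
    "\<forall>w\<in>P. \<forall>u\<in>Y. - q w u = 0"
    "form_n_minus U (\<lambda>u v. - q u v) = cdim P" "P \<inter> Y \<subseteq> {0}"
    by (rule form_n_minus_decomposition[OF fin hermitian_on_minus[OF qU]])
  note PY = PY'(1-4) bspec[OF PY'(5)] PY'(6-)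
  have pos: "0 < Re (q u u)" if "u \<in> P" "u \<noteq> 0" for u
    using PY(6) that by fastforce
  have Z: "csubspace Z"
    unfolding Z_def using q by (auto intro!: csubspaceI simp: VD hermitian_simps[OF q])
  have YZ: "Y = Z"
  proof (intro equalityI subsetI)
    fix y assume y: "y \<in> Y"
    have yU: "y \<in> U" "y \<in> V" using y PY(4) WU(4) by auto
    have "Re (q y y) = 0" using PY(7) WU(7) y yU by fastforce
    then have 0: "q u y = 0" if "u \<in> U" for u
      using nonneg_radical[OF qU WU(7) yU(1) _ that] by blast
    have "q x y = 0" if x: "x \<in> V" for x
    proof -
      obtain w u where wu: "w \<in> W" "u \<in> U" "x = w + u" using WU(5)[OF x] by blast
      then have "w \<in> V" "u \<in> V" using WU(3,4) by auto
      then show ?thesis using 0[OF wu(2)] WU(8)[OF wu(1) yU(1)] wu(3) yU(2) by (simp add: qD)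
    qed
    then show "y \<in> Z" using yU(2) by (simp add: Z_def)
  next
    fix z assume z: "z \<in> Z"
    then have zV: "z \<in> V" "\<And>u. u \<in> V \<Longrightarrow> q u z = 0" by (auto simp: Z_def)
    obtain w u where wu: "w \<in> W" "u \<in> U" "z = w + u" using WU(5)[OF zV(1)] by blast
    obtain p y where py: "p \<in> P" "y \<in> Y" "u = p + y" using PY(5)[OF wu(2)] by blast
    have V: "w \<in> V" "u \<in> V" "p \<in> V" "y \<in> V" using wu py WU(3,4) PY(3,4) by auto
    have "q w z = q w w" using wu V WU(8) by (simp add: qD)
    then have "w = 0" using zV(2)[OF V(1)] WU(6) wu(1) by force
    have yU: "y \<in> U" "p \<in> U" using py PY by auto
    have "Re (q y y) = 0" using PY(7) WU(7) py(2) yU by fastforce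
    then have "q p y = 0" using nonneg_radical[OF qU WU(7) yU(1) _ yU(2)] by blast
    then have "q p z = q p p" using wu(3) \<open>w = 0\<close> py(3) V by (simp add: qD)
    then have "p = 0" using zV(2)[OF V(3)] pos py(1) by force
    then show "z \<in> Y" using \<open>w = 0\<close> wu(3) py by simp
  qed
  have "cdim U = cdim P + cdim Z"
  proof (rule antisym)
    show "cdim U \<le> cdim P + cdim Z"
      using cdim_cover_le[OF fin PY(1) Z] PY(5) YZ by blast
    show "cdim P + cdim Z \<le> cdim U"
      using cdim_disjoint_le[OF fin PY(1) Z _ WU(2) PY(3)] PY(4,10) YZ by blast
  qed
  moreover have "cdim V = cdim W + cdim U"
  proof (rule antisym)
    show "cdim V \<le> cdim W + cdim U" by (rule cdim_cover_le[OF fin WU(1,2,5)])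
    show "cdim W + cdim U \<le> cdim V"
      by (rule cdim_disjoint_le[OF fin WU(1,2,10) qD(1) WU(3,4)])
  qed
  ultimately have dims: "cdim W + cdim P + cdim Z = cdim V" by simp
  \<comment> \<open>Nonnegative counterpart of \<open>P\<close> for the form \<open>- q\<close>: the
    negative part of \<open>q\<close> together with the radical.\<close>
  define N where "N = {w + z |w z. w \<in> W \<and> z \<in> Z}"
  have "form_n_minus V (\<lambda>u v. - q u v) = cdim P"
  proof (rule form_n_minus_eqI[OF fin qD(1) PY(1), where U = N])
    show "P \<subseteq> V" using PY(3) WU(4) by auto
    show "negative_on P (\<lambda>u v. - q u v)" by (rule PY(6))
    show "csubspace N" unfolding N_def by (rule csubspace_sums[OF WU(1) Z])
    show "N \<subseteq> V" using WU(3) VD unfolding N_def Z_def by auto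
    show "nonneg_on N (\<lambda>u v. - q u v)"
    proof
      fix x assume "x \<in> N"
      then obtain w z where x: "x = w + z" "w \<in> W" "z \<in> Z" by (auto simp: N_def)
      have V: "w \<in> V" "z \<in> V" "q w z = 0" "q z z = 0" using x WU(3) by (auto simp: Z_def)
      then have "q z w = 0" using qsym[OF V(2,1)] by simp
      then have "q x x = q w w" using x V by (simp add: qD VD)
      then show "0 \<le> Re (- q x x)"
        using WU(6) x(2) qD(6)[OF VD(1)] by (cases "w = 0") (auto simp: less_imp_le)
    qed
    show "\<exists>w\<in>P. \<exists>u\<in>N. x = w + u" if x: "x \<in> V" for x
    proof -
      obtain w u where wu: "w \<in> W" "u \<in> U" "x = w + u" using WU(5)[OF x] by blast
      obtain p y where py: "p \<in> P" "y \<in> Y" "u = p + y" using PY(5)[OF wu(2)] by blast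
      have "x = p + (w + y)" "w + y \<in> N" using wu py YZ by (auto simp: N_def)
      then show ?thesis using py(1) by blast
    qed
  qed
  then show thesis
    using that[OF WU(1) PY(1) WU(3) _ Z WU(6) _ WU(9) _ dims] PY(3) WU(4) pos by blast
qed

lemma form_n_minus_uminus:
  fixes V :: "'a :: chilbert_space set"
  assumes "finite_cdim TYPE('a)" "hermitian_on V q"
  shows "form_n_minus V q + form_n_minus V (\<lambda>u v. - q u v) + cdim {v \<in> V. \<forall>u\<in>V. q u v = 0} = cdim V"
  by (rule hermitian_inertia[OF assms]) linarith

section \<open>Semicontinuity of the negative index\<close>

text \<open>Schur complement of \<open>v\<close>. It removes \<open>v\<close> from a form for which
  \<open>V'\<close> is only nearly orthogonal to \<open>v\<close>. If \<open>q v v = 0\<close>, the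
  quotient is 0 and the form is unchanged.\<close>

lemma hermitian_schur:
  assumes q: "hermitian_on V q" and v: "v \<in> V" and V': "csubspace V'" "V' \<subseteq> V"
  shows "hermitian_on V' (\<lambda>x y. q x y - q x v * q v y / q v v)"
proof -
  note VD = csubspaceD[OF hermitian_onD(1)[OF q]]
  have c: "q v v = cnj (q v v)" by (rule hermitian_onD(4)[OF q v v])
  show ?thesis
    unfolding hermitian_on_def
  proof (intro conjI ballI allI)
    fix x y assume "x \<in> V'" "y \<in> V'"
    then have xy: "x \<in> V" "y \<in> V" using V' by auto
    show "q x y - q x v * q v y / q v v = cnj (q y x - q y v * q v x / q v v)"
      using hermitian_onD(4)[OF q xy] hermitian_onD(4)[OF q xy(1) v] hermitian_onD(4)[OF q v xy(2)] c
      by simp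
  qed (use q v V' in \<open>auto simp: hermitian_simps[OF q] subset_iff diff_divide_distrib add_divide_distrib algebra_simps\<close>)
qed

text \<open>Negative definiteness is an open condition, even for pointwise convergence along a
  filter. By induction on the dimension: on the \<open>q\<close>-complement of \<open>v\<close> the
  Schur complements of \<open>p t\<close> with respect to \<open>v\<close> converge to
  \<open>q\<close> itself, because \<open>q v y = 0\<close> there.\<close>

lemma eventually_negative_on:
  fixes W :: "'a :: chilbert_space set"
  assumes fin: "finite_cdim TYPE('a)"
    and "hermitian_on W q" "negative_on W q" "\<forall>\<^sub>F t in F. hermitian_on W (p t)"
    and "\<And>u v. u \<in> W \<Longrightarrow> v \<in> W \<Longrightarrow> ((\<lambda>t. p t u v) \<longlongrightarrow> q u v) F"
  shows "\<forall>\<^sub>F t in F. negative_on W (p t)"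
  using assms(2-)
proof (induction "cdim W" arbitrary: W p q rule: less_induct)
  case less
  note q = less(2) and neg = less(3) and lim = less(5)
  note WD = csubspaceD[OF hermitian_onD(1)[OF q]]
  show ?case
  proof (cases "W \<subseteq> {0}")
    case True
    then show ?thesis by (auto simp: subset_iff)
  next
    case False
    then obtain v where v: "v \<in> W" "v \<noteq> 0" by auto
    then have qv: "Re (q v v) < 0" using neg by blast
    then have nz: "q v v \<noteq> 0" by auto
    define V' where "V' = {x \<in> W. q v x = 0}"
    note split = hermitian_split[OF fin q v(1) nz, folded V'_def]
    define r where "r t x y = p t x y - p t x v * p t v y / p t v v" for t x y
    have "\<forall>\<^sub>F t in F. negative_on V' (r t)"
    proof (rule less(1)[where p = r, OF split(4,3)])
      show "negative_on V' q" using neg split(2) by blast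
      show "\<forall>\<^sub>F t in F. hermitian_on V' (r t)"
        using less(4)
      proof eventually_elim
        case (elim t)
        then show ?case using hermitian_schur[OF elim v(1) split(1,2)] by (simp add: r_def[abs_def])
      qed
      show "((\<lambda>t. r t x y) \<longlongrightarrow> q x y) F" if "x \<in> V'" "y \<in> V'" for x y
      proof -
        have xy: "x \<in> W" "y \<in> W" "q v y = 0" using that by (auto simp: V'_def)
        have "((\<lambda>t. r t x y) \<longlongrightarrow> q x y - q x v * q v y / q v v) F"
          unfolding r_def using lim xy(1,2) v(1) nz by (intro tendsto_intros) auto
        then show ?thesis using xy(3) by simp
      qed
    qed
    moreover have "\<forall>\<^sub>F t in F. Re (p t v v) < 0"
      using tendsto_Re[OF lim[OF v(1) v(1)]] qv by (rule order_tendstoD)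
    ultimately show ?thesis
      using less(4)
    proof eventually_elim
      case (elim t)
      note pD = hermitian_onD(1-3,5-)[OF elim(3)] and psym = hermitian_onD(4)[OF elim(3)]
      have pnz: "p t v v \<noteq> 0" using elim(2) by auto
      show ?case
      proof (intro ballI impI)
        fix u assume u: "u \<in> W" "u \<noteq> 0"
        \<comment> \<open>Two corrections: \<open>x\<close> is \<open>u\<close> made orthogonal to
          \<open>v\<close> for the limit form, \<open>y\<close> is then made orthogonal for
          \<open>p t\<close>. In the decomposition \<open>u = y + c v\<close> the form
          \<open>p t\<close> has no mixed term.\<close>
        define x where "x = u - (q v u / q v v) *\<^sub>C v"
        have x: "x \<in> V'" "x \<in> W" using split(5)[OF u(1)] split(2) by (auto simp: x_def)
        define d where "d = p t v x / p t v v"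
        define y where "y = x - d *\<^sub>C v"
        have y: "y \<in> W" using x v(1) WD by (simp add: y_def)
        have pvy: "p t v y = 0" using x(2) v(1) WD pnz by (simp add: y_def d_def pD)
        then have pyv: "p t y v = 0" using psym[OF y v(1)] by simp
        have "p t y y = p t y x" using x(2) v(1) y WD pyv by (simp add: y_def pD)
        also have "\<dots> = r t x x"
          using x(2) v(1) WD psym[OF v(1) v(1)] psym[OF x(2) v(1)]
          by (simp add: y_def pD r_def d_def)
        finally have pyy: "p t y y = r t x x" .
        define c where "c = d + q v u / q v v"
        have uy: "u = y + c *\<^sub>C v" by (simp add: y_def x_def c_def algebra_simps scaleC_add_left)
        have "p t u u = p t y y + (c * cnj c) * p t v v"
          unfolding uy using y v(1) pvy pyv WD by (simp add: pD)
        then have eq: "Re (p t u u) = Re (r t x x) + (cmod c)\<^sup>2 * Re (p t v v)"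
          using pyy by (simp add: complex_norm_square[symmetric] del: of_real_power)
        have le: "(cmod c)\<^sup>2 * Re (p t v v) \<le> 0" using elim(2) by (simp add: mult_nonneg_nonpos)
        show "Re (p t u u) < 0"
        proof (cases "x = 0")
          \<comment> \<open>If \<open>x = 0\<close>, the Schur part contributes nothing and
            negativity comes from the multiple of \<open>v\<close>.\<close>
          case True
          then have d0: "d = 0" using v(1) by (simp add: d_def pD)
          then have "y = 0" using True by (simp add: y_def)
          then have "c \<noteq> 0" using uy u(2) by auto
          then have "(cmod c)\<^sup>2 * Re (p t v v) < 0" using elim(2) by (simp add: mult_pos_neg)
          moreover have "r t x x = 0" using \<open>y = 0\<close> pyy pD(6)[OF WD(1)] by simp
          ultimately show ?thesis using eq by simp
        next
          case False
          then have "Re (r t x x) < 0" using elim(1) x(1) by blast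
          then show ?thesis using eq le by linarith
        qed
      qed
    qed
  qed
qed

text \<open>Under pointwise convergence the index can only drop in the limit; the one-sided
  comparison \<open>ge\<close> excludes such a drop.\<close>

lemma eventually_form_n_minus_eq:
  fixes V :: "'a :: chilbert_space set"
  assumes fin: "finite_cdim TYPE('a)"
    and q: "hermitian_on V q" and p: "\<forall>\<^sub>F t in F. hermitian_on V (p t)"
    and lim: "\<And>u v. u \<in> V \<Longrightarrow> v \<in> V \<Longrightarrow> ((\<lambda>t. p t u v) \<longlongrightarrow> q u v) F"
    and ge: "\<forall>\<^sub>F t in F. \<forall>u\<in>V. Re (q u u) \<le> Re (p t u u)"
  shows "\<forall>\<^sub>F t in F. form_n_minus V (p t) = form_n_minus V q"
proof -
  note V = hermitian_onD(1)[OF q]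
  obtain W where W: "csubspace W" "W \<subseteq> V" "negative_on W q" "form_n_minus V q = cdim W"
    by (rule form_n_minus_attained[OF fin V])
  have "\<forall>\<^sub>F t in F. negative_on W (p t)"
  proof (rule eventually_negative_on[where p = p, OF fin hermitian_on_subset[OF q W(1,2)] W(3)])
    show "\<forall>\<^sub>F t in F. hermitian_on W (p t)"
      using p by eventually_elim (rule hermitian_on_subset[OF _ W(1,2)])
  qed (use lim W(2) in blast)
  then show ?thesis
    using ge
  proof eventually_elim
    case (elim t)
    show ?case
    proof (rule antisym)
      show "form_n_minus V (p t) \<le> form_n_minus V q"
        using elim(2) by (intro form_n_minus_mono[OF fin V]) blast
      show "form_n_minus V q \<le> form_n_minus V (p t)"
        using form_n_minus_ge[OF fin W(1,2), of "p t"] elim(1) W(4) by simp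
    qed
  qed
qed

section \<open>Convergence in finite-dimensional spaces\<close>

lemma cinner_splitE:
  fixes V :: "'a :: chilbert_space set"
  assumes fin: "finite_cdim TYPE('a)" and V: "csubspace V" "\<not> V \<subseteq> {0}"
  obtains v V' where "v \<in> V" "norm v = 1" "csubspace V'" "V' \<subseteq> V" "cdim V' < cdim V"
    "\<forall>x\<in>V. x - cinner v x *\<^sub>C v \<in> V'" "\<forall>x\<in>V'. cinner v x = 0"
proof -
  obtain w where w: "w \<in> V" "w \<noteq> 0" using V(2) by auto
  define v where "v = (1 / norm w) *\<^sub>R w"
  have v: "v \<in> V" "norm v = 1" using w csubspaceD(6)[OF V(1)] by (auto simp: v_def)
  then have cv: "cinner v v = 1" by (simp add: cinner_self)
  show thesis
    using hermitian_split[OF fin hermitian_on_cinner[OF V(1)] v(1)] cv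
    by (intro that[OF v, of "{x \<in> V. cinner v x = 0}"]) auto
qed

text \<open>Weak convergence is strong in finite dimension. No limit vector is given beforehand: it
  is assembled from the limits of the coordinates along successive unit vectors.\<close>

lemma convergent_of_weakly_convergent:
  fixes V :: "'a :: chilbert_space set"
  assumes fin: "finite_cdim TYPE('a)"
    and "csubspace V" "\<And>t. x t \<in> V" "\<And>v. v \<in> V \<Longrightarrow> \<exists>l. ((\<lambda>t. cinner v (x t)) \<longlongrightarrow> l) F"
  shows "\<exists>y\<in>V. (x \<longlongrightarrow> y) F"
  using assms(2-)
proof (induction "cdim V" arbitrary: V x rule: less_induct)
  case less
  note VD = csubspaceD[OF less(2)]
  show ?case
  proof (cases "V \<subseteq> {0}")
    case True
    then have "x = (\<lambda>_. 0)" using less(3) by blast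
    then show ?thesis using VD(1) by auto
  next
    case False
    obtain v V' where v: "v \<in> V" "norm v = 1" "csubspace V'" "V' \<subseteq> V" "cdim V' < cdim V"
      "\<forall>x\<in>V. x - cinner v x *\<^sub>C v \<in> V'" "\<forall>x\<in>V'. cinner v x = 0"
      by (rule cinner_splitE[OF fin less(2) False])
    define x' where "x' t = x t - cinner v (x t) *\<^sub>C v" for t
    have "\<exists>y\<in>V'. (x' \<longlongrightarrow> y) F"
    proof (rule less(1)[OF v(5,3)])
      show "x' t \<in> V'" for t using bspec[OF v(6) less(3)] by (simp add: x'_def)
      show "\<exists>l. ((\<lambda>t. cinner w (x' t)) \<longlongrightarrow> l) F" if "w \<in> V'" for w
      proof -
        have "cinner w v = 0" using bspec[OF v(7) that] cinner_commute[of w v] by simp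
        then have "cinner w (x' t) = cinner w (x t)" for t by (simp add: x'_def cinner_simps)
        then show ?thesis using less(4)[of w] that v(4) by auto
      qed
    qed
    then obtain y where y: "y \<in> V'" "(x' \<longlongrightarrow> y) F" by blast
    obtain l where l: "((\<lambda>t. cinner v (x t)) \<longlongrightarrow> l) F" using less(4)[OF v(1)] by blast
    have "((\<lambda>t. x' t + cinner v (x t) *\<^sub>C v) \<longlongrightarrow> y + l *\<^sub>C v) F"
      by (intro tendsto_add y(2) tendsto_scaleC l tendsto_const)
    then have "(x \<longlongrightarrow> y + l *\<^sub>C v) F" by (simp add: x'_def)
    moreover have "y + l *\<^sub>C v \<in> V" using y(1) v(1,4) VD by blast
    ultimately show ?thesis by blast
  qed
qed

lemma tendsto_of_weakly_tendsto:
  fixes x :: "'b \<Rightarrow> 'a :: chilbert_space"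
  assumes fin: "finite_cdim TYPE('a)" and lim: "\<And>v. ((\<lambda>t. cinner v (x t)) \<longlongrightarrow> cinner v y) F"
  shows "(x \<longlongrightarrow> y) F"
proof (cases "F = bot")
  case False
  obtain z where z: "(x \<longlongrightarrow> z) F"
    using convergent_of_weakly_convergent[OF fin, of UNIV x F] lim by (auto intro: csubspaceI)
  have "cinner v z = cinner v y" for v
    using tendsto_unique[OF False tendsto_cinner[OF tendsto_const z] lim] .
  then have "cinner (z - y) (z - y) = 0" by (simp add: cinner_diff_right)
  then show ?thesis using z by simp
qed simp

text \<open>Bolzano-Weierstrass, one coordinate at a time.\<close>

lemma bounded_imp_convergent_subseq:
  fixes V :: "'a :: chilbert_space set" and x :: "nat \<Rightarrow> 'a"
  assumes fin: "finite_cdim TYPE('a)"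
    and "csubspace V" "\<And>k. x k \<in> V" "\<And>k. norm (x k) \<le> C"
  shows "\<exists>y\<in>V. \<exists>r. strict_mono r \<and> (x \<circ> r) \<longlonglongrightarrow> y"
  using assms(2-)
proof (induction "cdim V" arbitrary: V x C rule: less_induct)
  case less
  note VD = csubspaceD[OF less(2)]
  show ?case
  proof (cases "V \<subseteq> {0}")
    case True
    then have "x = (\<lambda>_. 0)" using less(3) by blast
    then show ?thesis using VD(1) strict_mono_id by (intro bexI[of _ 0] exI[of _ id]) (auto simp: o_def)
  next
    case False
    obtain v V' where v: "v \<in> V" "norm v = 1" "csubspace V'" "V' \<subseteq> V" "cdim V' < cdim V"
      "\<forall>x\<in>V. x - cinner v x *\<^sub>C v \<in> V'"
      "\<forall>x\<in>V'. cinner v x = 0"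
      by (rule cinner_splitE[OF fin less(2) False])
    have cb: "cmod (cinner v (x k)) \<le> C" for k
      using order_trans[OF cmod_cinner_le[of v "x k"]] v(2) less(4) by simp
    have "compact (cball 0 C :: complex set)" by simp
    then obtain l r where r: "strict_mono r" "((\<lambda>k. cinner v (x k)) \<circ> r) \<longlonglongrightarrow> l"
      unfolding compact_def using cb by (metis mem_cball_0)
    define x' where "x' k = x (r k) - cinner v (x (r k)) *\<^sub>C v" for k
    have "\<exists>y\<in>V'. \<exists>r. strict_mono r \<and> (x' \<circ> r) \<longlonglongrightarrow> y"
    proof (rule less(1)[OF v(5,3)])
      show "x' k \<in> V'" for k using bspec[OF v(6) less(3)] by (simp add: x'_def)
      \<comment> \<open>The induction is general in the bound, so doubling it is harmless.\<close>
      show "norm (x' k) \<le> C + C" for k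
        unfolding x'_def using norm_triangle_ineq4[of "x (r k)" "cinner v (x (r k)) *\<^sub>C v"]
          less(4)[of "r k"] cb[of "r k"] v(2) by (simp add: norm_scaleC)
    qed
    then obtain y r' where y: "y \<in> V'" "strict_mono r'" "(x' \<circ> r') \<longlonglongrightarrow> y" by blast
    have "((\<lambda>k. cinner v (x k)) \<circ> r \<circ> r') \<longlonglongrightarrow> l"
      by (rule LIMSEQ_subseq_LIMSEQ[OF r(2) y(2)])
    then have "(\<lambda>k. cinner v (x (r (r' k)))) \<longlonglongrightarrow> l" by (simp add: o_def)
    from tendsto_add[OF y(3)[unfolded o_def] tendsto_scaleC[OF this tendsto_const[of v]]]
    have "(x \<circ> (r \<circ> r')) \<longlonglongrightarrow> y + l *\<^sub>C v" by (simp add: x'_def o_def)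
    moreover have "strict_mono (r \<circ> r')" by (rule strict_mono_o[OF r(1) y(2)])
    moreover have "y + l *\<^sub>C v \<in> V" using y(1) v(1,4) VD by blast
    ultimately show ?thesis by blast
  qed
qed

lemma clinear_tendsto_zero:
  fixes V :: "'a :: chilbert_space set" and f :: "'a \<Rightarrow> 'b :: chilbert_space"
  assumes fin: "finite_cdim TYPE('a)" and f: "clinear f"
    and "csubspace V" "\<And>k. x k \<in> V" "(x \<longlongrightarrow> 0) F"
  shows "((\<lambda>k. f (x k)) \<longlongrightarrow> 0) F"
proof -
  interpret f: Vector_Spaces.linear scaleC scaleC f by (rule f)
  show ?thesis
    using assms(3-)
  proof (induction "cdim V" arbitrary: V x rule: less_induct)
    case less
    show ?case
    proof (cases "V \<subseteq> {0}")
      case True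
      then have "x = (\<lambda>_. 0)" using less(3) by blast
      then show ?thesis by (simp add: f.zero)
    next
      case False
      obtain v V' where v: "v \<in> V" "norm v = 1" "csubspace V'" "V' \<subseteq> V" "cdim V' < cdim V"
        "\<forall>x\<in>V. x - cinner v x *\<^sub>C v \<in> V'"
        "\<forall>x\<in>V'. cinner v x = 0"
        by (rule cinner_splitE[OF fin less(2) False])
      have c: "((\<lambda>k. cinner v (x k)) \<longlongrightarrow> 0) F"
        using tendsto_cinner[OF tendsto_const less(4), of v] by simp
      define x' where "x' k = x k - cinner v (x k) *\<^sub>C v" for k
      have "((\<lambda>k. f (x' k)) \<longlongrightarrow> 0) F"
      proof (rule less(1)[OF v(5,3)])
        show "x' k \<in> V'" for k using bspec[OF v(6) less(3)] by (simp add: x'_def)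
        show "(x' \<longlongrightarrow> 0) F"
          unfolding x'_def[abs_def]
          using tendsto_diff[OF less(4) tendsto_scaleC[OF c tendsto_const[of v]]] by simp
      qed
      from tendsto_add[OF this tendsto_scaleC[OF c tendsto_const[of "f v"]]]
      show ?thesis by (simp add: x'_def f.diff f.scale)
    qed
  qed
qed

lemma clinear_tendsto:
  fixes f :: "'a :: chilbert_space \<Rightarrow> 'b :: chilbert_space"
  assumes fin: "finite_cdim TYPE('a)" and f: "clinear f" and x: "(x \<longlongrightarrow> y) F"
  shows "((\<lambda>k. f (x k)) \<longlongrightarrow> f y) F"
proof -
  interpret f: Vector_Spaces.linear scaleC scaleC f by (rule f)
  have "((\<lambda>k. f (x k - y)) \<longlongrightarrow> 0) F"
    by (rule clinear_tendsto_zero[OF fin f, of UNIV]) (use x in \<open>auto intro: csubspaceI LIM_zero\<close>)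
  then show ?thesis by (simp add: f.diff LIM_zero_cancel)
qed

section \<open>Decreasing families of Hermitian forms\<close>

text \<open>
  \<open>R\<close> is the common radical of the family and \<open>K s\<close> a complement of it in the radical of \<open>q s\<close>.
\<close>

locale decreasing_forms =
  fixes V R :: "'a :: chilbert_space set" and K :: "real \<Rightarrow> 'a set"
    and q :: "real \<Rightarrow> 'a \<Rightarrow> 'a \<Rightarrow> complex"
  assumes fin: "finite_cdim TYPE('a)"
    and herm: "\<And>s. s < 0 \<Longrightarrow> hermitian_on V (q s)"
    and cont: "\<And>s u v. s < 0 \<Longrightarrow> u \<in> V \<Longrightarrow> v \<in> V \<Longrightarrow> ((\<lambda>t. q t u v) \<longlongrightarrow> q s u v) (at s)"
    and R: "csubspace R" "R \<subseteq> V" "\<And>s u r. s < 0 \<Longrightarrow> u \<in> V \<Longrightarrow> r \<in> R \<Longrightarrow> q s u r = 0"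
    and K: "\<And>s. s < 0 \<Longrightarrow> csubspace (K s)" "\<And>s. s < 0 \<Longrightarrow> K s \<subseteq> V" "\<And>s. s < 0 \<Longrightarrow> K s \<inter> R \<subseteq> {0}"
      "\<And>s u k. s < 0 \<Longrightarrow> u \<in> V \<Longrightarrow> k \<in> K s \<Longrightarrow> q s u k = 0"
    and radical: "\<And>s v. s < 0 \<Longrightarrow> v \<in> V \<Longrightarrow> \<forall>u\<in>V. q s u v = 0 \<Longrightarrow> \<exists>k\<in>K s. \<exists>r\<in>R. v = k + r"
    and strict: "\<And>s t u. s < t \<Longrightarrow> t < 0 \<Longrightarrow> u \<in> V \<Longrightarrow> u \<notin> R \<Longrightarrow> Re (q t u u) < Re (q s u u)"
    and start: "\<exists>s<0. nonneg_on V (q s)"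
begin

abbreviation N :: "real \<Rightarrow> nat" where "N s \<equiv> form_n_minus V (q s)"

lemma V: "csubspace V"
proof -
  have "hermitian_on V (q (-1))" by (rule herm) simp
  then show ?thesis by (rule hermitian_onD(1))
qed

lemma decreasing: "s < t \<Longrightarrow> t < 0 \<Longrightarrow> u \<in> V \<Longrightarrow> Re (q t u u) \<le> Re (q s u u)"
  using strict[of s t u] R(3)[of s u u] R(3)[of t u u] by (cases "u \<in> R") auto

lemma N_mono: "s < t \<Longrightarrow> t < 0 \<Longrightarrow> N s \<le> N t"
  by (rule form_n_minus_mono[where p = "q t" and q = "q s", OF fin V]) (rule decreasing)

text \<open>On \<open>K s\<close> the form vanishes at \<open>s\<close>, and off \<open>R\<close> it
  decreases strictly, so \<open>K s\<close> joins a maximal negative subspace immediately after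
  \<open>s\<close>.\<close>

lemma N_jump_ge:
  assumes st: "s < t" "t < 0"
  shows "N s + cdim (K s) \<le> N t"
proof -
  have s: "s < 0" using st by simp
  note qD = hermitian_onD(1-3,5-)[OF herm[OF s]] and qsym = hermitian_onD(4)[OF herm[OF s]]
  obtain W where W: "csubspace W" "W \<subseteq> V" "negative_on W (q s)" "N s = cdim W"
    by (rule form_n_minus_attained[OF fin V])
  have disj: "W \<inter> K s \<subseteq> {0}"
  proof
    fix x assume x: "x \<in> W \<inter> K s"
    then have "q s x x = 0" using K(4)[OF s, of x x] W(2) by blast
    then show "x \<in> {0}" using W(3) x by force
  qed
  define X where "X = {w + k |w k. w \<in> W \<and> k \<in> K s}"
  have "negative_on X (q t)"
  proof (intro ballI impI)
    fix x assume x: "x \<in> X" "x \<noteq> 0"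
    then obtain w k where wk: "x = w + k" "w \<in> W" "k \<in> K s" by (auto simp: X_def)
    have inV: "w \<in> V" "k \<in> V" "x \<in> V"
      using wk W(2) K(2)[OF s] csubspaceD(2)[OF V] by auto
    have zero: "q s w k = 0" "q s k k = 0" using K(4)[OF s] wk(3) inV by auto
    then have "q s k w = 0" using qsym[OF inV(2,1)] by simp
    then have eq: "q s x x = q s w w" "q s w x = q s w w"
      using wk(1) zero inV by (simp_all add: qD)
    have le: "Re (q s x x) \<le> 0"
      using W(3) wk(2) eq(1) qD(6)[OF csubspaceD(1)[OF V]] by (cases "w = 0") (auto simp: less_imp_le)
    show "Re (q t x x) < 0"
    proof (cases "x \<in> R")
      \<comment> \<open>Strict decrease fails on \<open>R\<close>, but there \<open>w\<close> must
        vanish, and \<open>K s\<close> meets \<open>R\<close> only in 0.\<close>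
      case True
      then have "q s w w = 0" using R(3)[OF s inV(1)] eq(2) by simp
      then have "w = 0" using W(3) wk(2) by force
      then have "x \<in> K s \<inter> R" using wk True by simp
      then show ?thesis using K(3)[OF s] x(2) by blast
    next
      case False
      then show ?thesis using strict[OF st inV(3)] le by linarith
    qed
  qed
  moreover have "csubspace X" unfolding X_def by (rule csubspace_sums[OF W(1) K(1)[OF s]])
  moreover have "X \<subseteq> V" using W(2) K(2)[OF s] csubspaceD(2)[OF V] by (auto simp: X_def)
  ultimately have "cdim X \<le> N t" by (intro form_n_minus_ge[OF fin])
  then show ?thesis
    using cdim_direct_sum[OF fin W(1) K(1)[OF s] disj] W(4) by (simp add: X_def)
qed

text \<open>The positive part \<open>P\<close> of \<open>q s\<close> survives for \<open>t\<close>
  near \<open>s\<close>, and the forms vanish on \<open>R\<close>. So \<open>P + R\<close> is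
  nonnegative for \<open>q t\<close>, which leaves for \<open>N t\<close> at most \<open>N s\<close>
  plus the dimension of the radical modulo \<open>R\<close>.\<close>

lemma N_jump_le:
  assumes s: "s < 0"
  shows "\<forall>\<^sub>F t in at_right s. N t \<le> N s + cdim (K s)"
proof -
  define Z where "Z = {v \<in> V. \<forall>u\<in>V. q s u v = 0}"
  obtain W P where WP: "csubspace W" "csubspace P" "W \<subseteq> V" "P \<subseteq> V" "csubspace Z"
    "negative_on W (q s)" "\<forall>u\<in>P. u \<noteq> 0 \<longrightarrow> 0 < Re (q s u u)"
    "N s = cdim W" "form_n_minus V (\<lambda>u v. - q s u v) = cdim P"
    "cdim W + cdim P + cdim Z = cdim V"
    unfolding Z_def by (rule hermitian_inertia[OF fin herm[OF s]])
  have neg_ev: "\<forall>\<^sub>F t in at_right s. t < 0"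
    using eventually_at_right_field[of "\<lambda>t. t < 0" s] s by auto
  have "\<forall>\<^sub>F t in at_right s. negative_on P (\<lambda>u v. - q t u v)"
  proof (rule eventually_negative_on[where p = "\<lambda>t u v. - q t u v", OF fin])
    show "hermitian_on P (\<lambda>u v. - q s u v)"
      by (intro hermitian_on_minus hermitian_on_subset[OF herm[OF s] WP(2,4)])
    show "negative_on P (\<lambda>u v. - q s u v)" using WP(7) by simp
    show "\<forall>\<^sub>F t in at_right s. hermitian_on P (\<lambda>u v. - q t u v)"
      using neg_ev
      by eventually_elim (intro hermitian_on_minus hermitian_on_subset[OF herm WP(2,4)])
    show "((\<lambda>t. - q t u v) \<longlongrightarrow> - q s u v) (at_right s)" if "u \<in> P" "v \<in> P" for u v
      using that WP(4) cont[OF s, of u v]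
      by (intro tendsto_minus) (auto intro: tendsto_mono[OF at_le])
  qed
  then show ?thesis
    using neg_ev
  proof eventually_elim
    case (elim t)
    note qD = hermitian_onD(1-3,5-)[OF herm[OF elim(2)]]
      and qsym = hermitian_onD(4)[OF herm[OF elim(2)]]
    define U where "U = {p + r |p r. p \<in> P \<and> r \<in> R}"
    have disj: "P \<inter> R \<subseteq> {0}"
    proof
      fix x assume "x \<in> P \<inter> R"
      then show "x \<in> {0}" using WP(7) R(3)[OF s, of x x] WP(4) by force
    qed
    have U: "csubspace U" "U \<subseteq> V"
      using csubspace_sums[OF WP(2) R(1)] WP(4) R(2) csubspaceD(2)[OF V] by (auto simp: U_def)
    have "nonneg_on U (q t)"
    proof
      fix x assume "x \<in> U"
      then obtain p r where pr: "x = p + r" "p \<in> P" "r \<in> R" by (auto simp: U_def)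
      have inV: "p \<in> V" "r \<in> V" using pr WP(4) R(2) by auto
      have zero: "q t p r = 0" "q t r r = 0" using R(3)[OF elim(2)] pr(3) inV by auto
      then have "q t r p = 0" using qsym[OF inV(2,1)] by simp
      then have "q t x x = q t p p" using pr(1) zero inV csubspaceD(2)[OF V] by (simp add: qD)
      then show "0 \<le> Re (q t x x)"
        using elim(1) pr(2) qD(6)[OF csubspaceD(1)[OF V]] by (cases "p = 0") (auto simp: less_imp_le)
    qed
    from form_n_minus_le[where q = "q t", OF fin V U this]
    have "N t + (cdim P + cdim R) \<le> cdim V"
      using cdim_direct_sum[OF fin WP(2) R(1) disj] by (simp add: U_def)
    moreover have "cdim Z \<le> cdim (K s) + cdim R"
      using radical[OF s] by (intro cdim_cover_le[OF fin K(1)[OF s] R(1)]) (simp add: Z_def)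
    ultimately show ?case using WP(8,10) by linarith
  qed
qed

text \<open>For \<open>t < s\<close> the forms lie above \<open>q s\<close>, so moving left creates
  no negative directions, and those of \<open>q s\<close> persist by openness. Jumps occur only to
  the right of a crossing.\<close>

lemma N_left:
  assumes s: "s < 0"
  shows "\<forall>\<^sub>F t in at_left s. N t = N s"
proof (rule eventually_form_n_minus_eq[OF fin herm[OF s]])
  have *: "\<forall>\<^sub>F t in at_left s. t < s" by (simp add: eventually_at_filter)
  then show "\<forall>\<^sub>F t in at_left s. hermitian_on V (q t)"
    by eventually_elim (use s in \<open>auto intro: herm\<close>)
  show "\<forall>\<^sub>F t in at_left s. \<forall>u\<in>V. Re (q s u u) \<le> Re (q t u u)"
    using * by eventually_elim (use decreasing[OF _ s] in auto)
  show "((\<lambda>t. q t u v) \<longlongrightarrow> q s u v) (at_left s)" if "u \<in> V" "v \<in> V" for u v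
    using cont[OF s that] by (rule tendsto_mono[OF at_le, rotated]) simp
qed

section \<open>Counting the crossings\<close>

definition E :: "real set" where "E = {s. s < 0 \<and> K s \<noteq> {0}}"

lemma cdim_K_pos:
  assumes "s \<in> E"
  shows "0 < cdim (K s)"
proof -
  have s: "s < 0" "K s \<noteq> {0}" using assms by (auto simp: E_def)
  then show ?thesis
    using cdim_eq_0[OF fin, of "K s"] csubspaceD(1)[OF K(1)[OF s(1)]] by fastforce
qed

lemma sum_K_le_N:
  assumes "finite A" "A \<subseteq> E" "\<forall>a\<in>A. a < s" "s < 0"
  shows "(\<Sum>a\<in>A. cdim (K a)) \<le> N s"
  using assms
proof (induction A arbitrary: s rule: finite_linorder_max_induct)
  case (insert b A)
  have "(\<Sum>a\<in>A. cdim (K a)) \<le> N b"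
    using insert by (intro insert.IH) (auto simp: E_def)
  moreover have "N b + cdim (K b) \<le> N s" using insert by (intro N_jump_ge) auto
  moreover have "b \<notin> A" using insert(2) by blast
  ultimately show ?case using insert(1) by simp
qed simp

text \<open>Every crossing raises \<open>N\<close> by at least one, while \<open>N\<close> never
  exceeds the dimension of \<open>V\<close>.\<close>

lemma E_finite: "finite E"
proof (rule ccontr)
  assume "infinite E"
  then obtain A where A: "A \<subseteq> E" "finite A" "card A = Suc (cdim V)"
    using infinite_arbitrarily_large[of E "Suc (cdim V)"] by auto
  have neg: "\<forall>a\<in>A. a < 0" using A(1) by (auto simp: E_def)
  have ne: "A \<noteq> {}" using A(3) by auto
  \<comment> \<open>Halving a negative number moves it to the right while keeping it below
    0.\<close>
  define s where "s = Max A / 2"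
  have "Max A < 0" using neg Max_in[OF A(2) ne] by blast
  then have s: "s < 0" "Max A < s" by (simp_all add: s_def)
  have "\<forall>a\<in>A. a < s" using s(2) A(2) by (meson Max_ge le_less_trans)
  then have "(\<Sum>a\<in>A. cdim (K a)) \<le> N s" using sum_K_le_N A s(1) by blast
  moreover have "(\<Sum>a\<in>A. 1) \<le> (\<Sum>a\<in>A. cdim (K a))"
    using cdim_K_pos A(1) by (intro sum_mono) (metis One_nat_def Suc_leI subsetD)
  moreover have "N s \<le> cdim V"
    using form_n_minus_le[where q = "q s" and U = "{0}", OF fin V] csubspaceD(1)[OF V]
      hermitian_onD(7)[OF herm[OF s(1)]]
    by (auto intro: csubspaceI)
  ultimately show False using A(3) by simp
qed

text \<open>The strict bound \<open>t < s\<close> leaves out a crossing at \<open>s\<close> itself,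
  in accordance with the left continuity of \<open>N\<close>.\<close>

definition c :: "real \<Rightarrow> nat" where "c s = (\<Sum>t | t \<in> E \<and> t < s. cdim (K t))"

lemma c_mono: "s \<le> t \<Longrightarrow> c s \<le> c t"
  unfolding c_def by (rule sum_mono2) (use E_finite in auto)

lemma c_jump:
  assumes "s < t" "s < 0"
  shows "c s + cdim (K s) \<le> c t"
proof (cases "s \<in> E")
  case True
  have "c s + cdim (K s) = (\<Sum>t\<in>insert s {t. t \<in> E \<and> t < s}. cdim (K t))"
    using E_finite by (simp add: c_def)
  also have "\<dots> \<le> c t"
    unfolding c_def using E_finite True assms by (intro sum_mono2) auto
  finally show ?thesis .
next
  case False
  then have "cdim (K s) = 0" using assms(2) cdim_eq_0[OF fin, of "K s"] by (simp add: E_def)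
  then show ?thesis using c_mono[of s t] assms(1) by simp
qed

text \<open>The jumps give \<open>c \<le> N\<close>. For the converse, the set where
  \<open>N\<close> exceeds \<open>c\<close> has an infimum \<open>i\<close>, as \<open>N\<close>
  vanishes up to the starting point. If \<open>i\<close> belongs to the set, left continuity
  produces a smaller member; if not, \<open>N\<close> grows across \<open>i\<close> by no more than
  \<open>c\<close> does, and the set keeps a distance from \<open>i\<close>.\<close>

lemma N_eq_c:
  assumes s: "s < 0"
  shows "N s = c s"
proof (rule antisym)
  show "c s \<le> N s"
    unfolding c_def using E_finite s by (intro sum_K_le_N) auto
  show "N s \<le> c s"
  proof (rule ccontr)
    define B where "B = {s. s < 0 \<and> c s < N s}"
    assume "\<not> N s \<le> c s"
    then have sB: "s \<in> B" using s by (simp add: B_def)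
    obtain s0 where s0: "s0 < 0" "nonneg_on V (q s0)" using start by blast
    have "N s0 = 0"
      using form_n_minus_le[where q = "q s0", OF fin V V _ s0(2)] by simp
    then have "s0 \<le> t" if "t \<in> B" for t
      using that N_mono[of t s0] s0(1) by (fastforce simp: B_def not_le)
    then have bdd: "bdd_below B" by (rule bdd_belowI)
    define i where "i = Inf B"
    have i: "i \<le> t" if "t \<in> B" for t unfolding i_def by (rule cInf_lower[OF that bdd])
    have i0: "i < 0" using i[OF sB] s by simp
    show False
    proof (cases "i \<in> B")
      case True
      have "\<forall>\<^sub>F t in at_left i. t < i \<and> N t = N i"
        using N_left[OF i0] by (simp add: eventually_conj_iff eventually_at_filter)
      then obtain t where t: "t < i" "N t = N i"
        using eventually_happens'[OF trivial_limit_at_left_real] by blast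
      have "t \<in> B" using True t c_mono[of t i] by (auto simp: B_def)
      then show False using i[of t] t(1) by simp
    next
      case False
      then have "N i \<le> c i" using i0 by (simp add: B_def)
      obtain b where b: "i < b" "\<And>t. i < t \<Longrightarrow> t < b \<Longrightarrow> N t \<le> N i + cdim (K i)"
        using N_jump_le[OF i0] by (auto simp: eventually_at_right_field)
      have "b \<le> t" if "t \<in> B" for t
      proof (rule ccontr)
        assume "\<not> b \<le> t"
        moreover have "i < t" using i[OF that] False that by (cases "i = t") auto
        ultimately have "N t \<le> N i + cdim (K i)" using b(2) by simp
        also have "\<dots> \<le> c t" using c_jump[OF \<open>i < t\<close> i0] \<open>N i \<le> c i\<close> by linarith
        finally show False using that by (simp add: B_def)
      qed
      then have "b \<le> i" unfolding i_def using sB by (intro cInf_greatest) auto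
      then show False using b(1) by simp
    qed
  qed
qed

lemma eventually_N_eq_sum:
  "\<forall>\<^sub>F s in at_left 0. N s = (\<Sum>s | s < 0 \<and> K s \<noteq> {0}. cdim (K s))"
proof -
  \<comment> \<open>The entry -1 keeps the maximum defined when there are no crossings.\<close>
  define a where "a = Max (insert (-1) E)"
  have "a \<in> insert (-1) E" unfolding a_def using E_finite by (intro Max_in) auto
  then have a0: "a < 0" by (auto simp: E_def)
  have le: "t \<le> a" if "t \<in> E" for t unfolding a_def using E_finite that by (intro Max_ge) auto
  have "N s = (\<Sum>s | s < 0 \<and> K s \<noteq> {0}. cdim (K s))" if "a < s" "s < 0" for s
  proof -
    have "{t. t \<in> E \<and> t < s} = {s. s < 0 \<and> K s \<noteq> {0}}"
      using le that by (fastforce simp: E_def)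
    then show ?thesis using N_eq_c[OF that(2)] by (simp add: c_def)
  qed
  then show ?thesis using a0 by (auto simp: eventually_at_left_field)
qed

lemma crossings_finite: "finite {s. s < 0 \<and> K s \<noteq> {0}}"
  using E_finite by (simp add: E_def)

end

section \<open>Positive eigenvalues of a self-adjoint operator in finite dimension\<close>

lemma sum_enat: "(\<Sum>x\<in>A. enat (f x)) = enat (\<Sum>x\<in>A. f x)"
  by (simp flip: of_nat_eq_enat of_nat_sum)

text \<open>The crossing argument in place of a spectral theorem. The forms
  \<open>- s \<langle>x, y\<rangle> - \<langle>x, A y\<rangle>\<close> decrease strictly in
  \<open>s\<close>, their radical at \<open>s\<close> is the eigenspace of \<open>A\<close> for
  \<open>- s\<close>, and at 0 they end in the form of \<open>- A\<close>.\<close>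

lemma n_plus_on_eq_form_n_minus:
  fixes A :: "'a :: chilbert_space \<Rightarrow> 'a"
  assumes fin: "finite_cdim TYPE('a)" and V: "csubspace V" and A: "selfadjoint_on V A"
  shows "n_plus_on V A = enat (form_n_minus V (\<lambda>x y. - cinner x (A y)))"
proof -
  have A_add: "A (x + y) = A x + A y" if "x \<in> V" "y \<in> V" for x y
    using A that by (simp add: selfadjoint_on_def clinear_on_def)
  have A_scale: "A (c *\<^sub>C x) = c *\<^sub>C A x" if "x \<in> V" for c x
    using A that by (simp add: selfadjoint_on_def clinear_on_def)
  have A_sym: "cinner (A x) y = cinner x (A y)" if "x \<in> V" "y \<in> V" for x y
    using A that by (simp add: selfadjoint_on_def)
  have A_in: "A x \<in> V" if "x \<in> V" for x
    using A that by (auto simp: selfadjoint_on_def)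
  define K where "K s = {x \<in> V. A x = complex_of_real (- s) *\<^sub>C x}" for s
  define q where "q s x y = complex_of_real (- s) * cinner x y - cinner x (A y)" for s x y
  have h: "hermitian_on V (\<lambda>x y. complex_of_real a * cinner x y + complex_of_real b * cinner x (A y))" for a b
    unfolding hermitian_on_def
  proof (intro conjI ballI allI)
    show "complex_of_real a * cinner x y + complex_of_real b * cinner x (A y)
        = cnj (complex_of_real a * cinner y x + complex_of_real b * cinner y (A x))"
      if "x \<in> V" "y \<in> V" for x y
      using A_sym[OF that] cinner_commute[of x y] cinner_commute[of "A x" y] by simp
  qed (auto simp: V A_add A_scale cinner_simps algebra_simps)
  interpret decreasing_forms V "{0}" K q
  proof unfold_locales
    fix s :: real assume s: "s < 0"
    show "hermitian_on V (q s)" using h[of "- s" "-1"] by (simp add: q_def[abs_def])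
    show "csubspace (K s)"
      using A_scale[OF csubspaceD(1)[OF V], of 0]
      by (auto intro!: csubspaceI simp: K_def csubspaceD[OF V] A_add A_scale scaleC_add_right
          scaleC_scaleC mult.commute)
    show "K s \<subseteq> V" by (auto simp: K_def)
    show "((\<lambda>t. q t u v) \<longlongrightarrow> q s u v) (at s)" for u v
      unfolding q_def by (intro tendsto_intros)
    show "q s u k = 0" if "k \<in> K s" for u k
      using that by (simp add: K_def q_def cinner_simps del: of_real_minus)
    show "\<exists>k\<in>K s. \<exists>r\<in>{0}. v = k + r" if v: "v \<in> V" "\<forall>u\<in>V. q s u v = 0" for v
    proof -
      define d where "d = complex_of_real (- s) *\<^sub>C v - A v"
      have "d \<in> V" using v(1) A_in V unfolding d_def by (blast intro: csubspaceD)
      moreover have "cinner d d = q s d v"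
        unfolding q_def cinner_diff_right[symmetric] cinner_scaleC_right[symmetric] d_def ..
      ultimately have "cinner d d = 0" using v(2) by simp
      then have "A v = complex_of_real (- s) *\<^sub>C v" by (simp add: d_def)
      then show ?thesis using v(1) by (simp add: K_def)
    qed
  next
    show "Re (q t u u) < Re (q s u u)" if "s < t" "u \<notin> {0}" for s t :: real and u
      using that by (simp add: q_def Re_cinner_self)
    show "q s u r = 0" if "r \<in> {0}" for s u r
      using that A_scale[OF csubspaceD(1)[OF V], of 0] by (simp add: q_def)
    show "\<exists>s<0. nonneg_on V (q s)"
    proof -
      \<comment> \<open>The form at \<open>s = - (k + 1)\<close> rescaled by
        \<open>- 1 / (k + 1)\<close>. It tends to the negative of the inner product, so openness of
        negative definiteness takes the place of a bound on the norm of \<open>A\<close>.\<close>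
      define p where "p k x y = complex_of_real (-1) * cinner x y
        + complex_of_real (1 / real (Suc k)) * cinner x (A y)" for k x y
      have "\<forall>\<^sub>F k in sequentially. negative_on V (p k)"
      proof (rule eventually_negative_on[where p = p, OF fin])
        show "hermitian_on V (\<lambda>x y. complex_of_real (-1) * cinner x y + complex_of_real 0 * cinner x (A y))"
          by (rule h)
        show "negative_on V (\<lambda>x y. complex_of_real (-1) * cinner x y + complex_of_real 0 * cinner x (A y))"
          by (simp add: Re_cinner_self)
        show "\<forall>\<^sub>F k in sequentially. hermitian_on V (p k)"
          unfolding p_def by (intro always_eventually allI h)
        show "(\<lambda>k. p k u v) \<longlonglongrightarrow> complex_of_real (-1) * cinner u v + complex_of_real 0 * cinner u (A v)" for u v
          unfolding p_def by (intro tendsto_intros LIMSEQ_Suc[OF lim_1_over_n])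
      qed
      then obtain k where k: "negative_on V (p k)" by (auto simp: eventually_sequentially)
      have "0 \<le> Re (q (- real (Suc k)) u u)" if "u \<in> V" for u
      proof -
        have "Re (p k u u) \<le> 0"
          using k that A_scale[OF csubspaceD(1)[OF V], of 0] by (cases "u = 0") (auto simp: p_def less_imp_le)
        moreover have "Re (q (- real (Suc k)) u u) = - (real (Suc k) * Re (p k u u))"
          by (simp add: q_def p_def field_simps del: of_nat_Suc)
        ultimately show ?thesis by (simp add: mult_nonneg_nonpos del: of_nat_Suc)
      qed
      then show ?thesis by (intro exI[of _ "- real (Suc k)"]) auto
    qed
  qed (use fin csubspaceD(1)[OF V] in \<open>auto intro: csubspaceI\<close>)
  let ?r = "\<lambda>x y. - cinner x (A y)"
  have "\<forall>\<^sub>F s in at_left (0::real). form_n_minus V (q s) = form_n_minus V ?r"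
  proof (rule eventually_form_n_minus_eq[OF fin])
    show "hermitian_on V ?r" using h[of 0 "-1"] by simp
    have neg: "\<forall>\<^sub>F s in at_left (0::real). s < 0" by (simp add: eventually_at_filter)
    then show "\<forall>\<^sub>F s in at_left 0. hermitian_on V (q s)"
      by eventually_elim (rule herm)
    show "\<forall>\<^sub>F s in at_left 0. \<forall>u\<in>V. Re (?r u u) \<le> Re (q s u u)"
      using neg by eventually_elim (simp add: q_def Re_cinner_self mult_nonpos_nonneg)
    have "((\<lambda>s. q s u v) \<longlongrightarrow> complex_of_real (- 0) * cinner u v - cinner u (A v)) (at_left 0)" for u v
      unfolding q_def by (intro tendsto_intros)
    then show "((\<lambda>s. q s u v) \<longlongrightarrow> ?r u v) (at_left 0)" for u v by simp
  qed
  with eventually_N_eq_sum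
  have "\<forall>\<^sub>F s in at_left (0::real). form_n_minus V ?r = (\<Sum>s | s < 0 \<and> K s \<noteq> {0}. cdim (K s))"
    by eventually_elim simp
  then have N: "form_n_minus V ?r = (\<Sum>s | s < 0 \<and> K s \<noteq> {0}. cdim (K s))"
    by simp
  have eig: "eigenspace ((\<lambda>x. (x, A x)) ` V) (complex_of_real \<mu>) = K (- \<mu>)" for \<mu>
    by (auto simp: eigenspace_def K_def image_iff)
  have E: "{\<mu> \<in> {0<..}. K (- \<mu>) \<noteq> {0}} = uminus ` {s. s < 0 \<and> K s \<noteq> {0}}"
  proof (intro equalityI subsetI)
    fix \<mu> assume "\<mu> \<in> {\<mu> \<in> {0<..}. K (- \<mu>) \<noteq> {0}}"
    then show "\<mu> \<in> uminus ` {s. s < 0 \<and> K s \<noteq> {0}}" by (intro image_eqI[of _ _ "- \<mu>"]) simp_all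
  next
    fix \<mu> assume "\<mu> \<in> uminus ` {s. s < 0 \<and> K s \<noteq> {0}}"
    then obtain s where "\<mu> = - s" "s < 0" "K s \<noteq> {0}" by (elim imageE CollectE conjE) (rule that)
    then show "\<mu> \<in> {\<mu> \<in> {0<..}. K (- \<mu>) \<noteq> {0}}" by simp
  qed
  show ?thesis
    unfolding n_plus_on_def eigenvalue_count_def eig Let_def E
    using crossings_finite N
    by (simp add: sum.reindex inj_on_def ecdim_eq[OF fin] sum_enat del: Collect_conj_eq)
qed

section \<open>Symplectic linear algebra\<close>

lemma sympl_simps:
  "sympl (u + v) w = sympl u w + sympl v w" "sympl w (u + v) = sympl w u + sympl w v"
  "sympl (u - v) w = sympl u w - sympl v w" "sympl w (u - v) = sympl w u - sympl w v"
  "sympl (c *\<^sub>C u) w = cnj c * sympl u w" "sympl w (c *\<^sub>C u) = c * sympl w u"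
  "sympl (- u) w = - sympl u w" "sympl w (- u) = - sympl w u"
  "sympl 0 w = 0" "sympl w 0 = 0"
  by (simp_all add: sympl_def cinner_simps scaleC_prod_def algebra_simps)

lemma sympl_commute: "sympl u v = - cnj (sympl v u)"
  unfolding sympl_def
  using cinner_commute[of "fst u" "snd v"] cinner_commute[of "snd u" "fst v"] by simp

lemma sympl_eq_0_commute: "sympl u v = 0 \<longleftrightarrow> sympl v u = 0"
  using sympl_commute[of u v] by simp

lemma Re_sympl_commute: "Re (sympl u v) = - Re (sympl v u)"
  using sympl_commute[of u v] by simp

lemma tendsto_sympl:
  "(f \<longlongrightarrow> u) F \<Longrightarrow> (g \<longlongrightarrow> v) F \<Longrightarrow> ((\<lambda>t. sympl (f t) (g t)) \<longlongrightarrow> sympl u v) F"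
  unfolding sympl_def by (intro tendsto_diff tendsto_cinner tendsto_fst tendsto_snd)

text \<open>The complex structure that turns \<open>sympl\<close> into the inner product of the
  doubled space, see \<open>sympl_jrot\<close>.\<close>

definition jrot :: "'k :: chilbert_space \<times> 'k \<Rightarrow> 'k \<times> 'k" where
  "jrot u = (- snd u, fst u)"

lemma sympl_jrot: "sympl u (jrot v) = cinner u v"
  by (simp add: sympl_def jrot_def cinner_prod_def cinner_simps)

lemma jrot_surj: "jrot (snd u, - fst u) = u"
  by (simp add: jrot_def)

lemma sympl_nondegenerate:
  assumes "\<And>v. sympl v u = 0"
  shows "u = 0"
proof -
  have "cinner v (snd u, - fst u) = 0" for v
    using assms[of v] sympl_jrot[of v "(snd u, - fst u)"] by (simp add: jrot_surj)
  then have "(snd u, - fst u) = 0" using cinner_self_eq_zero_iff by blast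
  then show ?thesis by (simp add: zero_prod_def prod_eq_iff)
qed

text \<open>Green's identity gives access to symplectic pairings only, so convergence of boundary
  values is tested against them; \<open>jrot\<close> converts them into inner products.\<close>

lemma tendsto_of_sympl_tendsto:
  fixes x :: "'b \<Rightarrow> 'k :: chilbert_space \<times> 'k"
  assumes fin: "finite_cdim TYPE('k)" and lim: "\<And>v. ((\<lambda>t. sympl v (x t)) \<longlongrightarrow> sympl v y) F"
  shows "(x \<longlongrightarrow> y) F"
proof -
  have rot: "cinner v z = - sympl (jrot v) z" for v z :: "'k \<times> 'k"
    using sympl_jrot[of z v] sympl_commute[of "jrot v" z] cinner_commute[of v z] by simp
  show ?thesis
    by (rule tendsto_of_weakly_tendsto[OF finite_cdim_prod[OF fin fin]])
      (unfold rot, intro tendsto_minus lim)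
qed

lemma convergent_of_sympl_convergent:
  fixes x :: "'b \<Rightarrow> 'k :: chilbert_space \<times> 'k"
  assumes fin: "finite_cdim TYPE('k)" and lim: "\<And>v. \<exists>l. ((\<lambda>t. sympl v (x t)) \<longlongrightarrow> l) F"
  shows "\<exists>y. (x \<longlongrightarrow> y) F"
proof -
  have rot: "cinner v z = - sympl (jrot v) z" for v z :: "'k \<times> 'k"
    using sympl_jrot[of z v] sympl_commute[of "jrot v" z] cinner_commute[of v z] by simp
  have "\<exists>l. ((\<lambda>t. cinner v (x t)) \<longlongrightarrow> l) F" for v
    unfolding rot using lim[of "jrot v"] by (elim exE) (rule exI, erule tendsto_minus)
  then have "\<exists>y\<in>UNIV. (x \<longlongrightarrow> y) F"
    by (intro convergent_of_weakly_convergent[OF finite_cdim_prod[OF fin fin]]) (auto intro: csubspaceI)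
  then show ?thesis by blast
qed

lemma lagrangianD:
  assumes "lagrangian L"
  shows "csubspace L" "u \<in> L \<Longrightarrow> v \<in> L \<Longrightarrow> sympl u v = 0"
    "(\<And>v. v \<in> L \<Longrightarrow> sympl u v = 0) \<Longrightarrow> u \<in> L"
  using assms unfolding lagrangian_def by blast+

text \<open>If \<open>u\<close> annihilates \<open>A\<close>, its part in \<open>B\<close>
  annihilates both \<open>A\<close> and \<open>B\<close>, hence everything, and nondegeneracy
  removes it. Dimensions are not counted, so the criterion suits planes given by boundary values and
  the limit plane.\<close>

lemma lagrangianI_isotropic_sum:
  assumes A: "csubspace A" "\<And>u v. u \<in> A \<Longrightarrow> v \<in> A \<Longrightarrow> sympl u v = 0"
    and B: "csubspace B" "\<And>u v. u \<in> B \<Longrightarrow> v \<in> B \<Longrightarrow> sympl u v = 0"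
    and sum: "\<And>x. \<exists>a\<in>A. x - a \<in> B"
  shows "lagrangian A"
proof -
  have "u \<in> A" if u: "\<forall>v\<in>A. sympl u v = 0" for u
  proof -
    obtain a where a: "a \<in> A" "u - a \<in> B" using sum by blast
    have "sympl x (u - a) = 0" for x
    proof -
      obtain y where y: "y \<in> A" "x - y \<in> B" using sum by blast
      have "sympl y (u - a) = 0"
        using u A(2) a(1) y(1) by (simp add: sympl_simps sympl_eq_0_commute[of y u])
      moreover have "sympl (x - y) (u - a) = 0" using B(2) a(2) y(2) by simp
      ultimately show ?thesis by (simp add: sympl_simps)
    qed
    then have "u - a = 0" by (rule sympl_nondegenerate)
    then show ?thesis using a(1) by simp
  qed
  then show ?thesis unfolding lagrangian_def using A by blast
qed

lemma orthogonal_projection_exists: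
  fixes V :: "'a :: chilbert_space set"
  assumes fin: "finite_cdim TYPE('a)" and "csubspace V"
  shows "\<exists>v\<in>V. \<forall>u\<in>V. cinner u (x - v) = 0"
  using assms(2)
proof (induction "cdim V" arbitrary: V rule: less_induct)
  case less
  note VD = csubspaceD[OF less(2)]
  show ?case
  proof (cases "V \<subseteq> {0}")
    case True
    then show ?thesis using VD(1) by (intro bexI[of _ 0]) auto
  next
    case False
    obtain v V' where v: "v \<in> V" "norm v = 1" "csubspace V'" "V' \<subseteq> V" "cdim V' < cdim V"
      "\<forall>x\<in>V. x - cinner v x *\<^sub>C v \<in> V'" "\<forall>x\<in>V'. cinner v x = 0"
      by (rule cinner_splitE[OF fin less(2) False])
    obtain y where y: "y \<in> V'" "\<forall>u\<in>V'. cinner u (x - y) = 0"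
      using less(1)[OF v(5,3)] by blast
    define p where "p = y + cinner v x *\<^sub>C v"
    have "cinner v v = 1" using v(2) by (simp add: cinner_self)
    then have 1: "cinner v (x - p) = 0" using v(7) y(1) by (simp add: p_def cinner_simps)
    have "cinner u (x - p) = 0" if u: "u \<in> V" for u
    proof -
      define u' where "u' = u - cinner v u *\<^sub>C v"
      have u': "u' \<in> V'" using v(6) u by (simp add: u'_def)
      then have "cinner u' v = 0" using v(7) cinner_commute[of u' v] by simp
      then have "cinner u' (x - p) = 0" using y(2) u' by (simp add: p_def cinner_simps)
      moreover have "u = u' + cinner v u *\<^sub>C v" by (simp add: u'_def)
      ultimately show ?thesis using 1 cinner_add_left[of u' "cinner v u *\<^sub>C v" "x - p"]
        by (simp add: cinner_scaleC_left)
    qed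
    moreover have "p \<in> V" using y(1) v(1,4) VD by (auto simp: p_def)
    ultimately show ?thesis by blast
  qed
qed

lemma csubspace_UNIV: "csubspace UNIV"
  by (rule csubspaceI) auto

text \<open>The rotation \<open>jrot\<close> maps the orthogonal complement of \<open>L\<close> onto
  \<open>L\<close>, so the two have equal dimension.\<close>

lemma cdim_lagrangian:
  fixes L :: "('k :: chilbert_space \<times> 'k) set"
  assumes fin: "finite_cdim TYPE('k)" and L: "lagrangian L"
  shows "2 * cdim L = cdim (UNIV :: ('k \<times> 'k) set)"
proof -
  note fin2 = finite_cdim_prod[OF fin fin] and LD = lagrangianD[OF L]
  define A where "A = {x. \<forall>u\<in>L. cinner u x = 0}"
  have A: "csubspace A" unfolding A_def by (rule csubspaceI) (simp_all add: cinner_simps)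
  have im: "jrot ` A = L"
  proof (intro equalityI subsetI)
    fix y assume "y \<in> jrot ` A"
    then obtain x where x: "y = jrot x" "\<forall>u\<in>L. cinner u x = 0" by (auto simp: A_def)
    show "y \<in> L"
      by (rule LD(3)) (use x sympl_jrot sympl_eq_0_commute in metis)
  next
    fix y assume y: "y \<in> L"
    have "cinner u (snd y, - fst y) = 0" if "u \<in> L" for u
      using sympl_jrot[of u "(snd y, - fst y)"] LD(2)[OF that y] by (simp add: jrot_surj)
    then have "(snd y, - fst y) \<in> A" by (simp add: A_def)
    then show "y \<in> jrot ` A" using jrot_surj[of y] by (metis imageI)
  qed
  have "cdim (jrot ` A) = cdim A"
    by (rule cdim_clinear_on_image[OF A])
      (auto simp: clinear_on_def jrot_def scaleC_prod_def inj_on_def prod_eq_iff)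
  then have "cdim L = cdim A" using im by simp
  moreover have "cdim (UNIV :: ('k \<times> 'k) set) = cdim L + cdim A"
  proof (rule antisym)
    have "\<exists>v\<in>L. \<exists>w\<in>A. x = v + w" for x
    proof -
      obtain v where "v \<in> L" "\<forall>u\<in>L. cinner u (x - v) = 0"
        using orthogonal_projection_exists[OF fin2 LD(1), of x] by blast
      then show ?thesis by (intro bexI[of _ v] bexI[of _ "x - v"]) (auto simp: A_def)
    qed
    then show "cdim (UNIV :: ('k \<times> 'k) set) \<le> cdim L + cdim A"
      by (intro cdim_cover_le[OF fin2 LD(1) A]) auto
    have "x = 0" if "x \<in> L" "x \<in> A" for x
      using that cinner_self_eq_zero_iff[of x] by (auto simp: A_def)
    then have "L \<inter> A \<subseteq> {0}" by auto
    then show "cdim L + cdim A \<le> cdim (UNIV :: ('k \<times> 'k) set)"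
      by (intro cdim_disjoint_le[OF fin2 LD(1) A _ csubspace_UNIV]) auto
  qed
  ultimately show ?thesis by simp
qed

subsection \<open>Projections along a complementary subspace\<close>

definition transversal :: "'a :: chilbert_space set \<Rightarrow> 'a set \<Rightarrow> bool" where
  "transversal A B \<longleftrightarrow> csubspace A \<and> csubspace B \<and> A \<inter> B = {0} \<and> (\<forall>x. \<exists>a\<in>A. x - a \<in> B)"

text \<open>The first argument is the kernel of the projection, the second its range.\<close>

definition proj_along :: "'a :: chilbert_space set \<Rightarrow> 'a set \<Rightarrow> 'a \<Rightarrow> 'a" where
  "proj_along B A x = (THE a. a \<in> A \<and> x - a \<in> B)"

lemma transversal_commute: "transversal A B \<Longrightarrow> transversal B A"
proof -
  assume T: "transversal A B"
  have "\<exists>b\<in>B. x - b \<in> A" for x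
  proof -
    obtain a where "a \<in> A" "x - a \<in> B" using T by (auto simp: transversal_def)
    then show ?thesis by (intro bexI[of _ "x - a"]) auto
  qed
  then show ?thesis using T by (auto simp: transversal_def)
qed

lemma transversal_lagrangian:
  fixes A B :: "('k :: chilbert_space \<times> 'k) set"
  assumes fin: "finite_cdim TYPE('k)" and A: "lagrangian A" and B: "lagrangian B"
    and disj: "A \<inter> B = {0}"
  shows "transversal A B"
proof -
  note fin2 = finite_cdim_prod[OF fin fin]
  note As = lagrangianD(1)[OF A] and Bs = lagrangianD(1)[OF B]
  define X where "X = {x + y |x y. x \<in> A \<and> y \<in> B}"
  have "cdim X = cdim A + cdim B"
    unfolding X_def using disj by (intro cdim_direct_sum[OF fin2 As Bs]) simp
  then have "cdim (UNIV :: ('k \<times> 'k) set) \<le> cdim X"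
    using cdim_lagrangian[OF fin A] cdim_lagrangian[OF fin B] by simp
  then have "X = UNIV"
    using csubspace_sums[OF As Bs, folded X_def]
    by (intro cdim_eq_imp_eq[OF fin2 _ csubspace_UNIV]) simp_all
  have "\<exists>a\<in>A. x - a \<in> B" for x
  proof -
    have "x \<in> X" using \<open>X = UNIV\<close> by simp
    then obtain a b where "x = a + b" "a \<in> A" "b \<in> B" by (auto simp: X_def)
    then show ?thesis by (intro bexI[of _ a]) auto
  qed
  then show ?thesis using As Bs disj by (simp add: transversal_def)
qed

context
  fixes A B :: "'a :: chilbert_space set"
  assumes T: "transversal A B"
begin

lemma proj_along_eqI:
  assumes "a \<in> A" "x - a \<in> B"
  shows "proj_along B A x = a"
  unfolding proj_along_def
proof (rule the_equality)
  fix b assume b: "b \<in> A \<and> x - b \<in> B"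
  have s: "csubspace A" "csubspace B" "A \<inter> B = {0}" using T by (auto simp: transversal_def)
  have "(x - a) - (x - b) \<in> B" using assms b s by (blast intro: csubspaceD)
  then have "b - a \<in> B" by simp
  moreover have "b - a \<in> A" using assms b s by (blast intro: csubspaceD)
  ultimately have "b - a = 0" using s(3) by blast
  then show "b = a" by simp
qed (use assms in simp)

lemma proj_along:
  "proj_along B A x \<in> A" "x - proj_along B A x \<in> B"
proof -
  obtain a where "a \<in> A" "x - a \<in> B" using T by (auto simp: transversal_def)
  then show "proj_along B A x \<in> A" "x - proj_along B A x \<in> B"
    using proj_along_eqI[of a x] by simp_all
qed

lemma proj_along_rev: "proj_along B A x - x \<in> B"
  using csubspaceD(5)[of B "x - proj_along B A x"] proj_along(2) T by (simp add: transversal_def)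

lemma proj_along_id: "a \<in> A \<Longrightarrow> proj_along B A a = a"
  using T by (intro proj_along_eqI) (auto simp: transversal_def csubspaceD)

lemma proj_along_add: "proj_along B A (x + y) = proj_along B A x + proj_along B A y"
proof (rule proj_along_eqI)
  have s: "csubspace A" "csubspace B" using T by (auto simp: transversal_def)
  show "proj_along B A x + proj_along B A y \<in> A" by (intro csubspaceD(2)[OF s(1)] proj_along)
  have "(x - proj_along B A x) + (y - proj_along B A y) \<in> B"
    by (intro csubspaceD(2)[OF s(2)] proj_along)
  then show "x + y - (proj_along B A x + proj_along B A y) \<in> B" by (simp add: algebra_simps)
qed

lemma proj_along_scale: "proj_along B A (c *\<^sub>C x) = c *\<^sub>C proj_along B A x"
proof (rule proj_along_eqI)
  have s: "csubspace A" "csubspace B" using T by (auto simp: transversal_def)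
  show "c *\<^sub>C proj_along B A x \<in> A" by (intro csubspaceD(3)[OF s(1)] proj_along)
  have "c *\<^sub>C (x - proj_along B A x) \<in> B" by (intro csubspaceD(3)[OF s(2)] proj_along)
  then show "c *\<^sub>C x - c *\<^sub>C proj_along B A x \<in> B" by (simp add: scaleC_diff_right)
qed

lemma clinear_proj_along: "clinear (proj_along B A)"
  unfolding Vector_Spaces.linear_iff
  by (simp add: proj_along_add proj_along_scale complex_vector.vector_space_axioms)

lemma proj_along_diff: "proj_along B A (x - y) = proj_along B A x - proj_along B A y"
proof -
  interpret Vector_Spaces.linear scaleC scaleC "proj_along B A" by (rule clinear_proj_along)
  show ?thesis by (rule diff)
qed

lemma proj_along_cong: "x - y \<in> B \<Longrightarrow> proj_along B A x = proj_along B A y"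
proof (rule proj_along_eqI)
  have s: "csubspace A" "csubspace B" using T by (auto simp: transversal_def)
  assume "x - y \<in> B"
  then have "(x - y) + (y - proj_along B A y) \<in> B" by (intro csubspaceD(2)[OF s(2)] proj_along)
  then show "x - proj_along B A y \<in> B" by simp
qed (rule proj_along)

end

lemma proj_along_split:
  assumes T: "transversal A B"
  shows "x = proj_along B A x + proj_along A B x"
proof -
  have "proj_along A B x = x - proj_along B A x"
    by (rule proj_along_eqI[OF transversal_commute[OF T]]) (use proj_along[OF T, of x] in auto)
  then show ?thesis by simp
qed

lemma proj_along_diff_mem:
  assumes "transversal A L" "transversal B L"
  shows "proj_along L B x - proj_along L A x \<in> L"
proof -
  have "csubspace L" using assms(1) by (simp add: transversal_def)
  then have "(proj_along L B x - x) + (x - proj_along L A x) \<in> L"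
    by (intro csubspaceD(2) proj_along_rev[OF assms(2)] proj_along(2)[OF assms(1)])
  then show ?thesis by simp
qed

lemma scaleC_Pair: "c *\<^sub>C (x, y) = (c *\<^sub>C x, c *\<^sub>C y)"
  and fst_scaleC: "fst (c *\<^sub>C u) = c *\<^sub>C fst u"
  and snd_scaleC: "snd (c *\<^sub>C u) = c *\<^sub>C snd u"
  by (simp_all add: scaleC_prod_def)

subsection \<open>The Duistermaat index\<close>

text \<open>
  Modulo \<open>L'\<close>, a plane transversal to \<open>L'\<close> amounts to a Hermitian form, and \<open>pform L' A B\<close> is the
  form of \<open>B\<close> minus the form of \<open>A\<close>.
\<close>

definition pform ::
  "('k :: chilbert_space \<times> 'k) set \<Rightarrow> ('k \<times> 'k) set \<Rightarrow> ('k \<times> 'k) set \<Rightarrow> 'k \<times> 'k \<Rightarrow> 'k \<times> 'k \<Rightarrow> complex"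
  where "pform L' A B u v = sympl (proj_along L' A u) (proj_along L' B v)"

text \<open>The projections of one vector to \<open>A\<close> and to \<open>B\<close> differ by an
  element of \<open>L'\<close>. As all three planes are isotropic, \<open>\<omega>(a, b)\<close> and
  \<open>- \<omega>(b', a')\<close> reduce to the same pairing with such a difference. Unlike for
  the split forms, symmetry holds on every subspace.\<close>

lemma pform_hermitian:
  assumes TA: "transversal A L'" and TB: "transversal B L'"
    and lag: "lagrangian A" "lagrangian B" "lagrangian L'" and V: "csubspace V"
  shows "hermitian_on V (pform L' A B)"
  unfolding hermitian_on_def pform_def
proof (intro conjI ballI allI)
  note iso = lagrangianD(2)[OF lag(1)] lagrangianD(2)[OF lag(2)] lagrangianD(2)[OF lag(3)]
  fix u v
  let ?a = "proj_along L' A u" and ?b = "proj_along L' B v"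
    and ?a' = "proj_along L' A v" and ?b' = "proj_along L' B u"
  have mem: "?a \<in> A" "?a' \<in> A" "?b \<in> B" "?b' \<in> B"
    by (rule proj_along[OF TA] proj_along[OF TB])+
  note diff = proj_along_diff_mem[OF TA TB]
  define l where "l = ?b' - ?a"
  define l' where "l' = ?b - ?a'"
  have l: "l \<in> L'" "l' \<in> L'" using diff by (simp_all add: l_def l'_def)
  have "sympl ?a ?b = sympl ?a (?a' + l')" by (simp add: l'_def)
  also have "\<dots> = sympl ?a l'" using iso(1)[OF mem(1,2)] by (simp add: sympl_simps)
  finally have 1: "sympl ?a ?b = sympl ?a l'" .
  have "sympl ?b' ?a' = sympl ?b' (?b - l')" by (simp add: l'_def)
  also have "\<dots> = - sympl (?a + l) l'" using iso(2)[OF mem(4,3)] by (simp add: sympl_simps l_def)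
  also have "\<dots> = - sympl ?a l'" using iso(3)[OF l] by (simp add: sympl_simps)
  finally show "sympl ?a ?b = cnj (sympl ?a' ?b')"
    using 1 sympl_commute[of ?a' ?b'] by simp
qed (simp_all add: V proj_along_add[OF TB] proj_along_scale[OF TB] sympl_simps)

text \<open>Cocycle identity. The change of projection from \<open>A\<close> to \<open>B\<close> and
  that from \<open>B\<close> to \<open>C\<close> both lie in \<open>L'\<close>, so their pairing
  vanishes; expanding it leaves the claim once \<open>B\<close> is known to be isotropic.\<close>

lemma pform_add:
  assumes T: "transversal A L'" "transversal B L'" "transversal C L'"
    and lag: "lagrangian B" "lagrangian L'"
  shows "pform L' A C u v = pform L' A B u v + pform L' B C u v"
proof -
  let ?l = "proj_along L' C v - proj_along L' B v"
  have l: "?l \<in> L'" by (rule proj_along_diff_mem[OF T(2,3)])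
  have "proj_along L' B u - proj_along L' A u \<in> L'"
    by (rule proj_along_diff_mem[OF T(1,2)])
  then have "sympl (proj_along L' B u - proj_along L' A u) ?l = 0"
    using lagrangianD(2)[OF lag(2)] l by blast
  then have "sympl (proj_along L' B u) (proj_along L' C v) - sympl (proj_along L' B u) (proj_along L' B v)
      = sympl (proj_along L' A u) (proj_along L' C v) - sympl (proj_along L' A u) (proj_along L' B v)"
    unfolding sympl_simps by (simp add: algebra_simps)
  moreover have "sympl (proj_along L' B u) (proj_along L' B v) = 0"
    using lagrangianD(2)[OF lag(1)] proj_along(1)[OF T(2)] by blast
  ultimately show ?thesis by (simp add: pform_def)
qed

lemma pform_proj:
  assumes T: "transversal A L'" "transversal B L'" "transversal C L'"
  shows "pform L' A B (proj_along L' C u) (proj_along L' C v) = pform L' A B u v"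
  unfolding pform_def
  using proj_along_cong[OF T(1) proj_along_rev[OF T(3)]] proj_along_cong[OF T(2) proj_along_rev[OF T(3)]]
  by simp

text \<open>All planes transversal to \<open>L'\<close> are models of the quotient by
  \<open>L'\<close>, and projection along \<open>L'\<close> identifies them; hence one base plane
  can serve for every term of the index.\<close>

lemma pform_n_minus_base:
  assumes T: "transversal A L'" "transversal B L'" "transversal C L'" "transversal D L'"
  shows "form_n_minus D (pform L' A B) = form_n_minus C (pform L' A B)"
proof -
  have C: "csubspace C" and CL: "C \<inter> L' = {0}" and L': "csubspace L'"
    using T(3) by (auto simp: transversal_def)
  have "inj_on (proj_along L' D) C"
  proof (rule inj_onI)
    fix x y assume xy: "x \<in> C" "y \<in> C" "proj_along L' D x = proj_along L' D y"
    have "(x - proj_along L' D x) - (y - proj_along L' D y) \<in> L'"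
      by (intro csubspaceD(4)[OF L'] proj_along[OF T(4)])
    then have "x - y \<in> L'" using xy(3) by simp
    moreover have "x - y \<in> C" using csubspaceD(4)[OF C xy(1,2)] .
    ultimately have "x - y = 0" using CL by blast
    then show "x = y" by simp
  qed
  moreover have "proj_along L' D ` C = D"
  proof (intro equalityI subsetI)
    fix d assume d: "d \<in> D"
    have "proj_along L' D (proj_along L' C d) = d"
      using proj_along_cong[OF T(4) proj_along_rev[OF T(3)], of d] proj_along_id[OF T(4) d] by simp
    then show "d \<in> proj_along L' D ` C" using proj_along(1)[OF T(3)] by (metis imageI)
  qed (use proj_along(1)[OF T(4)] in blast)
  moreover have "clinear_on C (proj_along L' D)"
    by (simp add: clinear_on_def proj_along_add[OF T(4)] proj_along_scale[OF T(4)])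
  ultimately show ?thesis
    using form_n_minus_iso[where V = C and f = "proj_along L' D" and p = "pform L' A B" and q = "pform L' A B", OF C]
      pform_proj[OF T(1,2,4)] by simp
qed

lemma lagr_form_eq:
  assumes T: "transversal C L'" and A: "lagrangian A" and uv: "u \<in> A" "v \<in> A"
  shows "lagr_form A L' C u v = sympl u (proj_along L' C v)"
proof -
  have "(THE l. l \<in> L' \<and> v + l \<in> C) = proj_along L' C v - v"
  proof (rule the_equality)
    show "proj_along L' C v - v \<in> L' \<and> v + (proj_along L' C v - v) \<in> C"
      using proj_along_rev[OF T] proj_along(1)[OF T] by simp
    fix l assume l: "l \<in> L' \<and> v + l \<in> C"
    have "csubspace L'" using T by (simp add: transversal_def)
    then have "v - (v + l) \<in> L'" using l csubspaceD(5) by fastforce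
    then have "proj_along L' C v = v + l" using l by (intro proj_along_eqI[OF T]) auto
    then show "l = proj_along L' C v - v" by simp
  qed
  then show ?thesis
    unfolding lagr_form_def using lagrangianD(2)[OF A uv] by (simp add: sympl_simps)
qed

lemma form_n_minus_lagr_form:
  assumes T: "transversal A L'" "transversal C L'" and A: "lagrangian A"
  shows "form_n_minus A (lagr_form A L' C) = form_n_minus A (pform L' A C)"
proof -
  have "lagr_form A L' C u u = pform L' A C u u" if "u \<in> A" for u
    using lagr_form_eq[OF T(2) A that that] proj_along_id[OF T(1) that] by (simp add: pform_def)
  then have "(\<forall>u\<in>W. u \<noteq> 0 \<longrightarrow> Re (lagr_form A L' C u u) < 0) \<longleftrightarrow> negative_on W (pform L' A C)"
    if "W \<subseteq> A" for W
    using that by (intro ball_cong refl) (metis subsetD)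
  then show ?thesis unfolding form_n_minus_def by (metis (no_types, opaque_lifting))
qed

lemma duistermaat_via_pform:
  assumes T: "transversal A L'" "transversal B L'" "transversal C L'" "transversal D L'"
    and lag: "lagrangian A" "lagrangian B"
  shows "duistermaat_via L' A B C = int (form_n_minus D (pform L' B C))
    - int (form_n_minus D (pform L' A C)) + int (form_n_minus D (pform L' A B))"
  unfolding duistermaat_via_def
  using form_n_minus_lagr_form[OF T(2,3) lag(2)] form_n_minus_lagr_form[OF T(1,3) lag(1)]
    form_n_minus_lagr_form[OF T(1,2) lag(1)] pform_n_minus_base[OF T(2,3,4,2)]
    pform_n_minus_base[OF T(1,3,4,1)] pform_n_minus_base[OF T(1,2,4,1)]
  by simp

text \<open>
  The negative index of this form expresses the Duistermaat index without reference to an auxiliary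
  plane: for any \<open>L'\<close>, the form is congruent to \<open>P\<^sub>A\<^sub>B \<oplus> P\<^sub>B\<^sub>C \<oplus> (- P\<^sub>A\<^sub>C)\<close> with \<open>P = pform L'\<close>.
\<close>

definition kashiwara_form ::
  "('k :: chilbert_space \<times> 'k) \<times> ('k \<times> 'k) \<times> ('k \<times> 'k) \<Rightarrow>
   ('k \<times> 'k) \<times> ('k \<times> 'k) \<times> ('k \<times> 'k) \<Rightarrow> complex" where
  "kashiwara_form u v = sympl (fst u) (fst (snd v)) + sympl (fst (snd u)) (snd (snd v))
     + sympl (snd (snd u)) (fst v)"

text \<open>The right side is free of \<open>L'\<close>, which is the independence of the auxiliary
  plane. The correction comes from the minus sign of the third summand: the indices of the form on
  \<open>A\<close> and of its negative add up to \<open>dim A - dim (A \<inter> C)\<close>.\<close>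

lemma duistermaat_via_kashiwara:
  fixes A B C L' :: "('k :: chilbert_space \<times> 'k) set"
  assumes fin: "finite_cdim TYPE('k)"
    and T: "transversal A L'" "transversal B L'" "transversal C L'"
    and lag: "lagrangian A" "lagrangian B" "lagrangian C" "lagrangian L'"
  shows "duistermaat_via L' A B C
    = int (form_n_minus (A \<times> B \<times> C) kashiwara_form) - int (cdim A) + int (cdim (A \<inter> C))"
proof -
  note fin2 = finite_cdim_prod[OF fin fin]
  have sub: "csubspace A" "csubspace B" "csubspace C" "csubspace L'"
    using lag by (auto intro: lagrangianD)
  let ?a = "proj_along L' A" and ?b = "proj_along L' B" and ?c = "proj_along L' C"
  let ?P = "pform L'"
  \<comment> \<open>The combinations \<open>x + y - w\<close>, \<open>y + w - x\<close>,
    \<open>x + w - y\<close> are made for polarization: after \<open>pform_add\<close> the summands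
    combine as \<open>q(a + b) - q(a - b) = 4 Re q(a, b)\<close>, which leaves four times the three
    cyclic mixed terms.\<close>
  define f where "f u = (?a (fst u + fst (snd u) - snd (snd u)),
    ?b (fst (snd u) + snd (snd u) - fst u), ?a (fst u + snd (snd u) - fst (snd u)))" for u
  define p where "p u v = ?P A B (fst u) (fst v)
      + (?P B C (fst (snd u)) (fst (snd v)) + - ?P A C (snd (snd u)) (snd (snd v)))"
    for u v :: "('k \<times> 'k) \<times> ('k \<times> 'k) \<times> ('k \<times> 'k)"
  note herm = pform_hermitian[OF T(1,2) lag(1,2,4)] pform_hermitian[OF T(2,3) lag(2,3,4)]
    pform_hermitian[OF T(1,3) lag(1,3,4)]
  have S: "csubspace (A \<times> B \<times> C)" by (intro csubspace_Times sub)
  have f_lin: "clinear_on (A \<times> B \<times> C) f"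
    unfolding clinear_on_def f_def
    by (simp add: scaleC_Pair fst_scaleC snd_scaleC scaleC_add_right[symmetric] scaleC_diff_right[symmetric]
        proj_along_scale[OF T(1)] proj_along_scale[OF T(2)])
      (simp add: algebra_simps proj_along_add[OF T(1)] proj_along_diff[OF T(1)]
        proj_along_add[OF T(2)] proj_along_diff[OF T(2)])
  have double: "2 *\<^sub>C x = x + x" for x :: "'k \<times> 'k"
    using scaleC_add_left[of 1 1 x] by simp
  have half: "x \<in> X" if "csubspace X" "x + x \<in> X" for X and x :: "'k \<times> 'k"
    using csubspaceD(3)[OF that, of "1/2"] by (simp add: double[symmetric] scaleC_scaleC)
  have f_inj: "inj_on f (A \<times> B \<times> C)"
  proof (rule inj_onI)
    fix u v assume uv: "u \<in> A \<times> B \<times> C" "v \<in> A \<times> B \<times> C" "f u = f v"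
    obtain x y w where d: "u - v = (x, y, w)" by (metis surj_pair)
    have "u - v \<in> A \<times> B \<times> C" by (rule csubspaceD(4)[OF S uv(1,2)])
    then have xyw: "x \<in> A" "y \<in> B" "w \<in> C" using d by auto
    have "f (u - v) = f u - f v" by (rule clinear_on_diff[OF S f_lin uv(1,2)])
    then have "f (x, y, w) = 0" using uv(3) d by simp
    then have z: "?a (x + y - w) = 0" "?b (y + w - x) = 0" "?a (x + w - y) = 0"
      by (auto simp: f_def zero_prod_def)
    have L: "x + y - w \<in> L'" "y + w - x \<in> L'" "x + w - y \<in> L'"
      using proj_along(2)[OF T(1), of "x + y - w"] proj_along(2)[OF T(2), of "y + w - x"]
        proj_along(2)[OF T(1), of "x + w - y"] z by auto
    have "x + x \<in> L'" using csubspaceD(2)[OF sub(4) L(1,3)] by (simp add: algebra_simps)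
    moreover have "y + y \<in> L'" using csubspaceD(2)[OF sub(4) L(1,2)] by (simp add: algebra_simps)
    moreover have "w + w \<in> L'" using csubspaceD(2)[OF sub(4) L(2,3)] by (simp add: algebra_simps)
    ultimately have "x \<in> L'" "y \<in> L'" "w \<in> L'" using half[OF sub(4)] by blast+
    then have "x = 0" "y = 0" "w = 0" using xyw T by (auto simp: transversal_def)
    then have "u - v = 0" using d by (simp add: zero_prod_def)
    then show "u = v" by simp
  qed
  have f_surj: "f ` (A \<times> B \<times> C) = A \<times> B \<times> A"
  proof (intro equalityI subsetI)
    fix e assume "e \<in> A \<times> B \<times> A"
    then obtain e1 e2 e3 where e: "e = (e1, e2, e3)" "e1 \<in> A" "e2 \<in> B" "e3 \<in> A" by auto
    define h where "h z = (1/2) *\<^sub>C z" for z :: "'k \<times> 'k"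
    have hh: "h z + h z = z" for z
      by (simp add: h_def double[symmetric] scaleC_scaleC)
    have h_add: "h (z + z') = h z + h z'" for z z' by (simp add: h_def scaleC_add_right)
    \<comment> \<open>Half sums invert the three combinations modulo \<open>L'\<close>, which is
      enough because \<open>f\<close> projects along \<open>L'\<close>.\<close>
    define x where "x = ?a (h (e1 + e3))"
    define y where "y = ?b (h (e1 + e2))"
    define w where "w = ?c (h (e2 + e3))"
    define dx where "dx = x - h (e1 + e3)"
    define dy where "dy = y - h (e1 + e2)"
    define dw where "dw = w - h (e2 + e3)"
    have d: "dx \<in> L'" "dy \<in> L'" "dw \<in> L'"
      unfolding dx_def dy_def dw_def x_def y_def w_def
      by (rule proj_along_rev[OF T(1)] proj_along_rev[OF T(2)] proj_along_rev[OF T(3)])+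
    have exp: "x = h e1 + h e3 + dx" "y = h e1 + h e2 + dy" "w = h e2 + h e3 + dw"
      by (simp_all add: dx_def dy_def dw_def h_add)
    have "(x + y - w) - e1 = dx + dy - dw" "(y + w - x) - e2 = dy + dw - dx" "(x + w - y) - e3 = dx + dw - dy"
      unfolding exp using hh[of e1] hh[of e2] hh[of e3] by (simp_all add: algebra_simps)
    then have "(x + y - w) - e1 \<in> L'" "(y + w - x) - e2 \<in> L'" "(x + w - y) - e3 \<in> L'"
      using d csubspaceD(2,4)[OF sub(4)] by simp_all
    then have "f (x, y, w) = e"
      unfolding f_def e(1)
      using proj_along_cong[OF T(1), of "x + y - w" e1] proj_along_cong[OF T(2), of "y + w - x" e2]
        proj_along_cong[OF T(1), of "x + w - y" e3] proj_along_id[OF T(1)] proj_along_id[OF T(2)] e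
      by simp
    moreover have "(x, y, w) \<in> A \<times> B \<times> C"
      using proj_along(1)[OF T(1)] proj_along(1)[OF T(2)] proj_along(1)[OF T(3)]
      by (simp add: x_def y_def w_def)
    ultimately show "e \<in> f ` (A \<times> B \<times> C)" by (metis imageI)
  qed (use proj_along(1)[OF T(1)] proj_along(1)[OF T(2)] in \<open>auto simp: f_def\<close>)
  have key: "Re (p (f u) (f u)) = 4 * Re (kashiwara_form u u)" if u: "u \<in> A \<times> B \<times> C" for u
  proof -
    obtain x y w where e: "u = (x, y, w)" "x \<in> A" "y \<in> B" "w \<in> C" using u by auto
    note H = hermitian_onD(1-3,5-)[OF herm(1)[OF csubspace_UNIV], simplified]
      hermitian_onD(1-3,5-)[OF herm(2)[OF csubspace_UNIV], simplified]
      hermitian_onD(1-3,5-)[OF herm(3)[OF csubspace_UNIV], simplified]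
    have sym: "Re (?P A B z z') = Re (?P A B z' z)" "Re (?P B C z z') = Re (?P B C z' z)" for z z'
      using hermitian_onD(4)[OF herm(1)[OF csubspace_UNIV], of z z']
        hermitian_onD(4)[OF herm(2)[OF csubspace_UNIV], of z z'] by simp_all
    have ac: "?P A C z z' = ?P A B z z' + ?P B C z z'" for z z'
      by (rule pform_add[OF T lag(2,4)])
    have vals: "?P A B x y = sympl x y" "?P B C y w = sympl y w" "?P A C x w = sympl x w"
      using e(2-4) by (simp_all add: pform_def proj_along_id[OF T(1)] proj_along_id[OF T(2)] proj_along_id[OF T(3)])
    have "Re (p (f u) (f u)) = Re (?P A B (x + y - w) (x + y - w)) + Re (?P B C (y + w - x) (y + w - x))
        - Re (?P A C (x + w - y) (x + w - y))"
      unfolding p_def f_def e(1)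
      by (simp add: pform_proj[OF T(1,2,1)] pform_proj[OF T(2,3,2)] pform_proj[OF T(1,3,1)])
    also have "\<dots> = 4 * (Re (?P A B x y) - Re (?P A B x w)) + 4 * (Re (?P B C y w) - Re (?P B C x w))"
      unfolding ac using sym(1)[of y x] sym(1)[of w x] sym(1)[of w y]
        sym(2)[of y x] sym(2)[of w x] sym(2)[of w y]
      by (simp add: H algebra_simps)
    also have "\<dots> = 4 * (Re (?P A B x y) + Re (?P B C y w) - Re (?P A C x w))"
      unfolding ac by simp
    also have "\<dots> = 4 * Re (kashiwara_form u u)"
      unfolding vals e(1) kashiwara_form_def using Re_sympl_commute[of w x] by simp
    finally show ?thesis .
  qed
  have "form_n_minus (A \<times> B \<times> C) kashiwara_form = form_n_minus (A \<times> B \<times> A) p"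
    using form_n_minus_iso[where p = p and q = kashiwara_form, OF S f_lin f_inj] key f_surj
    by simp
  also have "\<dots> = form_n_minus A (?P A B)
      + form_n_minus (B \<times> A) (\<lambda>u v. ?P B C (fst u) (fst v) + - ?P A C (snd u) (snd v))"
  proof (rule form_n_minus_Times[OF fin2 finite_cdim_prod[OF fin2 fin2] herm(1)[OF sub(1)]])
    show "hermitian_on (B \<times> A) (\<lambda>u v. ?P B C (fst u) (fst v) + - ?P A C (snd u) (snd v))"
      unfolding hermitian_on_def
    proof (intro conjI ballI allI)
      note H = hermitian_onD(1-3,5-)[OF herm(2)[OF csubspace_UNIV], simplified]
        hermitian_onD(1-3,5-)[OF herm(3)[OF csubspace_UNIV], simplified]
      show "csubspace (B \<times> A)" by (intro csubspace_Times sub)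
      fix u v
      show "?P B C (fst u) (fst v) + - ?P A C (snd u) (snd v)
          = cnj (?P B C (fst v) (fst u) + - ?P A C (snd v) (snd u))"
        using hermitian_onD(4)[OF herm(2)[OF csubspace_UNIV], of "fst u" "fst v"]
          hermitian_onD(4)[OF herm(3)[OF csubspace_UNIV], of "snd u" "snd v"] by simp
    qed (simp_all add: hermitian_onD(2,3)[OF herm(2)[OF csubspace_UNIV], simplified]
          hermitian_onD(2,3)[OF herm(3)[OF csubspace_UNIV], simplified] fst_scaleC snd_scaleC algebra_simps)
  qed (simp add: p_def)
  also have "form_n_minus (B \<times> A) (\<lambda>u v. ?P B C (fst u) (fst v) + - ?P A C (snd u) (snd v))
      = form_n_minus B (?P B C) + form_n_minus A (\<lambda>u v. - ?P A C u v)"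
    by (rule form_n_minus_Times[OF fin2 fin2 herm(2)[OF sub(2)] hermitian_on_minus[OF herm(3)[OF sub(1)]]])
      simp
  finally have K: "form_n_minus (A \<times> B \<times> C) kashiwara_form = form_n_minus A (?P A B)
      + (form_n_minus B (?P B C) + form_n_minus A (\<lambda>u v. - ?P A C u v))" .
  \<comment> \<open>For \<open>v\<close> in the radical, the projection to \<open>C\<close>
    annihilates \<open>A\<close>, hence lies in \<open>A\<close>, and differs from \<open>v\<close>
    by an element of \<open>A \<inter> L'\<close>.\<close>
  have "{v \<in> A. \<forall>u\<in>A. ?P A C u v = 0} = A \<inter> C"
  proof (intro equalityI subsetI IntI)
    fix v assume v: "v \<in> {v \<in> A. \<forall>u\<in>A. ?P A C u v = 0}"
    then show vA: "v \<in> A" by simp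
    have "sympl u (?c v) = 0" if "u \<in> A" for u
      using v that proj_along_id[OF T(1) that] by (auto simp: pform_def)
    then have "?c v \<in> A" by (intro lagrangianD(3)[OF lag(1)]) (simp add: sympl_eq_0_commute)
    then have "?c v - v \<in> A" using csubspaceD(4)[OF sub(1) _ vA] by blast
    moreover have "A \<inter> L' = {0}" using T(1) by (simp add: transversal_def)
    ultimately have "?c v - v = 0" using proj_along_rev[OF T(3), of v] by blast
    then show "v \<in> C" using proj_along(1)[OF T(3), of v] by simp
  next
    fix v assume "v \<in> A \<inter> C"
    then show "v \<in> {v \<in> A. \<forall>u\<in>A. ?P A C u v = 0}"
      using lagrangianD(2)[OF lag(1)] proj_along_id[OF T(1)] proj_along_id[OF T(3)]
      by (simp add: pform_def)
  qed
  then have "form_n_minus A (?P A C) + form_n_minus A (\<lambda>u v. - ?P A C u v) + cdim (A \<inter> C) = cdim A"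
    using form_n_minus_uminus[OF fin2 herm(3)[OF sub(1)]] by simp
  moreover have "duistermaat_via L' A B C = int (form_n_minus B (?P B C))
      - int (form_n_minus A (?P A C)) + int (form_n_minus A (?P A B))"
    unfolding duistermaat_via_def
    using form_n_minus_lagr_form[OF T(2,3) lag(2)] form_n_minus_lagr_form[OF T(1,3) lag(1)]
      form_n_minus_lagr_form[OF T(1,2) lag(1)] by simp
  ultimately show ?thesis using K by simp
qed

text \<open>The plane picked by the choice operator and the given \<open>L'\<close> produce the same
  value by \<open>duistermaat_via_kashiwara\<close>; \<open>L'\<close> also witnesses that a plane
  to pick exists.\<close>

lemma duistermaat_index_eq_via:
  fixes A B C L' :: "('k :: chilbert_space \<times> 'k) set"
  assumes fin: "finite_cdim TYPE('k)"
    and lag: "lagrangian A" "lagrangian B" "lagrangian C" "lagrangian L'"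
    and disj: "L' \<inter> A = {0}" "L' \<inter> B = {0}" "L' \<inter> C = {0}"
  shows "duistermaat_index A B C = duistermaat_via L' A B C"
proof -
  let ?L = "SOME L'. lagrangian L' \<and> L' \<inter> A = {0} \<and> L' \<inter> B = {0} \<and> L' \<inter> C = {0}"
  have L: "lagrangian ?L \<and> ?L \<inter> A = {0} \<and> ?L \<inter> B = {0} \<and> ?L \<inter> C = {0}"
    by (rule someI[of _ L']) (use lag(4) disj in simp)
  have T: "transversal X Y" if "lagrangian X" "lagrangian Y" "Y \<inter> X = {0}" for X Y :: "('k \<times> 'k) set"
    using transversal_lagrangian[OF fin that(1,2)] that(3) by (simp add: Int_commute)
  show ?thesis
    unfolding duistermaat_index_def
    using duistermaat_via_kashiwara[OF fin T[OF lag(1)] T[OF lag(2)] T[OF lag(3)] lag(1-3), of ?L]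
      duistermaat_via_kashiwara[OF fin T[OF lag(1)] T[OF lag(2)] T[OF lag(3)] lag(1-4)] L lag(4) disj
    by simp
qed

section \<open>The index of a triple with transversal outer planes\<close>

text \<open>Transversal planes pair nondegenerately, so this is a hyperbolic form: the graphs of a
  map from \<open>A\<close> to \<open>C\<close> and of its negative are a negative and a nonnegative
  subspace, each of half the dimension. Symmetrizing makes the form Hermitian and leaves its real
  diagonal that of the pairing.\<close>

lemma hyperbolic_n_minus:
  fixes A C :: "('k :: chilbert_space \<times> 'k) set"
  assumes fin: "finite_cdim TYPE('k)" and lag: "lagrangian A" "lagrangian C" and disj: "A \<inter> C = {0}"
  shows "form_n_minus (C \<times> A) (\<lambda>u v. (sympl (fst u) (snd v) - sympl (snd u) (fst v)) / 2) = cdim A"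
    (is "form_n_minus _ ?h = _")
proof -
  note fin2 = finite_cdim_prod[OF fin fin]
  have T: "transversal A C" by (rule transversal_lagrangian[OF fin lag disj])
  note T' = transversal_commute[OF T]
  have sub: "csubspace A" "csubspace C" using lag by (auto intro: lagrangianD)
  \<comment> \<open>The component of \<open>jrot m\<close> in \<open>C\<close>. Discarding the part
    in \<open>A\<close> does not change the pairing with \<open>m \<in> A\<close>, which is
    therefore the squared norm.\<close>
  define \<theta> where "\<theta> m = proj_along A C (jrot m)" for m
  have \<theta>_lin: "\<theta> (x + y) = \<theta> x + \<theta> y" "\<theta> (c *\<^sub>C x) = c *\<^sub>C \<theta> x" for x y c
  proof -
    have "jrot (x + y) = jrot x + jrot y" "jrot (c *\<^sub>C x) = c *\<^sub>C jrot x"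
      by (simp_all add: jrot_def scaleC_prod_def)
    then show "\<theta> (x + y) = \<theta> x + \<theta> y" "\<theta> (c *\<^sub>C x) = c *\<^sub>C \<theta> x"
      by (simp_all add: \<theta>_def proj_along_add[OF T'] proj_along_scale[OF T'])
  qed
  have \<theta>_mem: "\<theta> x \<in> C" for x unfolding \<theta>_def by (rule proj_along(1)[OF T'])
  have val: "sympl m (\<theta> m) = of_real ((norm m)\<^sup>2)" if "m \<in> A" for m
  proof -
    have "sympl m (\<theta> m - jrot m) = 0"
      unfolding \<theta>_def by (rule lagrangianD(2)[OF lag(1) that proj_along_rev[OF T']])
    then show ?thesis by (simp add: sympl_simps sympl_jrot cinner_self)
  qed
  have Re_h: "Re (?h (c *\<^sub>C \<theta> m, m) (c *\<^sub>C \<theta> m, m)) = - Re c * (norm m)\<^sup>2" if "m \<in> A" for c m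
    using val[OF that] sympl_commute[of "\<theta> m" m] by (simp add: sympl_simps field_simps)
  have S: "csubspace (C \<times> A)" by (intro csubspace_Times sub)
  define W where "W c = (\<lambda>m. (c *\<^sub>C \<theta> m, m)) ` A" for c
  have W_lin: "clinear_on A (\<lambda>m. (c *\<^sub>C \<theta> m, m))" "inj_on (\<lambda>m. (c *\<^sub>C \<theta> m, m)) A" for c
    unfolding clinear_on_def inj_on_def
    by (simp_all add: \<theta>_lin scaleC_add_right scaleC_scaleC mult.commute scaleC_Pair)
  have W: "csubspace (W c)" "cdim (W c) = cdim A" for c
    unfolding W_def by (rule clinear_on_image[OF sub(1) W_lin])+
  have WS: "W c \<subseteq> C \<times> A" for c
    unfolding W_def using csubspaceD(3)[OF sub(2) \<theta>_mem] by auto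
  have "\<theta> 0 = 0" using \<theta>_lin(2)[of 0 0] by simp
  have "negative_on (W 1) ?h"
  proof (intro ballI impI)
    fix u assume u: "u \<in> W 1" "u \<noteq> 0"
    then obtain m where m: "m \<in> A" "u = (1 *\<^sub>C \<theta> m, m)" by (auto simp: W_def)
    then have "m \<noteq> 0" using u(2) \<open>\<theta> 0 = 0\<close> by (auto simp: zero_prod_def)
    then show "Re (?h u u) < 0" using Re_h[of m 1] m by simp
  qed
  then have "cdim A \<le> form_n_minus (C \<times> A) ?h"
    using form_n_minus_ge[where q = ?h, OF finite_cdim_prod[OF fin2 fin2] W(1) WS, of 1] W(2) by simp
  moreover have "nonneg_on (W (-1)) ?h"
  proof
    fix u assume "u \<in> W (-1)"
    then obtain m where "m \<in> A" "u = ((-1) *\<^sub>C \<theta> m, m)" by (auto simp: W_def)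
    then show "0 \<le> Re (?h u u)" using Re_h[of m "-1"] by simp
  qed
  then have "form_n_minus (C \<times> A) ?h + cdim A \<le> cdim (C \<times> A)"
    using form_n_minus_le[where q = ?h, OF finite_cdim_prod[OF fin2 fin2] S W(1) WS, of "-1"] W(2) by simp
  moreover have "cdim (C \<times> A) = cdim A + cdim A"
    using cdim_Times[OF fin2 fin2 sub(2,1)] cdim_lagrangian[OF fin lag(1)] cdim_lagrangian[OF fin lag(2)]
    by simp
  ultimately show ?thesis by simp
qed

text \<open>Expand \<open>sympl u v = 0\<close> on \<open>B\<close> along \<open>A\<close> and
  \<open>C\<close>: the pure terms vanish, so the two mixed terms are opposite.\<close>

lemma split_form_hermitian:
  assumes AC: "transversal A C" and lag: "lagrangian A" "lagrangian C" "lagrangian B"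
  shows "hermitian_on B (\<lambda>u v. sympl (proj_along C A u) (proj_along A C v))" (is "hermitian_on B ?q")
  unfolding hermitian_on_def
proof (intro conjI ballI allI)
  note CA = transversal_commute[OF AC]
  let ?a = "proj_along C A" and ?c = "proj_along A C"
  fix u v assume uv: "u \<in> B" "v \<in> B"
  have "sympl u v = 0" by (rule lagrangianD(2)[OF lag(3) uv])
  moreover have "sympl u v = sympl (?a u + ?c u) (?a v + ?c v)"
    using proj_along_split[OF AC, of u] proj_along_split[OF AC, of v] by simp
  moreover have "sympl (?a u) (?a v) = 0" "sympl (?c u) (?c v) = 0"
    using lagrangianD(2)[OF lag(1) proj_along(1)[OF AC] proj_along(1)[OF AC]]
      lagrangianD(2)[OF lag(2) proj_along(1)[OF CA] proj_along(1)[OF CA]] by simp_all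
  ultimately have "?q u v = - sympl (?c u) (?a v)" by (simp add: sympl_simps add_eq_0_iff)
  then show "?q u v = cnj (?q v u)" using sympl_commute[of "?c u" "?a v"] by simp
qed (simp_all add: lagrangianD(1)[OF lag(3)] proj_along_add[OF transversal_commute[OF AC]]
    proj_along_scale[OF transversal_commute[OF AC]] sympl_simps)

text \<open>Completing the square in the Kashiwara form: subtracting from the outer variables the
  components of the middle one decouples it into the split form on \<open>B\<close> and a hyperbolic
  form, whose index \<open>dim A\<close> cancels the correction in
  \<open>duistermaat_via_kashiwara\<close>.\<close>

lemma duistermaat_via_transversal:
  fixes A B C L' :: "('k :: chilbert_space \<times> 'k) set"
  assumes fin: "finite_cdim TYPE('k)"
    and T: "transversal A L'" "transversal B L'" "transversal C L'"
    and lag: "lagrangian A" "lagrangian B" "lagrangian C" "lagrangian L'"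
    and disj: "A \<inter> C = {0}"
  shows "duistermaat_via L' A B C
    = int (form_n_minus B (\<lambda>u v. sympl (proj_along C A u) (proj_along A C v)))"
proof -
  note fin2 = finite_cdim_prod[OF fin fin]
  have AC: "transversal A C" by (rule transversal_lagrangian[OF fin lag(1,3) disj])
  note CA = transversal_commute[OF AC]
  have sub: "csubspace A" "csubspace B" "csubspace C"
    using lag by (auto intro: lagrangianD)
  let ?a = "proj_along C A" and ?c = "proj_along A C"
  let ?q = "\<lambda>u v. sympl (?a u) (?c v)"
  let ?h = "\<lambda>u v :: ('k \<times> 'k) \<times> ('k \<times> 'k). (sympl (fst u) (snd v) - sympl (snd u) (fst v)) / 2"
  define f where "f u = (fst (snd u), snd (snd u) - ?c (fst (snd u)), fst u - ?a (fst (snd u)))" for u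
  define p where "p u v = ?q (fst u) (fst v) + ?h (snd u) (snd v)"
    for u v :: "('k \<times> 'k) \<times> ('k \<times> 'k) \<times> ('k \<times> 'k)"
  have S: "csubspace (A \<times> B \<times> C)" by (intro csubspace_Times sub)
  have f_lin: "clinear_on (A \<times> B \<times> C) f"
    unfolding clinear_on_def f_def
    by (simp add: scaleC_Pair fst_scaleC snd_scaleC scaleC_diff_right
        proj_along_scale[OF AC] proj_along_scale[OF CA])
      (simp add: algebra_simps proj_along_add[OF AC] proj_along_add[OF CA])
  have f_inj: "inj_on f (A \<times> B \<times> C)" by (auto simp: inj_on_def f_def)
  have f_surj: "f ` (A \<times> B \<times> C) = B \<times> C \<times> A"
  proof (intro equalityI subsetI)
    fix e assume "e \<in> f ` (A \<times> B \<times> C)"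
    then obtain u where u: "u \<in> A \<times> B \<times> C" "e = f u" by blast
    then show "e \<in> B \<times> C \<times> A"
      using csubspaceD(4)[OF sub(1) _ proj_along(1)[OF AC]] csubspaceD(4)[OF sub(3) _ proj_along(1)[OF CA]]
      by (simp add: f_def mem_Times_iff)
  next
    fix e assume "e \<in> B \<times> C \<times> A"
    then obtain y w x where e: "e = (y, w, x)" "y \<in> B" "w \<in> C" "x \<in> A" by auto
    then have "e = f (x + ?a y, y, w + ?c y)" by (simp add: f_def)
    moreover have "(x + ?a y, y, w + ?c y) \<in> A \<times> B \<times> C"
      using e csubspaceD(2)[OF sub(1) _ proj_along(1)[OF AC]] csubspaceD(2)[OF sub(3) _ proj_along(1)[OF CA]]
      by simp
    ultimately show "e \<in> f ` (A \<times> B \<times> C)" by blast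
  qed
  have key: "Re (p (f u) (f u)) = Re (kashiwara_form u u)" if u: "u \<in> A \<times> B \<times> C" for u
  proof -
    obtain x y w where e: "u = (x, y, w)" "x \<in> A" "y \<in> B" "w \<in> C" using u by auto
    define a c where "a = ?a y" and "c = ?c y"
    have y: "y = a + c" unfolding a_def c_def by (rule proj_along_split[OF AC])
    have mem: "a \<in> A" "c \<in> C"
      unfolding a_def c_def by (rule proj_along(1)[OF AC] proj_along(1)[OF CA])+
    have z: "sympl x a = 0" "sympl c w = 0"
      using lagrangianD(2)[OF lag(1) e(2) mem(1)] lagrangianD(2)[OF lag(3) mem(2) e(4)] by simp_all
    have Reh: "Re (?h (v, v') (v, v')) = Re (sympl v v')" for v v'
      using Re_sympl_commute[of v' v] by simp
    have "Re (p (f u) (f u)) = Re (sympl a c) + Re (sympl (w - c) (x - a))"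
      unfolding p_def f_def e(1) using Reh[of "w - c" "x - a"] by (simp add: a_def c_def)
    also have "\<dots> = Re (sympl x c) + Re (sympl a w) + Re (sympl w x)"
      using Re_sympl_commute[of c x] Re_sympl_commute[of w a] Re_sympl_commute[of c a]
      by (simp add: sympl_simps)
    also have "\<dots> = Re (kashiwara_form u u)"
      unfolding e(1) kashiwara_form_def y using z by (simp add: sympl_simps)
    finally show ?thesis .
  qed
  have q: "hermitian_on B ?q" by (rule split_form_hermitian[OF AC lag(1,3,2)])
  have h: "hermitian_on (C \<times> A) ?h"
    unfolding hermitian_on_def
  proof (intro conjI ballI allI)
    show "csubspace (C \<times> A)" by (intro csubspace_Times sub)
    fix u v :: "('k \<times> 'k) \<times> ('k \<times> 'k)"
    show "?h u v = cnj (?h v u)"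
      using sympl_commute[of "fst u" "snd v"] sympl_commute[of "snd u" "fst v"] by simp
  qed (simp_all add: sympl_simps fst_scaleC snd_scaleC algebra_simps diff_divide_distrib add_divide_distrib)
  have "form_n_minus (A \<times> B \<times> C) kashiwara_form = form_n_minus (B \<times> C \<times> A) p"
    using form_n_minus_iso[where p = p and q = kashiwara_form, OF S f_lin f_inj] key f_surj
    by simp
  also have "\<dots> = form_n_minus B ?q + form_n_minus (C \<times> A) ?h"
    by (rule form_n_minus_Times[OF fin2 finite_cdim_prod[OF fin2 fin2] q h]) (simp add: p_def)
  also have "form_n_minus (C \<times> A) ?h = cdim A"
    by (rule hyperbolic_n_minus[OF fin lag(1,3) disj])
  finally have "form_n_minus (A \<times> B \<times> C) kashiwara_form = form_n_minus B ?q + cdim A" .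
  moreover have "cdim (A \<inter> C) = 0" unfolding disj using cdim_eq_0[OF fin2] by blast
  ultimately show ?thesis using duistermaat_via_kashiwara[OF fin T lag] by simp
qed

section \<open>Monotone paths of Lagrangian planes\<close>

lemma mono_bounded_tendsto_at_left:
  fixes f :: "real \<Rightarrow> real"
  assumes "a < b" and mono: "\<And>s t. a < s \<Longrightarrow> s < t \<Longrightarrow> t < b \<Longrightarrow> f s \<le> f t"
    and bound: "\<And>s. a < s \<Longrightarrow> s < b \<Longrightarrow> f s \<le> C"
  shows "\<exists>l. (f \<longlongrightarrow> l) (at_left b) \<and> (\<forall>s. a < s \<and> s < b \<longrightarrow> f s \<le> l)"
proof -
  define l where "l = Sup (f ` {a<..<b})"
  have ne: "f ` {a<..<b} \<noteq> {}" using assms(1) by simp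
  have bdd: "bdd_above (f ` {a<..<b})" using bound by (intro bdd_aboveI[of _ C]) auto
  have le: "f s \<le> l" if "a < s" "s < b" for s
    unfolding l_def using that bdd by (intro cSup_upper) auto
  have "(f \<longlongrightarrow> l) (at_left b)"
  proof (rule order_tendstoI)
    fix c assume "c < l"
    then obtain s where s: "a < s" "s < b" "c < f s"
      unfolding l_def using less_cSup_iff[OF ne bdd] by auto
    have "c < f t" if "s < t" "t < b" for t
      using mono[OF s(1) that] s(3) by linarith
    then show "\<forall>\<^sub>F t in at_left b. c < f t"
      using s(2) by (auto simp: eventually_at_left_field)
  next
    fix c assume "l < c"
    then have "f t < c" if "a < t" "t < b" for t using le[OF that] by linarith
    then show "\<forall>\<^sub>F t in at_left b. f t < c"
      using assms(1) by (auto simp: eventually_at_left_field)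
  qed
  then show ?thesis using le by blast
qed

lemma hermitian_on_cong:
  assumes p: "hermitian_on V p" and eq: "\<And>u v. u \<in> V \<Longrightarrow> v \<in> V \<Longrightarrow> q u v = p u v"
  shows "hermitian_on V q"
  unfolding hermitian_on_def
proof (intro conjI ballI allI)
  show "q u v = cnj (q v u)" if "u \<in> V" "v \<in> V" for u v
    using that hermitian_onD(4)[OF p, of u v] eq[of u v] eq[of v u] by simp
qed (use p in \<open>simp_all add: eq hermitian_simps[OF p] csubspaceD[OF hermitian_onD(1)[OF p]]\<close>)

lemma csubspace_Int: "csubspace V \<Longrightarrow> csubspace W \<Longrightarrow> csubspace (V \<inter> W)"
  by (rule complex_vector.subspace_inter)

text \<open>The properties of the Cauchy data spaces that the index count needs, freed from the
  operator. \<open>mono\<close> concerns the components \<open>a\<close>, \<open>b\<close> of one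
  vector along \<open>F\<close> at two parameters and is the integrated positivity of the crossing
  form; \<open>start\<close> is what remains of the form property of the Friedrichs
  extension.\<close>

locale lagrangian_path =
  fixes M :: "real \<Rightarrow> ('k :: chilbert_space \<times> 'k) set" and F :: "('k \<times> 'k) set"
  assumes fin: "finite_cdim TYPE('k)"
    and F: "lagrangian F"
    and M: "\<And>s. s < 0 \<Longrightarrow> lagrangian (M s)"
    and disj: "\<And>s. s < 0 \<Longrightarrow> M s \<inter> F = {0}"
    and mono: "\<And>s t a b. s < t \<Longrightarrow> t < 0 \<Longrightarrow> a \<in> M s \<Longrightarrow> b \<in> M t \<Longrightarrow> b - a \<in> F \<Longrightarrow> a \<noteq> 0 \<Longrightarrow>
      0 < Re (sympl a b)"
    and cont: "\<And>s u. s < 0 \<Longrightarrow> ((\<lambda>t. proj_along F (M t) u) \<longlongrightarrow> proj_along F (M s) u) (at s)"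
    and start: "\<And>u. (\<And>s. s < 0 \<Longrightarrow> Re (sympl (proj_along F (M s) u) (proj_along (M s) F u)) \<le> 0) \<Longrightarrow> u \<in> F"
begin

lemmas fin2 = finite_cdim_prod[OF fin fin]

lemma trans: "s < 0 \<Longrightarrow> transversal (M s) F"
  by (rule transversal_lagrangian[OF fin M F disj])

lemma trans': "s < 0 \<Longrightarrow> transversal F (M s)"
  by (rule transversal_commute[OF trans])

definition m :: "real \<Rightarrow> 'k \<times> 'k \<Rightarrow> 'k \<times> 'k" where "m s u = proj_along F (M s) u"

definition fr :: "real \<Rightarrow> 'k \<times> 'k \<Rightarrow> 'k \<times> 'k" where "fr s u = proj_along (M s) F u"

definition q :: "real \<Rightarrow> 'k \<times> 'k \<Rightarrow> 'k \<times> 'k \<Rightarrow> complex" where "q s u v = sympl (m s u) (fr s v)"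

lemma m_mem: "s < 0 \<Longrightarrow> m s u \<in> M s"
  unfolding m_def by (rule proj_along(1)[OF trans])

lemma fr_mem: "s < 0 \<Longrightarrow> fr s u \<in> F"
  unfolding fr_def by (rule proj_along(1)[OF trans'])

lemma split: "s < 0 \<Longrightarrow> u = m s u + fr s u"
  unfolding m_def fr_def by (rule proj_along_split[OF trans])

lemma fr_eqI: "s < 0 \<Longrightarrow> a \<in> F \<Longrightarrow> u - a \<in> M s \<Longrightarrow> fr s u = a"
  unfolding fr_def by (rule proj_along_eqI[OF trans'])

lemma fr_F: "s < 0 \<Longrightarrow> u \<in> F \<Longrightarrow> fr s u = u"
  unfolding fr_def by (rule proj_along_id[OF trans'])

lemma fr_M: "s < 0 \<Longrightarrow> u \<in> M s \<Longrightarrow> fr s u = 0"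
  by (rule fr_eqI) (auto simp: csubspaceD(1)[OF lagrangianD(1)[OF F]])

lemma F_iso: "u \<in> F \<Longrightarrow> v \<in> F \<Longrightarrow> sympl u v = 0"
  by (rule lagrangianD(2)[OF F])

lemma M_iso: "s < 0 \<Longrightarrow> u \<in> M s \<Longrightarrow> v \<in> M s \<Longrightarrow> sympl u v = 0"
  by (rule lagrangianD(2)[OF M])

lemma sympl_m_F: "s < 0 \<Longrightarrow> v \<in> F \<Longrightarrow> sympl (m s u) v = sympl u v"
  using split[of s u] F_iso[OF fr_mem] sympl_simps(1)[of "m s u" "fr s u" v] by simp

lemma q_eq: "s < 0 \<Longrightarrow> q s u v = sympl (m s u) v"
  using split[of s v] M_iso[of s "m s u" "m s v"] m_mem
    sympl_simps(2)[of "m s u" "m s v" "fr s v"] by (simp add: q_def)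

lemma q_hermitian: "s < 0 \<Longrightarrow> lagrangian L \<Longrightarrow> hermitian_on L (q s)"
  unfolding q_def[abs_def] m_def fr_def by (intro split_form_hermitian trans M F)

lemma m_diff_mem:
  assumes "s < 0" "t < 0"
  shows "m t u - m s u \<in> F"
proof -
  have "m t u + fr t u = m s u + fr s u"
    using split[OF assms(1), of u] split[OF assms(2), of u] by simp
  then have "m t u - m s u = fr s u - fr t u" by (simp add: algebra_simps)
  then show ?thesis
    using csubspaceD(4)[OF lagrangianD(1)[OF F] fr_mem[OF assms(1)] fr_mem[OF assms(2)]] by simp
qed

text \<open>\<open>m t u - m s u\<close> lies in \<open>F\<close>, so only its pairing with
  \<open>m t u\<close> survives, and isotropy of \<open>M t\<close> leaves the quantity that
  \<open>mono\<close> makes positive.\<close>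

lemma q_diff:
  assumes "s < 0" "t < 0"
  shows "q t u u = q s u u - sympl (m s u) (m t u)"
proof -
  have "q t u u - q s u u = sympl (m t u - m s u) u"
    using assms by (simp add: q_eq sympl_simps)
  also have "\<dots> = sympl (m t u - m s u) (m t u + fr t u)"
    using split[OF assms(2), of u] by simp
  also have "\<dots> = sympl (m t u - m s u) (m t u)"
    using F_iso[OF m_diff_mem fr_mem, OF assms assms(2), of u u] by (simp add: sympl_simps)
  also have "\<dots> = - sympl (m s u) (m t u)"
    using M_iso[OF assms(2) m_mem m_mem, OF assms(2) assms(2), of u u] by (simp add: sympl_simps)
  finally show ?thesis by (simp add: algebra_simps)
qed

lemma q_strict:
  assumes "s < t" "t < 0" "u \<notin> F"
  shows "Re (q t u u) < Re (q s u u)"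
proof -
  have s: "s < 0" using assms by simp
  have "m s u \<noteq> 0" using split[OF s, of u] fr_mem[OF s, of u] assms(3) by auto
  then have "0 < Re (sympl (m s u) (m t u))"
    using mono[OF assms(1,2) m_mem[OF s] m_mem[OF assms(2)] m_diff_mem[OF s assms(2)]] by blast
  then show ?thesis using q_diff[OF s assms(2), of u] by simp
qed

lemma q_F_eq_0: "s < 0 \<Longrightarrow> u \<in> L \<Longrightarrow> v \<in> L \<Longrightarrow> v \<in> F \<Longrightarrow> lagrangian L \<Longrightarrow> q s u v = 0"
  using lagrangianD(2)[of L u v] sympl_m_F[of s v u] by (simp add: q_def fr_F)

text \<open>By contradiction and compactness: unit vectors with negative values at parameters
  tending to \<open>-\<infinity>\<close> accumulate at a vector whose value is nonpositive at every
  parameter, by monotonicity and continuity, so \<open>start\<close> puts it into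
  \<open>F\<close>.\<close>

lemma q_eventually_nonneg:
  assumes L: "lagrangian L"
  shows "\<exists>s<0. nonneg_on L (q s)"
proof (rule ccontr)
  assume neg: "\<not> ?thesis"
  note LD = csubspaceD[OF lagrangianD(1)[OF L]]
  \<comment> \<open>On \<open>L \<inter> F\<close> the form vanishes for all \<open>s\<close>, so a
    limit in \<open>F\<close> would be no contradiction by itself; the vectors are therefore taken
    orthogonal to \<open>L \<inter> F\<close>.\<close>
  define V' where "V' = {u \<in> L. \<forall>r\<in>L \<inter> F. cinner r u = 0}"
  have V': "csubspace V'" unfolding V'_def by (rule csubspaceI) (auto simp: cinner_simps LD)
  have R: "csubspace (L \<inter> F)"
    by (intro csubspace_Int lagrangianD(1) L F)
  have "\<exists>w\<in>V'. norm w = 1 \<and> Re (q s w w) < 0" if s: "s < 0" for s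
  proof -
    note qD = hermitian_onD(1-3,5-)[OF q_hermitian[OF s L]]
      and qsym = hermitian_onD(4)[OF q_hermitian[OF s L]]
    obtain u where u: "u \<in> L" "Re (q s u u) < 0" using neg s by (auto simp: not_le)
    obtain r where r: "r \<in> L \<inter> F" "\<forall>x\<in>L \<inter> F. cinner x (u - r) = 0"
      using orthogonal_projection_exists[OF fin2 R, of u] by blast
    define v where "v = u - r"
    have v: "v \<in> V'" "v \<in> L" using u(1) r LD(4)[of u r] by (auto simp: V'_def v_def)
    have "q s v r = 0" "q s r r = 0" using q_F_eq_0[OF s _ _ _ L] v(2) r(1) by auto
    moreover have "q s r v = 0" using qsym[of r v] calculation(1) v(2) r(1) by simp
    ultimately have "q s (v + r) (v + r) = q s v v"
      using v(2) r(1) by (simp add: qD LD)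
    then have qv: "Re (q s v v) < 0" using u(2) by (simp add: v_def)
    then have nz: "v \<noteq> 0" using qD(6)[OF LD(1)] by auto
    define w where "w = complex_of_real (1 / norm v) *\<^sub>C v"
    have "w \<in> V'" unfolding w_def by (rule csubspaceD(3)[OF V' v(1)])
    moreover have "norm w = 1" using nz by (simp add: w_def norm_scaleC norm_divide)
    moreover have "q s w w = complex_of_real ((1 / norm v)\<^sup>2) * q s v v"
      using v(2) unfolding w_def by (simp add: qD LD power2_eq_square)
    then have "Re (q s w w) = (1 / norm v)\<^sup>2 * Re (q s v v)" by simp
    then have "Re (q s w w) < 0" using qv nz by (simp add: mult_less_0_iff)
    ultimately show ?thesis by blast
  qed
  then have "\<forall>k. \<exists>w. w \<in> V' \<and> norm w = 1 \<and> Re (q (- real (Suc k)) w w) < 0"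
    by (metis neg_less_0_iff_less of_nat_0_less_iff zero_less_Suc)
  then obtain w where w: "\<And>k. w k \<in> V'" "\<And>k. norm (w k) = 1" "\<And>k. Re (q (- real (Suc k)) (w k) (w k)) < 0"
    by metis
  have "\<exists>y\<in>V'. \<exists>r. strict_mono r \<and> (w \<circ> r) \<longlonglongrightarrow> y"
    by (rule bounded_imp_convergent_subseq[where C = 1, OF fin2 V' w(1)]) (simp add: w(2))
  then obtain y r where y: "y \<in> V'" "strict_mono r" "(w \<circ> r) \<longlonglongrightarrow> y" by blast
  have "(\<lambda>k. norm ((w \<circ> r) k)) \<longlonglongrightarrow> norm y" by (rule tendsto_norm[OF y(3)])
  then have ny: "norm y = 1" using w(2) by (simp add: o_def LIMSEQ_const_iff)
  have "Re (q s y y) \<le> 0" if s: "s < 0" for s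
  proof -
    have "(\<lambda>k. q s ((w \<circ> r) k) ((w \<circ> r) k)) \<longlonglongrightarrow> q s y y"
      unfolding q_def m_def fr_def
      by (rule tendsto_sympl[OF clinear_tendsto[OF fin2 clinear_proj_along[OF trans[OF s]] y(3)]
          clinear_tendsto[OF fin2 clinear_proj_along[OF trans'[OF s]] y(3)]])
    then have lim: "(\<lambda>k. Re (q s ((w \<circ> r) k) ((w \<circ> r) k))) \<longlonglongrightarrow> Re (q s y y)"
      by (rule tendsto_Re)
    obtain k0 :: nat where k0: "- s < real k0" using reals_Archimedean2 by blast
    have "Re (q s ((w \<circ> r) k) ((w \<circ> r) k)) \<le> 0" if "k0 \<le> k" for k
    proof -
      \<comment> \<open>The subsequence index is at least \<open>k\<close>, so its parameter lies
        below the fixed \<open>s\<close> and monotonicity applies.\<close>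
      have "k \<le> r k" using y(2) by (rule seq_suble)
      then have lt: "- real (Suc (r k)) < s" using k0 that by linarith
      have inL: "w (r k) \<in> L" using w(1) by (auto simp: V'_def)
      have "Re (q s (w (r k)) (w (r k))) \<le> Re (q (- real (Suc (r k))) (w (r k)) (w (r k)))"
      proof (cases "w (r k) \<in> F")
        case True
        have n: "- real (Suc (r k)) < 0" by simp
        show ?thesis using q_F_eq_0[OF s inL inL True L] q_F_eq_0[OF n inL inL True L] by simp
      next
        case False
        then show ?thesis using q_strict[OF lt s] by (simp add: less_imp_le)
      qed
      then show ?thesis using w(3)[of "r k"] by simp
    qed
    then show ?thesis by (intro LIMSEQ_le_const2[OF lim]) blast
  qed
  then have "y \<in> F" using start unfolding q_def m_def fr_def by blast
  then have "cinner y y = 0" using y(1) by (auto simp: V'_def)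
  then show False using ny by simp
qed

lemma crossing_family:
  assumes L: "lagrangian L"
  shows "decreasing_forms L (L \<inter> F) (\<lambda>s. L \<inter> M s) q"
proof unfold_locales
  note LD = csubspaceD[OF lagrangianD(1)[OF L]]
  show "finite_cdim TYPE('k \<times> 'k)" by (rule fin2)
  show "csubspace (L \<inter> F)"
    by (intro csubspace_Int lagrangianD(1) L F)
  show "\<exists>s<0. nonneg_on L (q s)" by (rule q_eventually_nonneg[OF L])
  fix s :: real assume s: "s < 0"
  show "hermitian_on L (q s)" by (rule q_hermitian[OF s L])
  show "csubspace (L \<inter> M s)"
    by (intro csubspace_Int lagrangianD(1) L M s)
  show "L \<inter> M s \<inter> (L \<inter> F) \<subseteq> {0}" using disj[OF s] by blast
  show "q s u k = 0" if "k \<in> L \<inter> M s" for u k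
    using that by (simp add: q_def fr_M[OF s] sympl_simps)
  show "q s u r = 0" if "u \<in> L" "r \<in> L \<inter> F" for u r
    using that q_F_eq_0[OF s _ _ _ L] by blast
  show "\<exists>k\<in>L \<inter> M s. \<exists>r\<in>L \<inter> F. v = k + r" if v: "v \<in> L" "\<forall>u\<in>L. q s u v = 0" for v
  proof -
    \<comment> \<open>For \<open>v\<close> in the radical, the component in \<open>F\<close>
      annihilates \<open>L\<close> and hence lies in \<open>L\<close>; so does the remaining
      component.\<close>
    have "sympl (fr s v) u = 0" if "u \<in> L" for u
      using v(2) that sympl_m_F[OF s fr_mem[OF s], of u v] sympl_eq_0_commute[of "fr s v" u]
      by (simp add: q_def)
    then have frL: "fr s v \<in> L" by (rule lagrangianD(3)[OF L])
    have "m s v = v - fr s v" using split[OF s, of v] by (simp add: algebra_simps)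
    then have "m s v \<in> L" using LD(4)[OF v(1) frL] by simp
    then show ?thesis using frL m_mem[OF s] fr_mem[OF s] split[OF s, of v] by blast
  qed
  show "((\<lambda>t. q t u v) \<longlongrightarrow> q s u v) (at s)" for u v
  proof -
    have ev: "\<forall>\<^sub>F t in at s. t < 0"
      using order_tendstoD(2)[OF tendsto_ident_at s] .
    have "((\<lambda>t. sympl (m t u) v) \<longlongrightarrow> sympl (m s u) v) (at s)"
      unfolding m_def by (intro tendsto_sympl cont s tendsto_const)
    then have "((\<lambda>t. sympl (m t u) v) \<longlongrightarrow> q s u v) (at s)" using q_eq[OF s] by simp
    moreover have "\<forall>\<^sub>F t in at s. sympl (m t u) v = q t u v"
      using ev by eventually_elim (simp add: q_eq)
    ultimately show ?thesis by (rule Lim_transform_eventually)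
  qed
qed (auto intro: q_strict)

section \<open>The left limit of the path at 0\<close>

abbreviation M0 :: "('k \<times> 'k) set" where "M0 \<equiv> left_graph_limit M 0"

lemma M0_csubspace: "csubspace M0"
proof (rule csubspaceI)
  show "0 \<in> M0"
    unfolding left_graph_limit_def
    using csubspaceD(1)[OF lagrangianD(1)[OF M]] by (auto intro!: exI[of _ "\<lambda>_. 0"])
next
  fix x y assume "x \<in> M0" "y \<in> M0"
  then obtain v w where "\<forall>s<0. v s \<in> M s" "(v \<longlongrightarrow> x) (at_left 0)" "\<forall>s<0. w s \<in> M s" "(w \<longlongrightarrow> y) (at_left 0)"
    by (auto simp: left_graph_limit_def)
  then show "x + y \<in> M0"
    unfolding left_graph_limit_def
    using csubspaceD(2)[OF lagrangianD(1)[OF M]]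
    by (intro CollectI exI[of _ "\<lambda>s. v s + w s"]) (auto intro: tendsto_add)
next
  fix c x assume "x \<in> M0"
  then obtain v where "\<forall>s<0. v s \<in> M s" "(v \<longlongrightarrow> x) (at_left 0)"
    by (auto simp: left_graph_limit_def)
  then show "c *\<^sub>C x \<in> M0"
    unfolding left_graph_limit_def
    using csubspaceD(3)[OF lagrangianD(1)[OF M]]
    by (intro CollectI exI[of _ "\<lambda>s. c *\<^sub>C v s"]) (auto intro: tendsto_scaleC)
qed

lemma M0_iso:
  assumes "x \<in> M0" "y \<in> M0"
  shows "sympl x y = 0"
proof -
  obtain v w where vw: "\<forall>s<0. v s \<in> M s" "(v \<longlongrightarrow> x) (at_left 0)" "\<forall>s<0. w s \<in> M s" "(w \<longlongrightarrow> y) (at_left 0)"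
    using assms by (auto simp: left_graph_limit_def)
  have "\<forall>\<^sub>F s in at_left 0. sympl (v s) (w s) = 0"
    using vw(1,3) M_iso by (auto simp: eventually_at_filter)
  then have "((\<lambda>s. sympl (v s) (w s)) \<longlongrightarrow> 0) (at_left 0)"
    by (rule tendsto_eventually)
  then show ?thesis
    using tendsto_unique[OF trivial_limit_at_left_real tendsto_sympl[OF vw(2,4)]] by blast
qed

context
  fixes s0 :: real
  assumes s0: "s0 < 0"
begin

abbreviation N :: "('k \<times> 'k) set" where "N \<equiv> M s0"

text \<open>For a common nonzero vector, \<open>mono\<close> with \<open>a = b\<close> would make
  \<open>\<omega>(a, a)\<close> nonzero on an isotropic plane.\<close>

lemma transN:
  assumes "s0 < s" "s < 0"
  shows "transversal (M s) N"
proof (rule transversal_lagrangian[OF fin M[OF assms(2)] M[OF s0]])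
  have "a = 0" if a: "a \<in> M s" "a \<in> N" for a
  proof (rule ccontr)
    assume "a \<noteq> 0"
    then have "0 < Re (sympl a a)"
      using mono[OF assms a(2,1)] csubspaceD(1)[OF lagrangianD(1)[OF F]] by simp
    then show False using M_iso[OF s0 a(2) a(2)] by simp
  qed
  then show "M s \<inter> N = {0}" using csubspaceD(1)[OF lagrangianD(1)[OF M]] s0 assms by auto
qed

lemmas transFN = trans'[OF s0]

text \<open>The path in the chart given by \<open>N\<close>: a plane transversal to \<open>N\<close>
  is a graph over \<open>F\<close> modulo \<open>N\<close>, and the form
  \<open>sympl v (\<mu> s v)\<close> on \<open>F\<close> is its coordinate.\<close>

definition \<mu> :: "real \<Rightarrow> 'k \<times> 'k \<Rightarrow> 'k \<times> 'k" where "\<mu> s v = proj_along N (M s) v"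

lemma \<mu>: "s0 < s \<Longrightarrow> s < 0 \<Longrightarrow> \<mu> s v \<in> M s" "s0 < s \<Longrightarrow> s < 0 \<Longrightarrow> \<mu> s v - v \<in> N"
  unfolding \<mu>_def by (rule proj_along(1)[OF transN] proj_along_rev[OF transN]; assumption)+

lemma q_nonpos_N:
  assumes "s0 < s" "s < 0" "u \<in> N"
  shows "Re (q s u u) \<le> 0"
proof (cases "u \<in> F")
  case True
  then show ?thesis using q_F_eq_0[OF assms(2,3,3) True M[OF s0]] by simp
next
  case False
  then have "Re (q s u u) < Re (q s0 u u)" by (rule q_strict[OF assms(1,2)])
  then show ?thesis using fr_M[OF s0 assms(3)] by (simp add: q_def sympl_simps)
qed

lemma q_decreasing_N:
  assumes "s < t" "t < 0" "u \<in> N"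
  shows "Re (q t u u) \<le> Re (q s u u)"
proof (cases "u \<in> F")
  case True
  have "s < 0" using assms by simp
  then show ?thesis
    using q_F_eq_0[OF assms(2,3,3) True M[OF s0]] q_F_eq_0[OF _ assms(3,3) True M[OF s0]] by simp
qed (simp add: q_strict[OF assms(1,2)] less_imp_le)

text \<open>Thus \<open>\<mu> s v - v\<close> represents the functional \<open>- sympl x v\<close>
  for the form \<open>q s\<close>, which links the coordinate in the chart with the inverse of
  \<open>q s\<close>.\<close>

lemma q_\<mu>:
  assumes s: "s0 < s" "s < 0" and v: "v \<in> F"
  shows "q s x (\<mu> s v - v) = - sympl x v"
proof -
  have "fr s (\<mu> s v - v) = - v"
    using v \<mu>(1)[OF s] csubspaceD(5)[OF lagrangianD(1)[OF F]] by (intro fr_eqI[OF s(2)]) auto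
  then show ?thesis using sympl_m_F[OF s(2) v] by (simp add: q_def sympl_simps)
qed

text \<open>
  Monotonicity is inherited from \<open>q\<close> by Legendre duality, since the form \<open>sympl v (\<mu> s v)\<close> on \<open>F\<close>
  is the inverse of the form \<open>q s\<close> on \<open>N\<close>.
\<close>

lemma sympl_\<mu>_eq:
  assumes s: "s0 < s" "s < 0" and v: "v \<in> F"
  shows "Re (sympl v (\<mu> s v)) = Re (q s (\<mu> s v - v) (\<mu> s v - v))"
proof -
  have "Re (q s (\<mu> s v - v) (\<mu> s v - v)) = Re (sympl v (\<mu> s v - v))"
    using q_\<mu>[OF s v, of "\<mu> s v - v"] Re_sympl_commute[of "\<mu> s v - v" v] by simp
  then show ?thesis using F_iso[OF v v] by (simp add: sympl_simps)
qed

lemma sympl_\<mu>_mono: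
  assumes st: "s0 < s" "s < t" "t < 0" and v: "v \<in> F"
  shows "Re (sympl v (\<mu> s v)) \<le> Re (sympl v (\<mu> t v))"
proof -
  have s: "s < 0" and t: "s0 < t" using st by auto
  define a b where "a = \<mu> s v - v" and "b = \<mu> t v - v"
  have ab: "a \<in> N" "b \<in> N" unfolding a_def b_def using \<mu>(2) st s t by auto
  note qD = hermitian_onD(1-3,5-)[OF q_hermitian[OF s M[OF s0]]]
    and qsym = hermitian_onD(4)[OF q_hermitian[OF s M[OF s0]]]
  \<comment> \<open>Both sides equal \<open>- Re (sympl b v)\<close>, as \<open>a\<close> and
    \<open>b\<close> represent the same functional at \<open>s\<close> and at
    \<open>t\<close>.\<close>
  have "Re (q s b a) = Re (q t b b)"
    unfolding a_def b_def using q_\<mu>[OF st(1) s v] q_\<mu>[OF t st(3) v] by simp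
  moreover have "Re (q s a b) = Re (q s b a)" using qsym[OF ab] by simp
  \<comment> \<open>The completed square yields \<open>q s a a + q s b b \<le> 2 q t b b\<close> in
    real parts, and the decrease of \<open>q\<close> on \<open>N\<close> cancels one
    \<open>q t b b\<close>.\<close>
  moreover have "Re (q s (b - a) (b - a)) \<le> 0"
    using csubspaceD(4)[OF qD(1) ab(2,1)] q_nonpos_N[OF st(1) s] by blast
  then have "Re (q s b b) - Re (q s b a) - (Re (q s a b) - Re (q s a a)) \<le> 0"
    using ab csubspaceD(4)[OF qD(1)] by (simp add: qD)
  moreover have "Re (q t b b) \<le> Re (q s b b)" by (rule q_decreasing_N[OF st(2,3) ab(2)])
  ultimately have "Re (q s a a) \<le> Re (q t b b)" by linarith
  then show ?thesis
    unfolding sympl_\<mu>_eq[OF st(1) s v] sympl_\<mu>_eq[OF t st(3) v] a_def b_def .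
qed

lemma sympl_\<mu>_limit:
  assumes v: "v \<in> F"
  obtains l where "((\<lambda>s. Re (sympl v (\<mu> s v))) \<longlongrightarrow> l) (at_left 0)"
    "\<forall>s. s0 < s \<and> s < 0 \<longrightarrow> Re (sympl v (\<mu> s v)) \<le> l"
proof -
  have "\<exists>l. ((\<lambda>s. Re (sympl v (\<mu> s v))) \<longlongrightarrow> l) (at_left 0) \<and>
      (\<forall>s. s0 < s \<and> s < 0 \<longrightarrow> Re (sympl v (\<mu> s v)) \<le> l)"
  proof (rule mono_bounded_tendsto_at_left[OF s0, where C = 0])
    show "Re (sympl v (\<mu> s v)) \<le> 0" if "s0 < s" "s < 0" for s
      unfolding sympl_\<mu>_eq[OF that v] by (rule q_nonpos_N[OF that \<mu>(2)[OF that]])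
  qed (rule sympl_\<mu>_mono[OF _ _ _ v])
  then show thesis using that by blast
qed

lemma eventually_range: "\<forall>\<^sub>F s in at_left 0. s0 < s \<and> s < 0"
  using s0 by (auto simp: eventually_at_left_field)

text \<open>Monotonicity and the bound 0 give limits of the diagonal values; polarization and
  multiplication by \<open>\<i>\<close> give those of all pairings with \<open>F\<close>, and
  pairings with \<open>N\<close> do not depend on \<open>s\<close>.\<close>

lemma \<mu>_convergent:
  assumes v: "v \<in> F"
  shows "\<exists>y. ((\<lambda>s. \<mu> s v) \<longlongrightarrow> y) (at_left 0)"
proof (rule convergent_of_sympl_convergent[OF fin])
  note FD = csubspaceD[OF lagrangianD(1)[OF F]]
  have herm: "hermitian_on F (\<lambda>u w. sympl u (\<mu> s w))" if s: "s0 < s" "s < 0" for s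
  proof -
    have "hermitian_on F (pform N F (M s))"
      by (rule pform_hermitian[OF transFN transN[OF s] F M[OF s(2)] M[OF s0] lagrangianD(1)[OF F]])
    then show ?thesis
      by (rule hermitian_on_cong) (simp add: pform_def \<mu>_def proj_along_id[OF transFN])
  qed
  have Re_lim: "\<exists>l. ((\<lambda>s. Re (sympl u (\<mu> s w))) \<longlongrightarrow> l) (at_left 0)" if uw: "u \<in> F" "w \<in> F" for u w
  proof -
    obtain l1 where l1: "((\<lambda>s. Re (sympl (u + w) (\<mu> s (u + w)))) \<longlongrightarrow> l1) (at_left 0)"
      by (rule sympl_\<mu>_limit[OF FD(2)[OF uw]])
    obtain l2 where l2: "((\<lambda>s. Re (sympl u (\<mu> s u))) \<longlongrightarrow> l2) (at_left 0)"
      by (rule sympl_\<mu>_limit[OF uw(1)])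
    obtain l3 where l3: "((\<lambda>s. Re (sympl w (\<mu> s w))) \<longlongrightarrow> l3) (at_left 0)"
      by (rule sympl_\<mu>_limit[OF uw(2)])
    have ev: "\<forall>\<^sub>F s in at_left 0. (Re (sympl (u + w) (\<mu> s (u + w))) - Re (sympl u (\<mu> s u))
        - Re (sympl w (\<mu> s w))) / 2 = Re (sympl u (\<mu> s w))"
      using eventually_range
    proof eventually_elim
      case (elim s)
      have h: "hermitian_on F (\<lambda>u w. sympl u (\<mu> s w))" using herm elim by blast
      show ?case
        using hermitian_onD(2)[OF h, of u u w] hermitian_onD(2)[OF h, of w u w]
          hermitian_onD(4)[OF h, of u w] uw by (simp add: sympl_simps)
    qed
    show ?thesis
      by (rule exI, rule Lim_transform_eventually[OF _ ev],
        rule tendsto_divide[OF tendsto_diff[OF tendsto_diff[OF l1 l2] l3] tendsto_const]) simp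
  qed
  have cx_lim: "\<exists>l. ((\<lambda>s. sympl u (\<mu> s w)) \<longlongrightarrow> l) (at_left 0)" if uw: "u \<in> F" "w \<in> F" for u w
  proof -
    obtain l1 where l1: "((\<lambda>s. Re (sympl u (\<mu> s w))) \<longlongrightarrow> l1) (at_left 0)"
      using Re_lim[OF uw] by blast
    have "\<i> *\<^sub>C u \<in> F" using uw(1) by (rule FD(3))
    then obtain l2 where l2: "((\<lambda>s. Re (sympl (\<i> *\<^sub>C u) (\<mu> s w))) \<longlongrightarrow> l2) (at_left 0)"
      using Re_lim[OF _ uw(2)] by blast
    then have l2': "((\<lambda>s. Im (sympl u (\<mu> s w))) \<longlongrightarrow> l2) (at_left 0)"
      by (simp add: sympl_simps)
    show ?thesis using tendsto_Complex[OF l1 l2'] by (auto simp: complex_surj)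
  qed
  show "\<exists>l. ((\<lambda>s. sympl x (\<mu> s v)) \<longlongrightarrow> l) (at_left 0)" for x
  proof -
    define xf xn where "xf = proj_along N F x" and "xn = proj_along F N x"
    have x: "x = xf + xn" "xf \<in> F" "xn \<in> N"
      unfolding xf_def xn_def
      by (rule proj_along_split[OF transFN] proj_along(1)[OF transFN] proj_along(1)[OF trans[OF s0]])+
    obtain l where l: "((\<lambda>s. sympl xf (\<mu> s v)) \<longlongrightarrow> l) (at_left 0)"
      using cx_lim[OF x(2) v] by blast
    have ev: "\<forall>\<^sub>F s in at_left 0. sympl xf (\<mu> s v) + sympl xn v = sympl x (\<mu> s v)"
      using eventually_range
    proof eventually_elim
      case (elim s)
      have "sympl xn (\<mu> s v - v) = 0" using M_iso[OF s0 x(3) \<mu>(2)] elim by blast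
      then show ?case unfolding x(1) by (simp add: sympl_simps)
    qed
    show ?thesis
      by (rule exI, rule Lim_transform_eventually[OF tendsto_add[OF l tendsto_const] ev])
  qed
qed

lemma \<mu>_limit:
  assumes v: "v \<in> F" and y: "((\<lambda>s. \<mu> s v) \<longlongrightarrow> y) (at_left 0)"
  shows "y \<in> M0" "v - y \<in> N"
proof -
  \<comment> \<open>\<open>left_graph_limit\<close> asks for a member of \<open>M s\<close> at every
    negative \<open>s\<close>, so the curve is continued by 0 up to \<open>s0\<close>.\<close>
  define w where "w s = (if s0 < s then \<mu> s v else 0)" for s
  have "\<forall>\<^sub>F s in at_left 0. \<mu> s v = w s"
    using eventually_range by eventually_elim (simp add: w_def)
  then have "(w \<longlongrightarrow> y) (at_left 0)" by (rule Lim_transform_eventually[OF y])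
  moreover have "\<forall>s<0. w s \<in> M s"
    using \<mu>(1) csubspaceD(1)[OF lagrangianD(1)[OF M]] by (simp add: w_def)
  ultimately show "y \<in> M0" by (auto simp: left_graph_limit_def)
  have "sympl (v - y) n = 0" if n: "n \<in> N" for n
  proof -
    have "\<forall>\<^sub>F s in at_left 0. sympl (v - \<mu> s v) n = 0"
      using eventually_range
    proof eventually_elim
      case (elim s)
      have "sympl (\<mu> s v - v) n = 0" using M_iso[OF s0 \<mu>(2) n] elim by blast
      then show ?case by (simp add: sympl_simps)
    qed
    then have "((\<lambda>s. sympl (v - \<mu> s v) n) \<longlongrightarrow> 0) (at_left 0)" by (rule tendsto_eventually)
    moreover have "((\<lambda>s. sympl (v - \<mu> s v) n) \<longlongrightarrow> sympl (v - y) n) (at_left 0)"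
      by (intro tendsto_sympl tendsto_diff tendsto_const y)
    ultimately show ?thesis using tendsto_unique[OF trivial_limit_at_left_real] by blast
  qed
  then show "v - y \<in> N" by (rule lagrangianD(3)[OF M[OF s0]])
qed

lemma M0_sum: "\<exists>a\<in>M0. x - a \<in> N"
proof -
  define xf where "xf = proj_along N F x"
  have x: "xf \<in> F" "x - xf \<in> N" unfolding xf_def by (rule proj_along[OF transFN])+
  obtain y where y: "((\<lambda>s. \<mu> s xf) \<longlongrightarrow> y) (at_left 0)" using \<mu>_convergent[OF x(1)] by blast
  have "(x - xf) + (xf - y) \<in> N"
    by (intro csubspaceD(2)[OF lagrangianD(1)[OF M[OF s0]]] x(2) \<mu>_limit(2)[OF x(1) y])
  then show ?thesis using \<mu>_limit(1)[OF x(1) y] by (intro bexI[of _ y]) simp_all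
qed

lemma M0_lagrangian': "lagrangian M0"
  by (rule lagrangianI_isotropic_sum[OF M0_csubspace M0_iso lagrangianD(1)[OF M[OF s0]] M_iso[OF s0] M0_sum])

lemma transM0N: "transversal M0 N"
proof -
  have "u = 0" if u: "u \<in> M0" "u \<in> N" for u
  proof (rule sympl_nondegenerate)
    fix x
    obtain a where a: "a \<in> M0" "x - a \<in> N" using M0_sum by blast
    have "sympl a u = 0" "sympl (x - a) u = 0" using M0_iso[OF a(1) u(1)] M_iso[OF s0 a(2) u(2)] .
    then show "sympl x u = 0" by (simp add: sympl_simps)
  qed
  then have "M0 \<inter> N = {0}"
    using csubspaceD(1)[OF M0_csubspace] csubspaceD(1)[OF lagrangianD(1)[OF M[OF s0]]] by auto
  then show ?thesis by (rule transversal_lagrangian[OF fin M0_lagrangian' M[OF s0]])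
qed

lemma \<mu>_tendsto:
  assumes v: "v \<in> F"
  shows "((\<lambda>s. \<mu> s v) \<longlongrightarrow> proj_along N M0 v) (at_left 0)"
proof -
  obtain y where y: "((\<lambda>s. \<mu> s v) \<longlongrightarrow> y) (at_left 0)" using \<mu>_convergent[OF v] by blast
  have "proj_along N M0 v = y" by (rule proj_along_eqI[OF transM0N \<mu>_limit[OF v y]])
  then show ?thesis using y by simp
qed

text \<open>By the cocycle identity the form from \<open>F\<close> to \<open>B\<close> is the form
  from \<open>F\<close> to \<open>M s\<close> plus that from \<open>M s\<close> to \<open>B\<close>.
  The first stays below its limit on the diagonal, so the second stays above its own, as the
  semicontinuity criterion requires.\<close>

lemma pform_limit:
  assumes TB: "transversal B N" and B: "lagrangian B"
  shows "\<forall>\<^sub>F s in at_left 0. form_n_minus F (pform N (M s) B) = form_n_minus F (pform N M0 B)"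
proof (rule eventually_form_n_minus_eq[OF fin2])
  note Fs = lagrangianD(1)[OF F]
  show "hermitian_on F (pform N M0 B)"
    by (rule pform_hermitian[OF transM0N TB M0_lagrangian' B M[OF s0] Fs])
  show "\<forall>\<^sub>F s in at_left 0. hermitian_on F (pform N (M s) B)"
    using eventually_range
    by eventually_elim (rule pform_hermitian[OF transN TB M B M[OF s0] Fs]; simp)
  show "((\<lambda>s. pform N (M s) B u v) \<longlongrightarrow> pform N M0 B u v) (at_left 0)" if "u \<in> F" for u v
    unfolding pform_def using \<mu>_tendsto[OF that] by (intro tendsto_sympl tendsto_const) (simp add: \<mu>_def)
  show "\<forall>\<^sub>F s in at_left 0. \<forall>u\<in>F. Re (pform N M0 B u u) \<le> Re (pform N (M s) B u u)"
    using eventually_range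
  proof eventually_elim
    case (elim s)
    show ?case
    proof
      fix u assume u: "u \<in> F"
      have s: "s0 < s" "s < 0" using elim by auto
      have "Re (pform N F B u u) = Re (pform N F (M s) u u) + Re (pform N (M s) B u u)"
        unfolding plus_complex.sel(1)[symmetric]
        by (rule arg_cong[OF pform_add, OF transFN transN[OF s] TB M[OF s(2)] M[OF s0]])
      moreover have "Re (pform N F B u u) = Re (pform N F M0 u u) + Re (pform N M0 B u u)"
        unfolding plus_complex.sel(1)[symmetric]
        by (rule arg_cong[OF pform_add, OF transFN transM0N TB M0_lagrangian' M[OF s0]])
      moreover have "Re (pform N F (M s) u u) \<le> Re (pform N F M0 u u)"
      proof -
        obtain l where l: "((\<lambda>s. Re (sympl u (\<mu> s u))) \<longlongrightarrow> l) (at_left 0)"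
          "\<forall>s. s0 < s \<and> s < 0 \<longrightarrow> Re (sympl u (\<mu> s u)) \<le> l"
          by (rule sympl_\<mu>_limit[OF u])
        have "((\<lambda>s. Re (sympl u (\<mu> s u))) \<longlongrightarrow> Re (sympl u (proj_along N M0 u))) (at_left 0)"
          by (intro tendsto_Re tendsto_sympl tendsto_const \<mu>_tendsto[OF u])
        then have "l = Re (sympl u (proj_along N M0 u))"
          using tendsto_unique[OF trivial_limit_at_left_real l(1)] by blast
        then show ?thesis
          using l(2) s by (simp add: pform_def proj_along_id[OF transFN u] \<mu>_def)
      qed
      ultimately show "Re (pform N M0 B u u) \<le> Re (pform N (M s) B u u)"
        by linarith
    qed
  qed
qed

end

section \<open>Crossings and the index of the limit triple\<close>

lemma M0_lagrangian: "lagrangian M0"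
  by (rule M0_lagrangian'[of "-1"]) simp

text \<open>A vector of \<open>M s0\<close> has the value 0 under \<open>q s0\<close>. If nonzero it
  lies off \<open>F\<close>, so on \<open>L\<close> its value would be negative at
  \<open>s1\<close>, against the choice of \<open>s1\<close>; any \<open>s0 < s1\<close> would
  do.\<close>

lemma auxiliary_plane:
  assumes L: "lagrangian L"
  obtains s0 where "s0 < 0" "M s0 \<inter> L = {0}"
proof -
  obtain s1 where s1: "s1 < 0" "nonneg_on L (q s1)" using q_eventually_nonneg[OF L] by blast
  define s0 where "s0 = s1 - 1"
  have s0: "s0 < 0" "s0 < s1" using s1(1) by (simp_all add: s0_def)
  have "u = 0" if u: "u \<in> M s0" "u \<in> L" for u
  proof (rule ccontr)
    assume "u \<noteq> 0"
    then have "u \<notin> F" using disj[OF s0(1)] u(1) by blast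
    then have "Re (q s1 u u) < Re (q s0 u u)" by (rule q_strict[OF s0(2) s1(1)])
    also have "q s0 u u = 0" using fr_M[OF s0(1) u(1)] by (simp add: q_def sympl_simps)
    finally show False using s1(2) u(2) by force
  qed
  then have "M s0 \<inter> L = {0}"
    using csubspaceD(1)[OF lagrangianD(1)[OF M[OF s0(1)]]] csubspaceD(1)[OF lagrangianD(1)[OF L]] by auto
  then show thesis using that s0(1) by blast
qed

text \<open>With auxiliary plane \<open>M s0\<close>, the index of the triple at \<open>s\<close>
  near 0 is on the one hand \<open>form_n_minus L (q s)\<close>, the number of crossings, and on the
  other hand already equal to its value at the limit plane.\<close>

theorem crossings_eq_duistermaat_index:
  assumes L: "lagrangian L"
  shows "finite {s. s < 0 \<and> L \<inter> M s \<noteq> {0}}"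
    and "int (\<Sum>s | s < 0 \<and> L \<inter> M s \<noteq> {0}. cdim (L \<inter> M s)) = duistermaat_index M0 L F"
proof -
  interpret dec: decreasing_forms L "L \<inter> F" "\<lambda>s. L \<inter> M s" q by (rule crossing_family[OF L])
  show "finite {s. s < 0 \<and> L \<inter> M s \<noteq> {0}}" by (rule dec.crossings_finite)
  obtain s0 where s0: "s0 < 0" "M s0 \<inter> L = {0}" by (rule auxiliary_plane[OF L])
  have TL: "transversal L (M s0)"
    using transversal_lagrangian[OF fin L M[OF s0(1)]] s0(2) by (simp add: Int_commute)
  note TF = trans'[OF s0(1)]
  have "\<forall>\<^sub>F s in at_left 0. duistermaat_via (M s0) (M s) L F = duistermaat_via (M s0) M0 L F"
    using eventually_range[OF s0(1)] pform_limit[OF s0(1) TL L] pform_limit[OF s0(1) TF F]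
  proof eventually_elim
    case (elim s)
    have s: "s0 < s" "s < 0" using elim(1) by auto
    show ?case
      using duistermaat_via_pform[OF transN[OF s0(1) s] TL TF TF M[OF s(2)] L]
        duistermaat_via_pform[OF transM0N[OF s0(1)] TL TF TF M0_lagrangian L] elim(2,3)
      by simp
  qed
  moreover have "\<forall>\<^sub>F s in at_left 0. duistermaat_via (M s0) (M s) L F = int (form_n_minus L (q s))"
    using eventually_range[OF s0(1)]
  proof eventually_elim
    case (elim s)
    have s: "s0 < s" "s < 0" using elim by auto
    show ?case
      using duistermaat_via_transversal[OF fin transN[OF s0(1) s] TL TF M[OF s(2)] L F M[OF s0(1)] disj[OF s(2)]]
      by (simp add: q_def[abs_def] m_def fr_def)
  qed
  ultimately have "\<forall>\<^sub>F s in at_left (0::real). int (\<Sum>s | s < 0 \<and> L \<inter> M s \<noteq> {0}. cdim (L \<inter> M s))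
      = duistermaat_via (M s0) M0 L F"
    using dec.eventually_N_eq_sum by eventually_elim simp
  then have "int (\<Sum>s | s < 0 \<and> L \<inter> M s \<noteq> {0}. cdim (L \<inter> M s)) = duistermaat_via (M s0) M0 L F"
    by simp
  also have "\<dots> = duistermaat_index M0 L F"
    by (rule duistermaat_index_eq_via[symmetric, OF fin M0_lagrangian L F M[OF s0(1)] _ s0(2) disj[OF s0(1)]])
      (use transM0N[OF s0(1)] in \<open>simp add: transversal_def Int_commute\<close>)
  finally show "int (\<Sum>s | s < 0 \<and> L \<inter> M s \<noteq> {0}. cdim (L \<inter> M s)) = duistermaat_index M0 L F" .
qed

lemma duistermaat_index_transversal:
  assumes L: "lagrangian L" and M0F: "M0 \<inter> F = {0}"
  shows "duistermaat_index M0 L F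
    = int (form_n_minus L (\<lambda>u v. sympl (proj_along F M0 u) (proj_along M0 F v)))"
proof -
  obtain s0 where s0: "s0 < 0" "M s0 \<inter> L = {0}" by (rule auxiliary_plane[OF L])
  have TL: "transversal L (M s0)"
    using transversal_lagrangian[OF fin L M[OF s0(1)]] s0(2) by (simp add: Int_commute)
  have "duistermaat_index M0 L F = duistermaat_via (M s0) M0 L F"
    by (rule duistermaat_index_eq_via[OF fin M0_lagrangian L F M[OF s0(1)] _ s0(2) disj[OF s0(1)]])
      (use transM0N[OF s0(1)] in \<open>simp add: transversal_def Int_commute\<close>)
  then show ?thesis
    using duistermaat_via_transversal[OF fin transM0N[OF s0(1)] TL trans'[OF s0(1)] M0_lagrangian L F M[OF s0(1)] M0F]
    by simp
qed

end

section \<open>The Friedrichs extension\<close>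

locale nonnegative_symmetric =
  fixes S :: "('h :: chilbert_space \<times> 'h) set"
  assumes lin: "linear_operator S"
    and sym: "symmetric_op S" and nonneg: "nonnegative_op S"
begin

abbreviation T :: "('h \<times> 'h) set" where "T \<equiv> adj S"

lemma S_csubspace: "csubspace S" and S_single: "single_valued S"
  using lin by (auto simp: linear_operator_def)

lemma T_iff: "(g, h) \<in> T \<longleftrightarrow> (\<forall>f f'. (f, f') \<in> S \<longrightarrow> cinner f' g = cinner f h)"
  by (auto simp: adj_def)

lemma T_csubspace: "csubspace T"
proof (rule csubspaceI)
  show "0 \<in> T" by (simp add: zero_prod_def T_iff)
  show "x + y \<in> T" if "x \<in> T" "y \<in> T" for x y
    using that by (cases x; cases y) (simp add: T_iff cinner_simps)
  show "c *\<^sub>C x \<in> T" if "x \<in> T" for c x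
    using that by (cases x) (simp add: T_iff cinner_simps scaleC_Pair)
qed

lemma T_add: "(f, f') \<in> T \<Longrightarrow> (g, g') \<in> T \<Longrightarrow> (f + g, f' + g') \<in> T"
  using csubspaceD(2)[OF T_csubspace, of "(f, f')" "(g, g')"] by simp

lemma T_diff: "(f, f') \<in> T \<Longrightarrow> (g, g') \<in> T \<Longrightarrow> (f - g, f' - g') \<in> T"
  using csubspaceD(4)[OF T_csubspace, of "(f, f')" "(g, g')"] by simp

lemma T_scaleC: "(f, f') \<in> T \<Longrightarrow> (c *\<^sub>C f, c *\<^sub>C f') \<in> T"
  using csubspaceD(3)[OF T_csubspace, of "(f, f')" c] by (simp add: scaleC_Pair)

lemma S_T: "(f, f') \<in> S \<Longrightarrow> (f, f') \<in> T"
  using sym by (fastforce simp: T_iff symmetric_op_def)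

abbreviation D :: "'h set" where "D \<equiv> Domain S"

abbreviation Sv :: "'h \<Rightarrow> 'h" where "Sv \<equiv> op_val S"

lemma Sv_eq: "(f, f') \<in> S \<Longrightarrow> Sv f = f'"
  unfolding op_val_def using S_single by (auto simp: single_valued_def)

lemma Sv: "f \<in> D \<Longrightarrow> (f, Sv f) \<in> S"
  using Sv_eq by auto

lemma D_csubspace: "csubspace D"
proof (rule csubspaceI)
  show "0 \<in> D" using csubspaceD(1)[OF S_csubspace] by (force simp: zero_prod_def)
  show "x + y \<in> D" if "x \<in> D" "y \<in> D" for x y
    using csubspaceD(2)[OF S_csubspace Sv[OF that(1)] Sv[OF that(2)]] by auto
  show "c *\<^sub>C x \<in> D" if "x \<in> D" for c x
    using csubspaceD(3)[OF S_csubspace Sv[OF that], of c] by (auto simp: scaleC_Pair)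
qed

lemma Sv_add: "f \<in> D \<Longrightarrow> g \<in> D \<Longrightarrow> Sv (f + g) = Sv f + Sv g"
  using csubspaceD(2)[OF S_csubspace Sv Sv, of f g] by (simp add: Sv_eq)

lemma Sv_diff: "f \<in> D \<Longrightarrow> g \<in> D \<Longrightarrow> Sv (f - g) = Sv f - Sv g"
  using csubspaceD(4)[OF S_csubspace Sv Sv, of f g] by (simp add: Sv_eq)

lemma Sv_scaleC: "f \<in> D \<Longrightarrow> Sv (c *\<^sub>C f) = c *\<^sub>C Sv f"
  using csubspaceD(3)[OF S_csubspace Sv, of f c] by (simp add: Sv_eq scaleC_Pair)

lemma Sv_scaleR: "f \<in> D \<Longrightarrow> Sv (r *\<^sub>R f) = r *\<^sub>R Sv f"
  using Sv_scaleC[of f "complex_of_real r"] by (simp add: scaleC_of_real)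

lemma Sv_T: "f \<in> D \<Longrightarrow> (f, Sv f) \<in> T"
  by (rule S_T[OF Sv])

lemma Sv_adj: "f \<in> D \<Longrightarrow> (g, g') \<in> T \<Longrightarrow> cinner (Sv f) g = cinner f g'"
  using Sv[of f] T_iff by blast

lemma Sv_sym: "f \<in> D \<Longrightarrow> g \<in> D \<Longrightarrow> cinner f (Sv g) = cinner (Sv f) g"
  using Sv_adj[OF _ Sv_T] by simp

section \<open>The form of the symmetric operator and its closure\<close>

abbreviation a :: "'h \<Rightarrow> 'h \<Rightarrow> complex" where "a f g \<equiv> cinner f (Sv g)"

lemma a_hermitian: "hermitian_on D a"
  unfolding hermitian_on_def
proof (intro conjI ballI allI)
  show "a u v = cnj (a v u)" if "u \<in> D" "v \<in> D" for u v
    using Sv_sym[OF that] cinner_commute[of "Sv u" v] by simp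
qed (simp_all add: D_csubspace Sv_add Sv_scaleC cinner_simps)

lemma a_nonneg: "nonneg_on D a"
  using nonneg Sv by (fastforce simp: nonnegative_op_def)

lemmas DD = csubspaceD[OF D_csubspace]

lemma a_sum_le:
  assumes "f \<in> D" "g \<in> D"
  shows "Re (a (f + g) (f + g)) \<le> 2 * Re (a f f) + 2 * Re (a g g)"
proof -
  have "0 \<le> Re (a (f - g) (f - g))" using a_nonneg DD(4)[OF assms] by blast
  then show ?thesis using assms by (simp add: Sv_diff Sv_add cinner_simps)
qed

lemma form_approxD:
  assumes "form_approx S \<phi> f"
  shows "\<phi> k \<in> D" "\<phi> \<longlonglongrightarrow> f"
    "e > 0 \<Longrightarrow> \<exists>N. \<forall>j\<ge>N. \<forall>k\<ge>N. Re (a (\<phi> j - \<phi> k) (\<phi> j - \<phi> k)) < e"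
  using assms by (auto simp: form_approx_def)

lemma form_approx_bounded:
  assumes \<phi>: "form_approx S \<phi> f"
  obtains C N where "C > 0" "\<forall>k\<ge>N. Re (a (\<phi> k) (\<phi> k)) \<le> C"
proof -
  obtain N where N: "\<forall>j\<ge>N. \<forall>k\<ge>N. Re (a (\<phi> j - \<phi> k) (\<phi> j - \<phi> k)) < 1"
    using form_approxD(3)[OF \<phi>, of 1] by auto
  have "Re (a (\<phi> k) (\<phi> k)) \<le> 2 * Re (a (\<phi> N) (\<phi> N)) + 2" if "k \<ge> N" for k
    using a_sum_le[of "\<phi> N" "\<phi> k - \<phi> N"] form_approxD(1)[OF \<phi>] DD(4) N that
    by (force intro: order_trans)
  moreover have "0 \<le> Re (a (\<phi> N) (\<phi> N))" using a_nonneg form_approxD(1)[OF \<phi>] by blast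
  ultimately show thesis by (intro that[of "2 * Re (a (\<phi> N) (\<phi> N)) + 2" N]) auto
qed

text \<open>For fixed \<open>k\<close>, the values \<open>a (\<psi> k) (\<phi> j)\<close> tend to
  \<open>\<langle>\<psi> k, g\<rangle>\<close> as \<open>j\<close> grows, by the definition of the
  adjoint. Cauchy-Schwarz makes the error uniform in \<open>k\<close>, because \<open>\<psi>\<close>
  is bounded and \<open>\<phi>\<close> is Cauchy for the form. As the limit does not depend on the
  sequences, the closed form is well defined at such \<open>f\<close>.\<close>

lemma form_limit:
  assumes \<psi>: "form_approx S \<psi> h" and \<phi>: "form_approx S \<phi> f" and fg: "(f, g) \<in> T"
  shows "(\<lambda>k. a (\<psi> k) (\<phi> k)) \<longlonglongrightarrow> cinner h g"
proof -
  note \<psi>D = form_approxD(1)[OF \<psi>] and \<phi>D = form_approxD(1)[OF \<phi>]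
  obtain C N where C: "C > 0" "\<forall>k\<ge>N. Re (a (\<psi> k) (\<psi> k)) \<le> C" by (rule form_approx_bounded[OF \<psi>])
  have "(\<lambda>k. a (\<psi> k) (\<phi> k) - cinner (\<psi> k) g) \<longlonglongrightarrow> 0"
  proof (rule LIMSEQ_I)
    fix e :: real assume e: "e > 0"
    \<comment> \<open>Chosen so that \<open>C * d\<close> is the square of \<open>e / 2\<close> in
      the Cauchy-Schwarz bound.\<close>
    define d where "d = (e / 2)\<^sup>2 / C"
    have d: "d > 0" using e C(1) by (simp add: d_def)
    obtain N' where N': "\<forall>j\<ge>N'. \<forall>k\<ge>N'. Re (a (\<phi> j - \<phi> k) (\<phi> j - \<phi> k)) < d"
      using form_approxD(3)[OF \<phi> d] by blast
    have "cmod (a (\<psi> k) (\<phi> k) - cinner (\<psi> k) g) \<le> e / 2" if k: "k \<ge> max N N'" for k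
    proof -
      have le: "cmod (a (\<psi> k) (\<phi> k) - a (\<psi> k) (\<phi> j)) \<le> e / 2" if j: "j \<ge> N'" for j
      proof -
        have mem: "\<phi> k - \<phi> j \<in> D" using DD(4)[OF \<phi>D \<phi>D] .
        have "(cmod (a (\<psi> k) (\<phi> k - \<phi> j)))\<^sup>2
            \<le> Re (a (\<psi> k) (\<psi> k)) * Re (a (\<phi> k - \<phi> j) (\<phi> k - \<phi> j))"
          by (rule nonneg_Cauchy_Schwarz[OF a_hermitian a_nonneg \<psi>D mem])
        also have "\<dots> \<le> C * d"
          using C N' k j a_nonneg \<psi>D mem by (intro mult_mono) (auto simp: less_imp_le)
        also have "\<dots> = (e / 2)\<^sup>2" using C(1) by (simp add: d_def)
        finally have "cmod (a (\<psi> k) (\<phi> k - \<phi> j)) \<le> e / 2"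
          by (rule power2_le_imp_le) (use e in simp)
        then show ?thesis using \<phi>D by (simp add: Sv_diff cinner_simps)
      qed
      have "(\<lambda>j. a (\<psi> k) (\<phi> j)) \<longlonglongrightarrow> cinner (\<psi> k) g"
        unfolding Sv_sym[OF \<psi>D \<phi>D] Sv_adj[OF \<psi>D fg, symmetric]
        by (intro tendsto_cinner tendsto_const form_approxD(2)[OF \<phi>])
      then have "(\<lambda>j. cmod (a (\<psi> k) (\<phi> k) - a (\<psi> k) (\<phi> j))) \<longlonglongrightarrow> cmod (a (\<psi> k) (\<phi> k) - cinner (\<psi> k) g)"
        by (intro tendsto_norm tendsto_diff tendsto_const)
      then show ?thesis by (rule LIMSEQ_le_const2) (use le in blast)
    qed
    then show "\<exists>no. \<forall>k\<ge>no. norm (a (\<psi> k) (\<phi> k) - cinner (\<psi> k) g - 0) < e"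
      using e by (intro exI[of _ "max N N'"]) fastforce
  qed
  from tendsto_add[OF this tendsto_cinner[OF form_approxD(2)[OF \<psi>] tendsto_const[of g]]]
  show ?thesis by simp
qed

lemma form_approx_const: "f \<in> D \<Longrightarrow> form_approx S (\<lambda>_. f) f"
  using Sv_eq[of 0 0] csubspaceD(1)[OF S_csubspace]
  by (auto simp: form_approx_def zero_prod_def)

lemma D_form_domain: "f \<in> D \<Longrightarrow> f \<in> form_domain S"
  unfolding form_domain_def using form_approx_const by blast

lemma form_domain_csubspace: "csubspace (form_domain S)"
proof (rule csubspaceI)
  show "0 \<in> form_domain S" by (rule D_form_domain[OF DD(1)])
next
  fix x y assume "x \<in> form_domain S" "y \<in> form_domain S"
  then obtain \<phi> \<psi> where \<phi>: "form_approx S \<phi> x" and \<psi>: "form_approx S \<psi> y"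
    by (auto simp: form_domain_def)
  note mem = form_approxD(1)[OF \<phi>] form_approxD(1)[OF \<psi>]
  have "form_approx S (\<lambda>k. \<phi> k + \<psi> k) (x + y)"
    unfolding form_approx_def
  proof (intro conjI allI impI)
    show "range (\<lambda>k. \<phi> k + \<psi> k) \<subseteq> D" using mem DD(2) by blast
    show "(\<lambda>k. \<phi> k + \<psi> k) \<longlonglongrightarrow> x + y"
      by (intro tendsto_add form_approxD(2)[OF \<phi>] form_approxD(2)[OF \<psi>])
    fix e :: real assume "e > 0"
    then have "e / 4 > 0" by simp
    obtain N where N: "\<forall>j\<ge>N. \<forall>k\<ge>N. Re (a (\<phi> j - \<phi> k) (\<phi> j - \<phi> k)) < e / 4"
      using form_approxD(3)[OF \<phi> \<open>e / 4 > 0\<close>] by blast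
    obtain N' where N': "\<forall>j\<ge>N'. \<forall>k\<ge>N'. Re (a (\<psi> j - \<psi> k) (\<psi> j - \<psi> k)) < e / 4"
      using form_approxD(3)[OF \<psi> \<open>e / 4 > 0\<close>] by blast
    have "Re (a (\<phi> j + \<psi> j - (\<phi> k + \<psi> k)) (\<phi> j + \<psi> j - (\<phi> k + \<psi> k))) < e"
      if "j \<ge> max N N'" "k \<ge> max N N'" for j k
    proof -
      have "\<phi> j + \<psi> j - (\<phi> k + \<psi> k) = (\<phi> j - \<phi> k) + (\<psi> j - \<psi> k)" by simp
      then have "Re (a (\<phi> j + \<psi> j - (\<phi> k + \<psi> k)) (\<phi> j + \<psi> j - (\<phi> k + \<psi> k)))
          \<le> 2 * Re (a (\<phi> j - \<phi> k) (\<phi> j - \<phi> k)) + 2 * Re (a (\<psi> j - \<psi> k) (\<psi> j - \<psi> k))"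
        using a_sum_le[OF DD(4)[OF mem(1) mem(1)] DD(4)[OF mem(2) mem(2)]] by metis
      moreover have "Re (a (\<phi> j - \<phi> k) (\<phi> j - \<phi> k)) < e / 4" "Re (a (\<psi> j - \<psi> k) (\<psi> j - \<psi> k)) < e / 4"
        using N N' that by auto
      ultimately show ?thesis by linarith
    qed
    then show "\<exists>N. \<forall>j\<ge>N. \<forall>k\<ge>N. Re (a (\<phi> j + \<psi> j - (\<phi> k + \<psi> k)) (\<phi> j + \<psi> j - (\<phi> k + \<psi> k))) < e"
      by blast
  qed
  then show "x + y \<in> form_domain S" by (auto simp: form_domain_def)
next
  fix c x assume "x \<in> form_domain S"
  then obtain \<phi> where \<phi>: "form_approx S \<phi> x" by (auto simp: form_domain_def)
  note mem = form_approxD(1)[OF \<phi>]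
  have "form_approx S (\<lambda>k. c *\<^sub>C \<phi> k) (c *\<^sub>C x)"
    unfolding form_approx_def
  proof (intro conjI allI impI)
    show "range (\<lambda>k. c *\<^sub>C \<phi> k) \<subseteq> D" using mem DD(3) by blast
    show "(\<lambda>k. c *\<^sub>C \<phi> k) \<longlonglongrightarrow> c *\<^sub>C x"
      by (intro tendsto_scaleC tendsto_const form_approxD(2)[OF \<phi>])
    fix e :: real assume e: "e > 0"
    \<comment> \<open>The summand 1 covers \<open>c = 0\<close>.\<close>
    define d where "d = e / ((cmod c)\<^sup>2 + 1)"
    have pos: "(cmod c)\<^sup>2 + 1 > 0" by (simp add: add_nonneg_pos)
    then have d: "d > 0" "(cmod c)\<^sup>2 * d < e"
      using e by (simp_all add: d_def field_simps)
    obtain N where N: "\<forall>j\<ge>N. \<forall>k\<ge>N. Re (a (\<phi> j - \<phi> k) (\<phi> j - \<phi> k)) < d"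
      using form_approxD(3)[OF \<phi> d(1)] by blast
    have "Re (a (c *\<^sub>C \<phi> j - c *\<^sub>C \<phi> k) (c *\<^sub>C \<phi> j - c *\<^sub>C \<phi> k)) < e" if "j \<ge> N" "k \<ge> N" for j k
    proof -
      define z where "z = \<phi> j - \<phi> k"
      have z: "z \<in> D" "Re (a z z) < d" unfolding z_def using DD(4)[OF mem mem] N that by auto
      have "a (c *\<^sub>C z) (c *\<^sub>C z) = (c * cnj c) * a z z"
        using z(1) by (simp add: Sv_scaleC cinner_simps)
      then have "Re (a (c *\<^sub>C z) (c *\<^sub>C z)) = (cmod c)\<^sup>2 * Re (a z z)"
        by (simp add: complex_norm_square[symmetric] del: of_real_power)
      also have "\<dots> \<le> (cmod c)\<^sup>2 * d" using z(2) by (intro mult_left_mono) auto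
      finally show ?thesis using d(2) by (simp add: z_def scaleC_diff_right)
    qed
    then show "\<exists>N. \<forall>j\<ge>N. \<forall>k\<ge>N. Re (a (c *\<^sub>C \<phi> j - c *\<^sub>C \<phi> k) (c *\<^sub>C \<phi> j - c *\<^sub>C \<phi> k)) < e"
      by blast
  qed
  then show "c *\<^sub>C x \<in> form_domain S" by (auto simp: form_domain_def)
qed

text \<open>The adjoint restricted to the form domain. \<open>friedrichs_eq\<close> identifies it
  with the form definition; the arguments on the Friedrichs extension run through this
  description.\<close>

definition HF :: "('h \<times> 'h) set" where "HF = {(f, g). (f, g) \<in> T \<and> f \<in> form_domain S}"

lemma closed_formI:
  assumes "h \<in> form_domain S" "f \<in> form_domain S"
    and lim: "\<And>\<psi> \<phi>. form_approx S \<psi> h \<Longrightarrow> form_approx S \<phi> f \<Longrightarrow> (\<lambda>k. a (\<psi> k) (\<phi> k)) \<longlonglongrightarrow> z"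
  shows "closed_form S h f = z"
  unfolding closed_form_def
proof (rule the_equality)
  fix w assume w: "\<forall>\<psi> \<phi>. form_approx S \<psi> h \<longrightarrow> form_approx S \<phi> f \<longrightarrow> (\<lambda>k. a (\<psi> k) (\<phi> k)) \<longlonglongrightarrow> w"
  obtain \<psi> \<phi> where "form_approx S \<psi> h" "form_approx S \<phi> f"
    using assms(1,2) by (auto simp: form_domain_def)
  then show "w = z" using w lim LIMSEQ_unique by blast
qed (use lim in blast)

text \<open>One inclusion is \<open>form_limit\<close>. For the other, test vectors from the domain
  of \<open>S\<close> suffice: with the two sequences exchanged, \<open>form_limit\<close> evaluates
  the closed form at \<open>x\<close> as \<open>\<langle>x', f\<rangle>\<close>.\<close>

lemma friedrichs_eq: "friedrichs S = HF"
proof (intro equalityI subrelI)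
  fix f g assume "(f, g) \<in> HF"
  then have fg: "(f, g) \<in> T" "f \<in> form_domain S" by (auto simp: HF_def)
  have "closed_form S h f = cinner h g" if "h \<in> form_domain S" for h
    by (rule closed_formI[OF that fg(2)]) (rule form_limit[OF _ _ fg(1)])
  then show "(f, g) \<in> friedrichs S" using fg(2) by (simp add: friedrichs_def)
next
  fix f g assume "(f, g) \<in> friedrichs S"
  then have fd: "f \<in> form_domain S" and cf: "\<And>h. h \<in> form_domain S \<Longrightarrow> closed_form S h f = cinner h g"
    by (auto simp: friedrichs_def)
  have "cinner x' f = cinner x g" if x: "(x, x') \<in> S" for x x'
  proof -
    have xD: "x \<in> D" using x by blast
    have "closed_form S x f = cinner x' f"
    proof (rule closed_formI[OF D_form_domain[OF xD] fd])
      fix \<psi> \<phi> assume \<psi>: "form_approx S \<psi> x" and \<phi>: "form_approx S \<phi> f"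
      have "(\<lambda>k. cnj (a (\<phi> k) (\<psi> k))) \<longlonglongrightarrow> cnj (cinner f x')"
        by (intro tendsto_cnj form_limit[OF \<phi> \<psi> S_T[OF x]])
      moreover have "cnj (a (\<phi> k) (\<psi> k)) = a (\<psi> k) (\<phi> k)" for k
        using hermitian_onD(4)[OF a_hermitian form_approxD(1)[OF \<psi>] form_approxD(1)[OF \<phi>], of k k] by simp
      ultimately show "(\<lambda>k. a (\<psi> k) (\<phi> k)) \<longlonglongrightarrow> cinner x' f"
        using cinner_commute[of x' f] by simp
    qed
    then show ?thesis using cf[OF D_form_domain[OF xD]] by simp
  qed
  then show "(f, g) \<in> HF" using fd by (simp add: HF_def T_iff)
qed

lemma HF_T: "(f, f') \<in> HF \<Longrightarrow> (f, f') \<in> T"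
  and HF_form_domain: "(f, f') \<in> HF \<Longrightarrow> f \<in> form_domain S"
  and HF_I: "(f, f') \<in> T \<Longrightarrow> f \<in> form_domain S \<Longrightarrow> (f, f') \<in> HF"
  by (simp_all add: HF_def)

lemma HF_diff: "(f, f') \<in> HF \<Longrightarrow> (g, g') \<in> HF \<Longrightarrow> (f - g, f' - g') \<in> HF"
  by (simp add: HF_def T_diff csubspaceD(4)[OF form_domain_csubspace])

lemma HF_add: "(f, f') \<in> HF \<Longrightarrow> (g, g') \<in> HF \<Longrightarrow> (f + g, f' + g') \<in> HF"
  by (simp add: HF_def T_add csubspaceD(2)[OF form_domain_csubspace])

lemma HF_scaleC: "(f, f') \<in> HF \<Longrightarrow> (c *\<^sub>C f, c *\<^sub>C f') \<in> HF"
  by (simp add: HF_def T_scaleC csubspaceD(3)[OF form_domain_csubspace])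

lemma HF_D: "f \<in> D \<Longrightarrow> (f, Sv f) \<in> HF"
  by (intro HF_I Sv_T D_form_domain)

lemma HF_obtain:
  assumes "(f, f') \<in> HF"
  obtains \<phi> where "form_approx S \<phi> f" "(f, f') \<in> T"
  using assms by (auto simp: HF_def form_domain_def)

lemma HF_sym:
  assumes f: "(f, f') \<in> HF" and g: "(g, g') \<in> HF"
  shows "cinner f g' = cinner f' g"
proof -
  obtain \<phi> where \<phi>: "form_approx S \<phi> f" "(f, f') \<in> T" by (rule HF_obtain[OF f])
  obtain \<psi> where \<psi>: "form_approx S \<psi> g" "(g, g') \<in> T" by (rule HF_obtain[OF g])
  have "(\<lambda>k. cnj (a (\<psi> k) (\<phi> k))) \<longlonglongrightarrow> cnj (cinner g f')"
    by (intro tendsto_cnj form_limit[OF \<psi>(1) \<phi>])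
  moreover have "cnj (a (\<psi> k) (\<phi> k)) = a (\<phi> k) (\<psi> k)" for k
    using hermitian_onD(4)[OF a_hermitian form_approxD(1)[OF \<phi>(1)] form_approxD(1)[OF \<psi>(1)], of k k] by simp
  ultimately have "(\<lambda>k. a (\<phi> k) (\<psi> k)) \<longlonglongrightarrow> cinner f' g" using cinner_commute[of f' g] by simp
  then show ?thesis using form_limit[OF \<phi>(1) \<psi>] LIMSEQ_unique by blast
qed

lemma HF_nonneg:
  assumes "(f, f') \<in> HF"
  shows "0 \<le> Re (cinner f f')"
proof -
  obtain \<phi> where \<phi>: "form_approx S \<phi> f" "(f, f') \<in> T" by (rule HF_obtain[OF assms])
  have "(\<lambda>k. Re (a (\<phi> k) (\<phi> k))) \<longlonglongrightarrow> Re (cinner f f')"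
    by (intro tendsto_Re form_limit[OF \<phi>(1) \<phi>])
  then show ?thesis
    by (rule LIMSEQ_le_const) (use a_nonneg form_approxD(1)[OF \<phi>(1)] in blast)
qed

text \<open>Expanding the energy of \<open>f - \<phi> k\<close> gives four terms, each tending to
  the same number up to sign, and the signs cancel.\<close>

lemma HF_core:
  assumes f: "(f, f') \<in> HF"
  obtains \<phi> where "\<forall>k. \<phi> k \<in> D" "\<phi> \<longlonglongrightarrow> f"
    "(\<lambda>k. Re (cinner (f - \<phi> k) (f' - Sv (\<phi> k)))) \<longlonglongrightarrow> 0"
proof -
  obtain \<phi> where \<phi>: "form_approx S \<phi> f" "(f, f') \<in> T" by (rule HF_obtain[OF f])
  note lim = form_approxD(2)[OF \<phi>(1)]
  have eq: "cinner (f - \<phi> k) (f' - Sv (\<phi> k))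
      = cinner f f' - cinner f' (\<phi> k) - cinner (\<phi> k) f' + a (\<phi> k) (\<phi> k)" for k
    using HF_sym[OF f HF_D[OF form_approxD(1)[OF \<phi>(1)]], of k] by (simp add: cinner_simps)
  have "(\<lambda>k. cinner (f - \<phi> k) (f' - Sv (\<phi> k))) \<longlonglongrightarrow> cinner f f' - cinner f' f - cinner f f' + cinner f f'"
    unfolding eq by (intro tendsto_add tendsto_diff tendsto_cinner tendsto_const lim form_limit[OF \<phi>(1) \<phi>])
  then have "(\<lambda>k. Re (cinner (f - \<phi> k) (f' - Sv (\<phi> k)))) \<longlonglongrightarrow> Re (cinner f f' - cinner f' f)"
    by (intro tendsto_Re) simp
  then have "(\<lambda>k. Re (cinner (f - \<phi> k) (f' - Sv (\<phi> k)))) \<longlonglongrightarrow> 0" using HF_sym[OF f f] by simp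
  then show thesis using that form_approxD(1)[OF \<phi>(1)] lim by blast
qed

section \<open>The resolvent by minimization\<close>

lemma linear_part_zero:
  fixes c b :: real
  assumes "\<And>\<tau>. 0 \<le> 2 * \<tau> * c + \<tau>\<^sup>2 * b"
  shows "c = 0"
proof -
  define B where "B = \<bar>b\<bar> + 1"
  have B: "B > 0" "b \<le> B" by (simp_all add: B_def)
  have "0 \<le> 2 * (- c / B) * c + (- c / B)\<^sup>2 * b" by (rule assms)
  also have "\<dots> \<le> 2 * (- c / B) * c + (- c / B)\<^sup>2 * B"
    using B by (intro add_left_mono mult_left_mono) auto
  also have "\<dots> = - (c\<^sup>2 / B)" using B(1) by (simp add: field_simps power2_eq_square)
  finally show ?thesis using B(1) by (simp add: divide_le_0_iff)
qed

text \<open>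
  The resolvent equation is solved by minimizing the quadratic functional
  \<open>\<phi> \<mapsto> Re (a \<phi> \<phi>) - s \<parallel>\<phi>\<parallel>\<^sup>2 - 2 Re \<langle>\<phi>, g\<rangle>\<close> over the domain of \<open>S\<close>.
\<close>

lemma HF_resolvent:
  assumes s: "s < 0"
  obtains f f' where "(f, f') \<in> HF" "f' - s *\<^sub>R f = g"
proof -
  define b where "b \<phi> = Re (a \<phi> \<phi>) - s * (norm \<phi>)\<^sup>2" for \<phi>
  define J where "J \<phi> = b \<phi> - 2 * Re (cinner \<phi> g)" for \<phi>
  have norm_sum: "(norm (x + y))\<^sup>2 = (norm x)\<^sup>2 + 2 * Re (cinner x y) + (norm y)\<^sup>2" for x y :: 'h
    using cinner_commute[of y x] by (simp flip: Re_cinner_self add: cinner_simps)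
  \<comment> \<open>The shift makes \<open>b\<close> coercive: since \<open>s < 0\<close> and the
    form is nonnegative, \<open>b\<close> dominates both the form and a positive multiple of the
    squared norm.\<close>
  have b_ge: "Re (a \<phi> \<phi>) \<le> b \<phi>" "- s * (norm \<phi>)\<^sup>2 \<le> b \<phi>" if "\<phi> \<in> D" for \<phi>
    using a_nonneg that s by (auto simp: b_def mult_nonpos_nonneg)
  have J_ge: "- (norm g)\<^sup>2 / (- s) \<le> J \<phi>" if "\<phi> \<in> D" for \<phi>
  proof -
    have "0 \<le> (- s * norm \<phi> - norm g)\<^sup>2 / (- s)" using s by (intro divide_nonneg_pos) auto
    also have "\<dots> = - s * (norm \<phi>)\<^sup>2 - 2 * (norm \<phi> * norm g) + (norm g)\<^sup>2 / (- s)"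
      using s by (simp add: field_simps power2_eq_square)
    finally have "- (norm g)\<^sup>2 / (- s) \<le> - s * (norm \<phi>)\<^sup>2 - 2 * (norm \<phi> * norm g)" by simp
    moreover have "Re (cinner \<phi> g) \<le> norm \<phi> * norm g"
      using complex_Re_le_cmod[of "cinner \<phi> g"] cmod_cinner_le[of \<phi> g] by linarith
    ultimately show ?thesis using b_ge(2)[OF that] unfolding J_def by linarith
  qed
  define I where "I = Inf (J ` D)"
  have ne: "J ` D \<noteq> {}" using DD(1) by blast
  have bdd: "bdd_below (J ` D)" using J_ge by (auto intro!: bdd_belowI)
  have I_le: "I \<le> J \<phi>" if "\<phi> \<in> D" for \<phi> unfolding I_def using that bdd by (intro cInf_lower) auto
  have "\<exists>\<phi>. \<phi> \<in> D \<and> J \<phi> < I + 1 / real (Suc k)" for k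
  proof -
    have "Inf (J ` D) < I + 1 / real (Suc k)" unfolding I_def by simp
    then show ?thesis using cInf_less_iff[OF ne bdd] by auto
  qed
  then obtain \<phi> where \<phi>: "\<And>k. \<phi> k \<in> D" "\<And>k. J (\<phi> k) < I + 1 / real (Suc k)" by metis
  \<comment> \<open>Parallelogram identity; the linear parts of the three values of \<open>J\<close>
    cancel. It turns near-minimality into closeness.\<close>
  have b_diff: "b (x - y) = 2 * J x + 2 * J y - 4 * J ((1/2) *\<^sub>R (x + y))" if "x \<in> D" "y \<in> D" for x y
  proof -
    define z where "z = x + y"
    have z: "z \<in> D" unfolding z_def by (rule DD(2)[OF that])
    have "4 * b ((1/2) *\<^sub>R z) = b z"
      unfolding b_def using z
      by (simp add: Sv_scaleR cinner_scaleR_left cinner_scaleR_right power_mult_distrib power_divide algebra_simps)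
    then have "4 * J ((1/2) *\<^sub>R z) = b z - 4 * Re (cinner z g)"
      unfolding J_def by (simp add: cinner_scaleR_left)
    moreover have "(norm (x - y))\<^sup>2 = (norm x)\<^sup>2 - 2 * Re (cinner x y) + (norm y)\<^sup>2"
      using norm_sum[of x "- y"] by (simp add: cinner_minus_right)
    note n = this norm_sum[of x y]
    have "b (x - y) + b z = 2 * b x + 2 * b y"
      unfolding b_def z_def n using that
      by (simp add: Sv_diff Sv_add cinner_simps algebra_simps)
    ultimately show ?thesis unfolding J_def z_def by (simp add: cinner_simps)
  qed
  have b_small: "b (\<phi> j - \<phi> k) \<le> 2 / real (Suc j) + 2 / real (Suc k)" for j k
  proof -
    have "I \<le> J ((1/2) *\<^sub>R (\<phi> j + \<phi> k))" by (intro I_le DD(6) DD(2) \<phi>(1))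
    then show ?thesis using b_diff[OF \<phi>(1) \<phi>(1), of j k] \<phi>(2)[of j] \<phi>(2)[of k] by simp
  qed
  have small: "\<exists>N. \<forall>j\<ge>N. \<forall>k\<ge>N. b (\<phi> j - \<phi> k) < e" if "e > 0" for e
  proof -
    obtain N where N: "1 / real (Suc N) < e / 4"
      using reals_Archimedean[of "e / 4"] \<open>e > 0\<close> by (auto simp: inverse_eq_divide)
    define u where "u k = 2 / real (Suc k)" for k
    have u: "u N < e / 2" "\<And>j. N \<le> j \<Longrightarrow> u j \<le> u N"
      using N by (simp_all add: u_def frac_le)
    have "b (\<phi> j - \<phi> k) < e" if jk: "j \<ge> N" "k \<ge> N" for j k
      using b_small[of j k, folded u_def] u(1) u(2)[OF jk(1)] u(2)[OF jk(2)] by linarith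
    then show ?thesis by blast
  qed
  \<comment> \<open>\<open>b\<close> dominates both the norm and the form, so its smallness gives
    convergence here and \<open>form_approx\<close> afterwards.\<close>
  have "Cauchy \<phi>"
  proof (rule metric_CauchyI)
    fix e :: real assume e: "e > 0"
    then have "- s * e\<^sup>2 > 0" using s by (simp add: mult_neg_pos)
    then obtain N where N: "\<forall>j\<ge>N. \<forall>k\<ge>N. b (\<phi> j - \<phi> k) < - s * e\<^sup>2" using small by blast
    have "dist (\<phi> j) (\<phi> k) < e" if "j \<ge> N" "k \<ge> N" for j k
    proof -
      have "- s * (norm (\<phi> j - \<phi> k))\<^sup>2 < - s * e\<^sup>2"
        using b_ge(2)[OF DD(4)[OF \<phi>(1) \<phi>(1)], of j k] N that by fastforce
      then have "(norm (\<phi> j - \<phi> k))\<^sup>2 < e\<^sup>2" using s by simp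
      then show ?thesis using e by (simp add: dist_norm power2_less_imp_less)
    qed
    then show "\<exists>N. \<forall>j\<ge>N. \<forall>k\<ge>N. dist (\<phi> j) (\<phi> k) < e" by blast
  qed
  then obtain f where f: "\<phi> \<longlonglongrightarrow> f" using Cauchy_convergent convergent_def by blast
  have "form_approx S \<phi> f"
    unfolding form_approx_def
  proof (intro conjI allI impI f)
    show "range \<phi> \<subseteq> D" using \<phi>(1) by blast
    fix e :: real assume "e > 0"
    then obtain N where "\<forall>j\<ge>N. \<forall>k\<ge>N. b (\<phi> j - \<phi> k) < e" using small by blast
    then show "\<exists>N. \<forall>j\<ge>N. \<forall>k\<ge>N. Re (a (\<phi> j - \<phi> k) (\<phi> j - \<phi> k)) < e"
      using b_ge(1)[OF DD(4)[OF \<phi>(1) \<phi>(1)]] le_less_trans by blast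
  qed
  then have fd: "f \<in> form_domain S" by (auto simp: form_domain_def)
  have Re_zero: "Re (cinner (Sv w) f - s * cinner w f - cinner w g) = 0" if w: "w \<in> D" for w
  proof (rule linear_part_zero)
    fix \<tau> :: real
    define c where "c x = Re (cinner (Sv w) x - s * cinner w x - cinner w g)" for x
    \<comment> \<open>Moving from a near-minimizer by \<open>\<tau> w\<close> cannot lower the
      functional by more than \<open>1 / (k + 1)\<close>.\<close>
    have "- (1 / real (Suc k)) \<le> 2 * \<tau> * c (\<phi> k) + \<tau>\<^sup>2 * b w" for k
    proof -
      have mem: "\<phi> k \<in> D" "\<tau> *\<^sub>R w \<in> D" using \<phi>(1) DD(6)[OF w] by auto
      have "Re (a (\<phi> k) w) = Re (cinner (Sv w) (\<phi> k))"
        using cinner_commute[of "\<phi> k" "Sv w"] by simp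
      then have "J (\<phi> k + \<tau> *\<^sub>R w) = J (\<phi> k) + 2 * \<tau> * c (\<phi> k) + \<tau>\<^sup>2 * b w"
        unfolding J_def b_def c_def
        using mem w Sv_sym[OF w mem(1)] cinner_commute[of "\<phi> k" w] norm_sum[of "\<phi> k" "\<tau> *\<^sub>R w"]
        by (simp add: Sv_add Sv_scaleR cinner_simps cinner_scaleR_left cinner_scaleR_right
            power_mult_distrib algebra_simps power2_eq_square)
      then show ?thesis
        using I_le[OF DD(2)[OF mem]] \<phi>(2)[of k] by linarith
    qed
    moreover have "(\<lambda>k. 2 * \<tau> * c (\<phi> k) + \<tau>\<^sup>2 * b w) \<longlonglongrightarrow> 2 * \<tau> * c f + \<tau>\<^sup>2 * b w"
      unfolding c_def by (intro tendsto_intros tendsto_cinner f)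
    moreover have "(\<lambda>k. - (1 / real (Suc k))) \<longlonglongrightarrow> - 0"
      by (intro tendsto_minus LIMSEQ_Suc[OF lim_1_over_n])
    ultimately have "- 0 \<le> 2 * \<tau> * c f + \<tau>\<^sup>2 * b w"
      by (intro LIMSEQ_le[where X = "\<lambda>k. - (1 / real (Suc k))"]) auto
    then show "0 \<le> 2 * \<tau> * Re (cinner (Sv w) f - s * cinner w f - cinner w g) + \<tau>\<^sup>2 * b w"
      by (simp add: c_def)
  qed
  have zero: "cinner (Sv w) f - s * cinner w f - cinner w g = 0" if w: "w \<in> D" for w
  proof -
    \<comment> \<open>Applying the real statement to \<open>\<i> w\<close> gives the imaginary
      part.\<close>
    have "Im (cinner (Sv w) f - s * cinner w f - cinner w g) = 0"
      using Re_zero[OF DD(3)[OF w, of \<i>]] w by (simp add: Sv_scaleC cinner_simps)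
    then show ?thesis using Re_zero[OF w] by (simp add: complex_eq_iff)
  qed
  have "(f, g + s *\<^sub>R f) \<in> T"
    unfolding T_iff
  proof (intro allI impI)
    fix x x' assume x: "(x, x') \<in> S"
    then have "x \<in> D" "Sv x = x'" using Sv_eq by auto
    then show "cinner x' f = cinner x (g + s *\<^sub>R f)"
      using zero[of x] by (simp add: cinner_simps cinner_scaleR_right scaleR_conv_of_real algebra_simps)
  qed
  then show thesis using fd by (intro that[of f "g + s *\<^sub>R f"] HF_I) auto
qed

lemma HF_bound:
  assumes "(r, r') \<in> HF" "t < 0"
  shows "- t * (norm r)\<^sup>2 \<le> Re (cinner r (r' - t *\<^sub>R r))"
    "norm r \<le> norm (r' - t *\<^sub>R r) / (- t)"
proof -
  show *: "- t * (norm r)\<^sup>2 \<le> Re (cinner r (r' - t *\<^sub>R r))"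
    using HF_nonneg[OF assms(1)] by (simp add: cinner_simps cinner_scaleR_right Re_cinner_self)
  have "Re (cinner r (r' - t *\<^sub>R r)) \<le> norm r * norm (r' - t *\<^sub>R r)"
    using complex_Re_le_cmod[of "cinner r (r' - t *\<^sub>R r)"] cmod_cinner_le[of r "r' - t *\<^sub>R r"] by linarith
  then have le: "norm r * (- t * norm r) \<le> norm r * norm (r' - t *\<^sub>R r)"
    using * by (simp add: power2_eq_square mult_ac)
  show "norm r \<le> norm (r' - t *\<^sub>R r) / (- t)"
  proof (cases "r = 0")
    case False
    have "- t * norm r \<le> norm (r' - t *\<^sub>R r)" by (rule mult_left_le_imp_le[OF le]) (use False in simp)
    then show ?thesis using assms(2) by (simp add: field_simps)
  qed (use assms(2) in \<open>simp add: divide_nonneg_neg\<close>)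
qed

end

section \<open>Boundary triplets and Cauchy data\<close>

locale boundary_setting = nonnegative_symmetric S
  for S :: "('h :: chilbert_space \<times> 'h) set" +
  fixes \<Gamma>\<^sub>0 \<Gamma>\<^sub>1 :: "'h \<Rightarrow> 'k :: chilbert_space" and n :: nat
  assumes triplet: "boundary_triplet n S \<Gamma>\<^sub>0 \<Gamma>\<^sub>1"
begin

definition G :: "'h \<Rightarrow> 'k \<times> 'k" where "G f = (\<Gamma>\<^sub>0 f, \<Gamma>\<^sub>1 f)"

lemma finite_K: "finite_cdim TYPE('k)"
proof -
  have "ecdim (UNIV :: 'k set) = enat n" using triplet by (simp add: boundary_triplet_def)
  then obtain B :: "'k set" where "finite B" "UNIV \<subseteq> cspan B"
    by (auto simp: ecdim_def split: if_splits)
  then show ?thesis by (auto simp: finite_cdim_def)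
qed

lemma G_add: "(f, f') \<in> T \<Longrightarrow> (g, g') \<in> T \<Longrightarrow> G (f + g) = G f + G g"
  using triplet by (fastforce simp: boundary_triplet_def clinear_on_def G_def)

lemma G_scaleC: "(f, f') \<in> T \<Longrightarrow> G (c *\<^sub>C f) = c *\<^sub>C G f"
  using triplet by (fastforce simp: boundary_triplet_def clinear_on_def G_def scaleC_Pair)

lemma G_diff: "(f, f') \<in> T \<Longrightarrow> (g, g') \<in> T \<Longrightarrow> G (f - g) = G f - G g"
  using G_add[of "f - g" "f' - g'" g g'] T_diff[of f f' g g'] by (simp add: algebra_simps)

lemma G_surj: obtains f f' where "(f, f') \<in> T" "G f = u"
proof -
  have "u \<in> G ` Domain T"
    using triplet by (simp add: boundary_triplet_def G_def[abs_def])
  then show thesis using that by blast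
qed

lemma green: "(f, f') \<in> T \<Longrightarrow> (g, g') \<in> T \<Longrightarrow> cinner f g' - cinner f' g = sympl (G f) (G g)"
  using triplet by (auto simp: boundary_triplet_def sympl_def G_def)

lemma G_D:
  assumes "f \<in> D"
  shows "G f = 0"
proof -
  have "sympl v (G f) = 0" for v
  proof -
    obtain g g' where g: "(g, g') \<in> T" "G g = v" by (rule G_surj)
    have "sympl (G f) (G g) = 0"
      using green[OF Sv_T[OF assms] g(1)] Sv_adj[OF assms g(1)] by simp
    then show ?thesis using g(2) sympl_eq_0_commute[of v "G f"] by simp
  qed
  then show ?thesis by (rule sympl_nondegenerate)
qed

lemma HF_G_iso:
  assumes "(f, f') \<in> HF" "(g, g') \<in> HF"
  shows "sympl (G f) (G g) = 0"
  using green[OF HF_T[OF assms(1)] HF_T[OF assms(2)]] HF_sym[OF assms] by simp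

text \<open>Solve at -1 with right side \<open>f' + f\<close>; the difference \<open>m\<close>
  between \<open>f\<close> and the solution lies in the kernel of the adjoint plus 1. Up to sign its
  boundary value is that of an element of \<open>HF\<close>, so it pairs to 0 with the solution for
  right side \<open>m\<close>, and Green's identity reads
  \<open>\<langle>m, m\<rangle> = 0\<close>.\<close>

lemma kernel_form_domain:
  assumes f: "(f, f') \<in> T" and Gf: "G f = 0"
  shows "f \<in> form_domain S"
proof -
  obtain p p' where p: "(p, p') \<in> HF" "p' - (-1) *\<^sub>R p = f' + f"
    by (rule HF_resolvent[of "-1"]) simp
  define m where "m = f - p"
  have "f' - p' = - m" using p(2) by (simp add: m_def algebra_simps)
  then have m: "(m, - m) \<in> T" using T_diff[OF f HF_T[OF p(1)]] by (simp add: m_def)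
  have Gm: "G m = - G p" using G_diff[OF f HF_T[OF p(1)]] Gf by (simp add: m_def)
  obtain g g' where g: "(g, g') \<in> HF" "g' - (-1) *\<^sub>R g = m"
    by (rule HF_resolvent[of "-1"]) simp
  have "cinner m g' - cinner (- m) g = 0"
    using green[OF m HF_T[OF g(1)]] HF_G_iso[OF p(1) g(1)] Gm by (simp add: sympl_simps)
  then have "cinner m m = 0" using g(2) by (simp add: cinner_simps flip: g(2))
  then show ?thesis using HF_form_domain[OF p(1)] by (simp add: m_def)
qed

section \<open>The planes of the Friedrichs extension and of the kernels\<close>

definition F :: "('k \<times> 'k) set" where "F = G ` Domain HF"

lemma F_I: "(f, f') \<in> HF \<Longrightarrow> G f \<in> F"
  by (auto simp: F_def)

text \<open>Two elements with equal boundary values differ by an element of the kernel of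
  \<open>G\<close>, and this lies in the form domain; so the plane determines the extension.\<close>

lemma F_D:
  assumes f: "(f, f') \<in> T" and "G f \<in> F"
  shows "(f, f') \<in> HF"
proof -
  obtain p p' where p: "(p, p') \<in> HF" "G f = G p" using assms(2) by (auto simp: F_def)
  have "f - p \<in> form_domain S"
    by (rule kernel_form_domain[OF T_diff[OF f HF_T[OF p(1)]]])
      (simp add: G_diff[OF f HF_T[OF p(1)]] p(2))
  from csubspaceD(2)[OF form_domain_csubspace this HF_form_domain[OF p(1)]]
  show ?thesis by (intro HF_I f) simp
qed

abbreviation M :: "real \<Rightarrow> ('k \<times> 'k) set" where "M \<equiv> cauchy_data S \<Gamma>\<^sub>0 \<Gamma>\<^sub>1"

lemma M_iff: "u \<in> M s \<longleftrightarrow> (\<exists>f. (f, s *\<^sub>R f) \<in> T \<and> u = G f)"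
  by (auto simp: cauchy_data_def eigenspace_def G_def scaleC_of_real)

lemma M_I: "(f, s *\<^sub>R f) \<in> T \<Longrightarrow> G f \<in> M s"
  unfolding M_iff by blast

lemma F_csubspace: "csubspace F"
proof (rule csubspaceI)
  show "0 \<in> F" using F_I[OF HF_D[OF DD(1)]] G_D[OF DD(1)] by simp
next
  fix x y assume "x \<in> F" "y \<in> F"
  then obtain f f' g g' where "(f, f') \<in> HF" "(g, g') \<in> HF" "x = G f" "y = G g" by (auto simp: F_def)
  then show "x + y \<in> F" using F_I[OF HF_add] G_add[OF HF_T HF_T] by metis
next
  fix c x assume "x \<in> F"
  then obtain f f' where "(f, f') \<in> HF" "x = G f" by (auto simp: F_def)
  then show "c *\<^sub>C x \<in> F" using F_I[OF HF_scaleC] G_scaleC[OF HF_T] by metis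
qed

lemma M_csubspace: "csubspace (M s)"
proof (rule csubspaceI)
  have "(0, s *\<^sub>R 0) \<in> T" using csubspaceD(1)[OF T_csubspace] by (simp add: zero_prod_def)
  then show "0 \<in> M s" using M_I[of 0 s] G_D[OF DD(1)] by simp
next
  fix x y assume "x \<in> M s" "y \<in> M s"
  then obtain f g where fg: "(f, s *\<^sub>R f) \<in> T" "(g, s *\<^sub>R g) \<in> T" "x = G f" "y = G g" by (auto simp: M_iff)
  have "(f + g, s *\<^sub>R (f + g)) \<in> T" using T_add[OF fg(1,2)] by (simp add: scaleR_add_right)
  then show "x + y \<in> M s" using M_I G_add[OF fg(1,2)] fg(3,4) by metis
next
  fix c x assume "x \<in> M s"
  then obtain f where f: "(f, s *\<^sub>R f) \<in> T" "x = G f" by (auto simp: M_iff)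
  have "(c *\<^sub>C f, s *\<^sub>R (c *\<^sub>C f)) \<in> T"
    using T_scaleC[OF f(1), of c]
    by (simp add: scaleC_of_real[symmetric] scaleC_scaleC mult.commute)
  then show "c *\<^sub>C x \<in> M s" using M_I G_scaleC[OF f(1)] f(2) by metis
qed

lemma F_iso: "u \<in> F \<Longrightarrow> v \<in> F \<Longrightarrow> sympl u v = 0"
  using HF_G_iso by (auto simp: F_def)

lemma M_iso: "u \<in> M s \<Longrightarrow> v \<in> M s \<Longrightarrow> sympl u v = 0"
  using green by (auto simp: M_iff cinner_scaleR_left cinner_scaleR_right simp flip: green)

text \<open>Apply the resolvent of \<open>HF\<close> at \<open>s\<close> to \<open>f' - s f\<close>;
  subtracting the result from \<open>f\<close> leaves an element of the kernel of the adjoint minus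
  \<open>s\<close>.\<close>

lemma decomposition:
  assumes s: "s < 0" and f: "(f, f') \<in> T"
  obtains m p p' where "(m, s *\<^sub>R m) \<in> T" "(p, p') \<in> HF" "f = m + p" "f' = s *\<^sub>R m + p'" "G f = G m + G p"
proof -
  obtain p p' where p: "(p, p') \<in> HF" "p' - s *\<^sub>R p = f' - s *\<^sub>R f" by (rule HF_resolvent[OF s])
  have e: "f' - p' = s *\<^sub>R (f - p)" using p(2) by (simp add: algebra_simps)
  have m: "(f - p, s *\<^sub>R (f - p)) \<in> T" using T_diff[OF f HF_T[OF p(1)]] e by simp
  have "f' = s *\<^sub>R (f - p) + p'" using e by (simp add: algebra_simps)
  moreover have "G f = G (f - p) + G p" using G_diff[OF f HF_T[OF p(1)]] by simp
  ultimately show thesis using that[OF m p(1)] by simp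
qed

lemma sum_M_F:
  assumes "s < 0"
  shows "\<exists>v\<in>M s. x - v \<in> F"
proof -
  obtain f f' where f: "(f, f') \<in> T" "G f = x" by (rule G_surj)
  obtain m p p' where m: "(m, s *\<^sub>R m) \<in> T" "(p, p') \<in> HF" "f = m + p" "f' = s *\<^sub>R m + p'" "G f = G m + G p"
    by (rule decomposition[OF assms f(1)])
  have "x - G m = G p" using m(5) f(2) by simp
  then show ?thesis using M_I[OF m(1)] F_I[OF m(2)] by (intro bexI[of _ "G m"]) simp_all
qed

lemma M_lagrangian: "s < 0 \<Longrightarrow> lagrangian (M s)"
  by (rule lagrangianI_isotropic_sum[OF M_csubspace M_iso F_csubspace F_iso sum_M_F])

lemma F_lagrangian: "lagrangian F"
proof (rule lagrangianI_isotropic_sum[OF F_csubspace F_iso M_csubspace M_iso])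
  fix x
  obtain v where "v \<in> M (-1)" "x - v \<in> F" using sum_M_F[of "-1" x] by auto
  then show "\<exists>a\<in>F. x - a \<in> M (-1)" by (intro bexI[of _ "x - v"]) simp_all
qed

lemma eigen_HF_zero:
  assumes "s < 0" "(m, s *\<^sub>R m) \<in> HF"
  shows "m = 0"
proof -
  have "0 \<le> s * (norm m)\<^sup>2"
    using HF_nonneg[OF assms(2)] by (simp add: cinner_scaleR_right Re_cinner_self)
  then show ?thesis using assms(1) by (simp add: zero_le_mult_iff)
qed

lemma M_Int_F:
  assumes s: "s < 0"
  shows "M s \<inter> F = {0}"
proof -
  have "u = 0" if u: "u \<in> M s" "u \<in> F" for u
  proof -
    obtain m where m: "(m, s *\<^sub>R m) \<in> T" "u = G m" using u(1) by (auto simp: M_iff)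
    have "(m, s *\<^sub>R m) \<in> HF" by (rule F_D[OF m(1)]) (use m(2) u(2) in simp)
    then have "m = 0" by (rule eigen_HF_zero[OF s])
    then show ?thesis using m(2) G_D[OF DD(1)] by simp
  qed
  then show ?thesis using csubspaceD(1)[OF M_csubspace] csubspaceD(1)[OF F_csubspace] by auto
qed

lemma trans_M_F: "s < 0 \<Longrightarrow> transversal (M s) F"
  by (rule transversal_lagrangian[OF finite_K M_lagrangian F_lagrangian M_Int_F])

text \<open>With \<open>r\<close> the resolvent of \<open>HF\<close> at \<open>t\<close> applied to
  \<open>m\<close>, the vector \<open>m + (t - s) r\<close> solves the equation at \<open>t\<close>
  and has the same boundary value modulo \<open>F\<close>. The resolvent bound controls the
  distance; nonnegativity of \<open>HF\<close> gives \<open>\<langle>m, r\<rangle>\<close> a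
  nonnegative real part.\<close>

lemma transfer_eigen:
  assumes t: "t < 0" and m: "(m, s *\<^sub>R m) \<in> T"
  obtains m\<^sub>t where "(m\<^sub>t, t *\<^sub>R m\<^sub>t) \<in> T" "G m\<^sub>t - G m \<in> F"
    "norm (m\<^sub>t - m) \<le> \<bar>t - s\<bar> * (norm m / (- t))"
    "s \<le> t \<longrightarrow> (norm m)\<^sup>2 \<le> Re (cinner m m\<^sub>t)"
proof -
  obtain r r' where r: "(r, r') \<in> HF" "r' - t *\<^sub>R r = m" by (rule HF_resolvent[OF t])
  define m\<^sub>t where "m\<^sub>t = m + (t - s) *\<^sub>R r"
  have rs: "((t - s) *\<^sub>R r, (t - s) *\<^sub>R r') \<in> HF"
    using HF_scaleC[OF r(1), of "complex_of_real (t - s)"] by (simp only: scaleC_of_real)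
  have "s *\<^sub>R m + (t - s) *\<^sub>R r' = t *\<^sub>R m\<^sub>t"
    unfolding m\<^sub>t_def using r(2) by (simp add: algebra_simps flip: r(2))
  then have mt: "(m\<^sub>t, t *\<^sub>R m\<^sub>t) \<in> T"
    using T_add[OF m HF_T[OF rs]] by (simp add: m\<^sub>t_def)
  moreover have "G m\<^sub>t - G m \<in> F"
    using G_add[OF m HF_T[OF rs]] F_I[OF rs] by (simp add: m\<^sub>t_def)
  moreover have "norm (m\<^sub>t - m) \<le> \<bar>t - s\<bar> * (norm m / (- t))"
    using mult_left_mono[OF HF_bound(2)[OF r(1) t], of "\<bar>t - s\<bar>"] r(2) by (simp add: m\<^sub>t_def)
  moreover have "(norm m)\<^sup>2 \<le> Re (cinner m m\<^sub>t)" if "s \<le> t"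
  proof -
    have "0 \<le> - t * (norm r)\<^sup>2" using t by (simp add: mult_nonpos_nonneg)
    then have "0 \<le> Re (cinner r m)" using HF_bound(1)[OF r(1) t] r(2) by simp
    then have "0 \<le> Re (cinner m r)" using cinner_commute[of m r] by simp
    then show ?thesis using that
      by (simp add: m\<^sub>t_def cinner_simps cinner_scaleR_right Re_cinner_self)
  qed
  ultimately show thesis using that by blast
qed

text \<open>As \<open>M t\<close> meets \<open>F\<close> only in 0, \<open>w\<close> is the boundary
  value of the vector transferred from \<open>s\<close> to \<open>t\<close>. Green's identity turns
  the pairing into \<open>(t - s) \<langle>m, m\<^sub>t\<rangle>\<close>, which the transfer keeps
  above a positive multiple of the squared norm of \<open>m\<close>.\<close>

lemma M_mono:
  assumes st: "s < t" "t < 0" and v: "v \<in> M s" and w: "w \<in> M t" and vw: "w - v \<in> F" and nz: "v \<noteq> 0"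
  shows "0 < Re (sympl v w)"
proof -
  obtain m where m: "(m, s *\<^sub>R m) \<in> T" "v = G m" using v by (auto simp: M_iff)
  obtain m\<^sub>t where mt: "(m\<^sub>t, t *\<^sub>R m\<^sub>t) \<in> T" "G m\<^sub>t - G m \<in> F"
    "norm (m\<^sub>t - m) \<le> \<bar>t - s\<bar> * (norm m / (- t))" "s \<le> t \<longrightarrow> (norm m)\<^sup>2 \<le> Re (cinner m m\<^sub>t)"
    by (rule transfer_eigen[OF st(2) m(1)])
  have "w - G m\<^sub>t \<in> M t" by (rule csubspaceD(4)[OF M_csubspace w M_I[OF mt(1)]])
  moreover have "(w - v) - (G m\<^sub>t - G m) \<in> F" by (rule csubspaceD(4)[OF F_csubspace vw mt(2)])
  then have "w - G m\<^sub>t \<in> F" using m(2) by simp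
  ultimately have "w - G m\<^sub>t = 0" using M_Int_F[OF st(2)] by blast
  then have w_eq: "w = G m\<^sub>t" by simp
  have "m \<noteq> 0" using nz m(2) G_D[OF DD(1)] by auto
  then have "0 < (t - s) * (norm m)\<^sup>2" using st by simp
  also have "\<dots> \<le> (t - s) * Re (cinner m m\<^sub>t)" using mt(4) st by (intro mult_left_mono) auto
  also have "\<dots> = Re (sympl v w)"
    unfolding m(2) w_eq green[OF m(1) mt(1), symmetric]
    by (simp add: cinner_scaleR_left cinner_scaleR_right algebra_simps)
  finally show ?thesis .
qed

lemma proj_M:
  assumes "s < 0" "(m, s *\<^sub>R m) \<in> T" "u - G m \<in> F"
  shows "proj_along F (M s) u = G m"
  by (rule proj_along_eqI[OF trans_M_F[OF assms(1)] M_I[OF assms(2)] assms(3)])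

text \<open>The transferred vectors converge in norm, but continuity of \<open>G\<close> is not at
  hand. Pairings with a fixed boundary value converge by Green's identity, and this suffices in
  finite dimension.\<close>

lemma M_cont:
  assumes s: "s < 0"
  shows "((\<lambda>t. proj_along F (M t) u) \<longlongrightarrow> proj_along F (M s) u) (at s)"
proof -
  obtain m where m: "(m, s *\<^sub>R m) \<in> T" "u - G m \<in> F"
    using sum_M_F[OF s, of u] by (auto simp: M_iff)
  have "\<forall>t. \<exists>x. t < 0 \<longrightarrow> (x, t *\<^sub>R x) \<in> T \<and> G x - G m \<in> F \<and> norm (x - m) \<le> \<bar>t - s\<bar> * (norm m / (- t))"
    using transfer_eigen[OF _ m(1)] by metis
  then obtain x where x: "\<And>t. t < 0 \<Longrightarrow> (x t, t *\<^sub>R x t) \<in> T" "\<And>t. t < 0 \<Longrightarrow> G (x t) - G m \<in> F"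
    "\<And>t. t < 0 \<Longrightarrow> norm (x t - m) \<le> \<bar>t - s\<bar> * (norm m / (- t))"
    by metis
  have ev: "\<forall>\<^sub>F t in at s. t < 0" using order_tendstoD(2)[OF tendsto_ident_at s] .
  have "((\<lambda>t. \<bar>t - s\<bar> * (norm m / (- t))) \<longlongrightarrow> \<bar>s - s\<bar> * (norm m / (- s))) (at s)"
    using s by (intro tendsto_intros) auto
  then have "((\<lambda>t. \<bar>t - s\<bar> * (norm m / (- t))) \<longlongrightarrow> 0) (at s)" by simp
  moreover have "\<forall>\<^sub>F t in at s. norm (x t - m) \<le> \<bar>t - s\<bar> * (norm m / (- t))"
    using ev by eventually_elim (rule x(3))
  ultimately have "((\<lambda>t. x t - m) \<longlongrightarrow> 0) (at s)"
    by (rule Lim_null_comparison[rotated])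
  then have xm: "(x \<longlongrightarrow> m) (at s)" by (rule LIM_zero_cancel)
  show ?thesis
  proof (rule tendsto_of_sympl_tendsto[OF finite_K])
    fix v
    obtain g g' where g: "(g, g') \<in> T" "G g = v" by (rule G_surj)
    have lim: "((\<lambda>t. cinner g (t *\<^sub>R x t) - cinner g' (x t)) \<longlongrightarrow> cinner g (s *\<^sub>R m) - cinner g' m) (at s)"
      by (intro tendsto_diff tendsto_cinner tendsto_const tendsto_scaleR xm tendsto_ident_at)
    have "sympl v (proj_along F (M s) u) = cinner g (s *\<^sub>R m) - cinner g' m"
      using green[OF g(1) m(1)] g(2) proj_M[OF s m] by simp
    moreover have "\<forall>\<^sub>F t in at s. cinner g (t *\<^sub>R x t) - cinner g' (x t) = sympl v (proj_along F (M t) u)"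
      using ev
    proof eventually_elim
      case (elim t)
      have "(u - G m) - (G (x t) - G m) \<in> F" by (rule csubspaceD(4)[OF F_csubspace m(2) x(2)[OF elim]])
      then have "proj_along F (M t) u = G (x t)" by (intro proj_M[OF elim x(1)[OF elim]]) simp
      then show ?case using green[OF g(1) x(1)[OF elim]] g(2) by simp
    qed
    ultimately show "((\<lambda>t. sympl v (proj_along F (M t) u)) \<longlongrightarrow> sympl v (proj_along F (M s) u)) (at s)"
      using Lim_transform_eventually[OF lim] by simp
  qed
qed

text \<open>
  The form \<open>q\<close> of the path at \<open>s\<close> is the infimum of \<open>Re \<langle>f - \<phi>, (S\<^sup>* - s) (f - \<phi>)\<rangle>\<close> over
  \<open>\<phi>\<close> in the domain of \<open>S\<close>. If these infima stay nonpositive as \<open>s\<close> tends to \<open>-\<infinity>\<close>, then a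
  minimizing sequence converges to \<open>f\<close> in the form norm.
\<close>

lemma M_start:
  assumes nonpos: "\<And>s. s < 0 \<Longrightarrow> Re (sympl (proj_along F (M s) u) (proj_along (M s) F u)) \<le> 0"
  shows "u \<in> F"
proof -
  obtain f f' where f: "(f, f') \<in> T" "G f = u" by (rule G_surj)
  define Q where "Q s = Re (sympl (proj_along F (M s) u) (proj_along (M s) F u))" for s
  define A where "A \<phi> = Re (cinner (f - \<phi>) (f' - Sv \<phi>))" for \<phi>
  \<comment> \<open>Write \<open>f = m + p\<close> with \<open>m\<close> in the kernel of the
    adjoint minus \<open>s\<close> and \<open>p\<close> in \<open>HF\<close>. The shifted operator
    kills \<open>m\<close>, and the pairing of \<open>m\<close> with the rest has the constant real
    part \<open>Q s\<close>; so the shifted energy of \<open>f - \<phi>\<close> is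
    \<open>Q s\<close> plus that of \<open>p - \<phi>\<close>.\<close>
  have split: "\<exists>p p'. (p, p') \<in> HF \<and> (\<forall>\<phi>\<in>D. A \<phi> - s * (norm (f - \<phi>))\<^sup>2
      = Q s + Re (cinner (p - \<phi>) (p' - Sv \<phi>)) - s * (norm (p - \<phi>))\<^sup>2)" if s: "s < 0" for s
  proof -
    obtain m p p' where d: "(m, s *\<^sub>R m) \<in> T" "(p, p') \<in> HF" "f = m + p" "f' = s *\<^sub>R m + p'" "G f = G m + G p"
      by (rule decomposition[OF s f(1)])
    have "proj_along F (M s) u = G m"
      by (rule proj_M[OF s d(1)]) (use d(5) f(2) F_I[OF d(2)] in auto)
    moreover have "proj_along (M s) F u = G p"
      by (rule proj_along_eqI[OF transversal_commute[OF trans_M_F[OF s]] F_I[OF d(2)]])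
        (use d(5) f(2) M_I[OF d(1)] in auto)
    ultimately have Qs: "Q s = Re (sympl (G m) (G p))" by (simp add: Q_def)
    have "A \<phi> - s * (norm (f - \<phi>))\<^sup>2 = Q s + Re (cinner (p - \<phi>) (p' - Sv \<phi>)) - s * (norm (p - \<phi>))\<^sup>2"
      if \<phi>: "\<phi> \<in> D" for \<phi>
    proof -
      define y where "y = (p' - Sv \<phi>) - s *\<^sub>R (p - \<phi>)"
      have "(p - \<phi>, p' - Sv \<phi>) \<in> T" by (rule T_diff[OF HF_T[OF d(2)] Sv_T[OF \<phi>]])
      from green[OF d(1) this]
      have "cinner m y = sympl (G m) (G (p - \<phi>))"
        by (simp add: y_def cinner_simps cinner_scaleR_left cinner_scaleR_right scaleR_diff_right)
      also have "G (p - \<phi>) = G p" using G_diff[OF HF_T[OF d(2)] Sv_T[OF \<phi>]] G_D[OF \<phi>] by simp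
      finally have my: "Re (cinner m y) = Q s" using Qs by simp
      have "A \<phi> - s * (norm (f - \<phi>))\<^sup>2 = Re (cinner (f - \<phi>) ((f' - Sv \<phi>) - s *\<^sub>R (f - \<phi>)))"
        unfolding A_def cinner_diff_right[of "f - \<phi>" "f' - Sv \<phi>" "s *\<^sub>R (f - \<phi>)"]
        by (simp only: cinner_scaleR_right minus_complex.sel scaleR_complex.sel Re_cinner_self)
      also have "(f' - Sv \<phi>) - s *\<^sub>R (f - \<phi>) = y" by (simp add: d(3,4) y_def algebra_simps)
      also have "f - \<phi> = m + (p - \<phi>)" by (simp add: d(3))
      also have "Re (cinner (m + (p - \<phi>)) y) = Q s + Re (cinner (p - \<phi>) y)"
        using my cinner_add_left[of m "p - \<phi>" y] by simp
      also have "Re (cinner (p - \<phi>) y) = Re (cinner (p - \<phi>) (p' - Sv \<phi>)) - s * (norm (p - \<phi>))\<^sup>2"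
        unfolding y_def cinner_diff_right[of "p - \<phi>" "p' - Sv \<phi>" "s *\<^sub>R (p - \<phi>)"]
        by (simp only: cinner_scaleR_right minus_complex.sel scaleR_complex.sel Re_cinner_self)
      finally show ?thesis by (simp add: d(3) algebra_simps)
    qed
    then show ?thesis using d(2) by blast
  qed
  have lower: "Q s \<le> A \<phi> - s * (norm (f - \<phi>))\<^sup>2" if s: "s < 0" and \<phi>: "\<phi> \<in> D" for s \<phi>
  proof -
    obtain p p' where p: "(p, p') \<in> HF" "\<forall>\<phi>\<in>D. A \<phi> - s * (norm (f - \<phi>))\<^sup>2
      = Q s + Re (cinner (p - \<phi>) (p' - Sv \<phi>)) - s * (norm (p - \<phi>))\<^sup>2" using split[OF s] by blast
    have "0 \<le> Re (cinner (p - \<phi>) (p' - Sv \<phi>))" by (rule HF_nonneg[OF HF_diff[OF p(1) HF_D[OF \<phi>]]])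
    moreover have "s * (norm (p - \<phi>))\<^sup>2 \<le> 0" using s by (simp add: mult_nonpos_nonneg)
    ultimately show ?thesis using bspec[OF p(2) \<phi>] by linarith
  qed
  have upper: "\<exists>\<phi>\<in>D. A \<phi> - s * (norm (f - \<phi>))\<^sup>2 < Q s + e" if s: "s < 0" and e: "e > 0" for s e
  proof -
    obtain p p' where p: "(p, p') \<in> HF" "\<forall>\<phi>\<in>D. A \<phi> - s * (norm (f - \<phi>))\<^sup>2
      = Q s + Re (cinner (p - \<phi>) (p' - Sv \<phi>)) - s * (norm (p - \<phi>))\<^sup>2" using split[OF s] by blast
    obtain \<phi> where \<phi>: "\<forall>k. \<phi> k \<in> D" "\<phi> \<longlonglongrightarrow> p"
      "(\<lambda>k. Re (cinner (p - \<phi> k) (p' - Sv (\<phi> k)))) \<longlonglongrightarrow> 0"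
      by (rule HF_core[OF p(1)])
    have "(\<lambda>k. Re (cinner (p - \<phi> k) (p' - Sv (\<phi> k))) - s * (norm (p - \<phi> k))\<^sup>2) \<longlonglongrightarrow> 0 - s * (norm (p - p))\<^sup>2"
      by (intro tendsto_diff \<phi>(2,3) tendsto_mult tendsto_const tendsto_power tendsto_norm)
    then have "\<forall>\<^sub>F k in sequentially. Re (cinner (p - \<phi> k) (p' - Sv (\<phi> k))) - s * (norm (p - \<phi> k))\<^sup>2 < e"
      using e by (intro order_tendstoD(2)) auto
    then obtain k where k: "Re (cinner (p - \<phi> k) (p' - Sv (\<phi> k))) - s * (norm (p - \<phi> k))\<^sup>2 < e"
      by (auto simp: eventually_sequentially)
    have "\<phi> k \<in> D" using \<phi>(1) by blast
    then show ?thesis using bspec[OF p(2) \<open>\<phi> k \<in> D\<close>] k by (intro bexI[of _ "\<phi> k"]) linarith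
  qed
  \<comment> \<open>The hypothesis \<open>nonpos\<close> bounds \<open>Q\<close> from above, which
    makes this supremum meaningful.\<close>
  define Qm where "Qm = Sup (Q ` {..<0})"
  have bdd: "bdd_above (Q ` {..<0})" using nonpos by (auto intro!: bdd_aboveI simp: Q_def)
  have Q_le: "Q s \<le> Qm" if "s < 0" for s unfolding Qm_def using that bdd by (intro cSup_upper) auto
  have "\<forall>k. \<exists>\<phi>. \<phi> \<in> D \<and> A \<phi> + real (Suc k) * (norm (f - \<phi>))\<^sup>2 < Qm + 1 / real (Suc k)"
  proof
    fix k
    have "\<exists>\<phi>\<in>D. A \<phi> - (- real (Suc k)) * (norm (f - \<phi>))\<^sup>2 < Q (- real (Suc k)) + 1 / real (Suc k)"
      by (rule upper) auto
    moreover have "Q (- real (Suc k)) \<le> Qm" by (rule Q_le) simp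
    ultimately show "\<exists>\<phi>. \<phi> \<in> D \<and> A \<phi> + real (Suc k) * (norm (f - \<phi>))\<^sup>2 < Qm + 1 / real (Suc k)"
      by (metis (no_types, opaque_lifting) add_le_cancel_right diff_minus_eq_add less_le_trans mult_minus_left)
  qed
  then obtain \<phi> where \<phi>: "\<And>k. \<phi> k \<in> D"
    "\<And>k. A (\<phi> k) + real (Suc k) * (norm (f - \<phi> k))\<^sup>2 < Qm + 1 / real (Suc k)"
    by metis
  \<comment> \<open>From the lower estimate at -1, which uses up one of the \<open>k + 1\<close>
    copies of the squared distance; the other \<open>k\<close> force \<open>\<phi> k\<close> to
    converge to \<open>f\<close>.\<close>
  define C where "C = Qm + 1 - Q (-1)"
  have bound: "real k * (norm (f - \<phi> k))\<^sup>2 \<le> C" for k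
  proof -
    have "Q (-1) \<le> A (\<phi> k) + (norm (f - \<phi> k))\<^sup>2" using lower[of "-1", OF _ \<phi>(1)] by simp
    moreover have "1 / real (Suc k) \<le> 1" by simp
    moreover have "real (Suc k) * (norm (f - \<phi> k))\<^sup>2 = real k * (norm (f - \<phi> k))\<^sup>2 + (norm (f - \<phi> k))\<^sup>2"
      by (simp add: algebra_simps)
    ultimately show ?thesis using \<phi>(2)[of k] unfolding C_def by linarith
  qed
  have sq: "(\<lambda>k. (norm (f - \<phi> k))\<^sup>2) \<longlonglongrightarrow> 0"
  proof (rule tendsto_sandwich[where f = "\<lambda>_. 0" and h = "\<lambda>k. C * (1 / real k)"])
    show "\<forall>\<^sub>F k in sequentially. (norm (f - \<phi> k))\<^sup>2 \<le> C * (1 / real k)"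
      using eventually_gt_at_top[of 0]
    proof eventually_elim
      case (elim k)
      then show ?case using bound[of k] by (simp add: field_simps)
    qed
    have "(\<lambda>k. C * (1 / real k)) \<longlonglongrightarrow> C * 0" by (intro tendsto_mult tendsto_const lim_1_over_n)
    then show "(\<lambda>k. C * (1 / real k)) \<longlonglongrightarrow> 0" by simp
  qed auto
  then have "(\<lambda>k. sqrt ((norm (f - \<phi> k))\<^sup>2)) \<longlonglongrightarrow> sqrt 0" by (rule tendsto_real_sqrt)
  then have "(\<lambda>k. f - \<phi> k) \<longlonglongrightarrow> 0" by (simp add: tendsto_norm_zero_iff)
  then have lim: "\<phi> \<longlonglongrightarrow> f" using tendsto_diff[OF tendsto_const[of f], of "\<lambda>k. f - \<phi> k" 0] by simp
  have "form_approx S \<phi> f"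
    unfolding form_approx_def
  proof (intro conjI allI impI lim)
    show "range \<phi> \<subseteq> D" using \<phi>(1) by blast
    fix e :: real assume e: "e > 0"
    \<comment> \<open>Budget: \<open>A (\<phi> i) < Qm + e / 16\<close> for late \<open>i\<close>,
      and \<open>A w > Qm - e / 8\<close> at the midpoint \<open>w\<close>; in the parallelogram
      identity this adds up to \<open>3 e / 4\<close>. As \<open>s\<close> is fixed from here on,
      its norm terms become small.\<close>
    have "Qm - e / 16 < Sup (Q ` {..<0})" unfolding Qm_def using e by simp
    then obtain s where s: "s < 0" "Qm - e / 16 < Q s"
      using less_cSup_iff[OF _ bdd, of "Qm - e / 16"] by auto
    have "(\<lambda>k. - s * (norm (f - \<phi> k))\<^sup>2) \<longlonglongrightarrow> - s * 0" by (intro tendsto_mult tendsto_const sq)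
    then have "\<forall>\<^sub>F k in sequentially. - s * (norm (f - \<phi> k))\<^sup>2 < e / 16"
      using e by (intro order_tendstoD(2)) auto
    moreover have "\<forall>\<^sub>F k in sequentially. 1 / real (Suc k) < e / 16"
      using e by (intro order_tendstoD(2)[OF LIMSEQ_Suc[OF lim_1_over_n]]) simp
    ultimately have "\<forall>\<^sub>F k in sequentially. - s * (norm (f - \<phi> k))\<^sup>2 < e / 16 \<and> 1 / real (Suc k) < e / 16"
      by (rule eventually_conj)
    then obtain N where N: "\<And>k. k \<ge> N \<Longrightarrow> - s * (norm (f - \<phi> k))\<^sup>2 < e / 16"
      "\<And>k. k \<ge> N \<Longrightarrow> 1 / real (Suc k) < e / 16"
      by (auto simp: eventually_sequentially)
    have "Re (a (\<phi> j - \<phi> k) (\<phi> j - \<phi> k)) < e" if jk: "j \<ge> N" "k \<ge> N" for j k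
    proof -
      define g h where "g = f - \<phi> j" and "h = f - \<phi> k"
      define g' h' where "g' = f' - Sv (\<phi> j)" and "h' = f' - Sv (\<phi> k)"
      define w where "w = (1/2) *\<^sub>R (\<phi> j + \<phi> k)"
      have w: "w \<in> D" unfolding w_def by (intro DD(2,6) \<phi>(1))
      have fw: "f - w = (1/2) *\<^sub>R (g + h)" "f' - Sv w = (1/2) *\<^sub>R (g' + h')"
      proof -
        have two: "x = (1/2) *\<^sub>R x + (1/2) *\<^sub>R x" for x :: 'h by (simp flip: scaleR_add_left)
        have "f - w = ((1/2) *\<^sub>R f + (1/2) *\<^sub>R f) - w" using two[of f] by simp
        then show "f - w = (1/2) *\<^sub>R (g + h)"
          by (simp add: w_def g_def h_def scaleR_add_right scaleR_diff_right)
        have "f' - Sv w = ((1/2) *\<^sub>R f' + (1/2) *\<^sub>R f') - (1/2) *\<^sub>R (Sv (\<phi> j) + Sv (\<phi> k))"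
          using two[of f'] by (simp add: w_def Sv_scaleR[OF DD(2)[OF \<phi>(1) \<phi>(1)]] Sv_add[OF \<phi>(1) \<phi>(1)])
        then show "f' - Sv w = (1/2) *\<^sub>R (g' + h')"
          by (simp add: g'_def h'_def scaleR_add_right scaleR_diff_right)
      qed
      have "a (\<phi> j - \<phi> k) (\<phi> j - \<phi> k) = cinner (g - h) (g' - h')"
      proof -
        have "\<phi> j - \<phi> k = - (g - h)" by (simp add: g_def h_def)
        moreover have "Sv (\<phi> j - \<phi> k) = - (g' - h')"
          using Sv_diff[OF \<phi>(1) \<phi>(1)] by (simp add: g'_def h'_def)
        ultimately show ?thesis by (simp only: cinner_minus_left cinner_minus_right minus_minus)
      qed
      then have "Re (a (\<phi> j - \<phi> k) (\<phi> j - \<phi> k))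
          = 2 * Re (cinner g g') + 2 * Re (cinner h h') - Re (cinner (g + h) (g' + h'))"
        by (simp add: cinner_simps)
      moreover have "Re (cinner (g + h) (g' + h')) = 4 * A w"
        unfolding A_def fw by (simp add: cinner_scaleR_left cinner_scaleR_right)
      ultimately have eq: "Re (a (\<phi> j - \<phi> k) (\<phi> j - \<phi> k)) = 2 * A (\<phi> j) + 2 * A (\<phi> k) - 4 * A w"
        by (simp add: A_def g_def h_def g'_def h'_def)
      have A_lt: "A (\<phi> i) < Qm + e / 16" if "i \<ge> N" for i
      proof -
        have "0 \<le> real (Suc i) * (norm (f - \<phi> i))\<^sup>2" by simp
        then show ?thesis using \<phi>(2)[of i] N(2)[OF that] by linarith
      qed
      have "(norm (f - w))\<^sup>2 \<le> ((norm g)\<^sup>2 + (norm h)\<^sup>2) / 2"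
      proof -
        have "(norm (f - w))\<^sup>2 = (norm (g + h))\<^sup>2 / 4" by (simp add: fw(1) power_mult_distrib power_divide)
        moreover have "(norm (g + h))\<^sup>2 = 2 * (norm g)\<^sup>2 + 2 * (norm h)\<^sup>2 - (norm (g - h))\<^sup>2"
          by (simp flip: Re_cinner_self add: cinner_simps)
        then have "(norm (g + h))\<^sup>2 \<le> 2 * (norm g)\<^sup>2 + 2 * (norm h)\<^sup>2"
          by (simp del: power_mono_iff)
        ultimately show ?thesis by (simp add: field_simps)
      qed
      then have "- s * (norm (f - w))\<^sup>2 \<le> - s * (((norm g)\<^sup>2 + (norm h)\<^sup>2) / 2)"
        using s(1) by (intro mult_left_mono) auto
      also have "\<dots> = (- s * (norm g)\<^sup>2 + - s * (norm h)\<^sup>2) / 2" by (simp add: algebra_simps)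
      also have "\<dots> < (e / 16 + e / 16) / 2"
        unfolding g_def h_def
        by (rule divide_strict_right_mono[OF add_strict_mono[OF N(1)[OF jk(1)] N(1)[OF jk(2)]]]) simp
      also have "\<dots> = e / 16" by simp
      finally have "- s * (norm (f - w))\<^sup>2 < e / 16" .
      then have "Qm - e / 8 < A w" using lower[OF s(1) w] s(2) by linarith
      then show ?thesis using eq A_lt[OF jk(1)] A_lt[OF jk(2)] e by linarith
    qed
    then show "\<exists>N. \<forall>j\<ge>N. \<forall>k\<ge>N. Re (a (\<phi> j - \<phi> k) (\<phi> j - \<phi> k)) < e" by blast
  qed
  then have "f \<in> form_domain S" by (auto simp: form_domain_def)
  then show ?thesis using F_I[OF HF_I[OF f(1)]] f(2) by simp
qed

sublocale path: lagrangian_path M F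
  by unfold_locales
    (rule finite_K F_lagrangian M_lagrangian M_Int_F M_mono M_cont M_start; assumption)+

section \<open>Negative eigenvalues of an extension as crossings\<close>

text \<open>For \<open>s < 0\<close> the boundary map is injective on the kernel of the adjoint
  minus \<open>s\<close>: a vector with boundary value 0 belongs to \<open>HF\<close>, which has no
  negative eigenvalues. So multiplicities can be read off in the boundary space.\<close>

lemma eigenspace_extension:
  fixes L :: "('k \<times> 'k) set"
  assumes L: "csubspace L" and s: "s < 0"
  defines "E \<equiv> eigenspace (extension_of_plane S \<Gamma>\<^sub>0 \<Gamma>\<^sub>1 L) (complex_of_real s)"
  shows "ecdim E = enat (cdim (L \<inter> M s))" "E \<noteq> {0} \<longleftrightarrow> L \<inter> M s \<noteq> {0}"
proof -
  have E_iff: "f \<in> E \<longleftrightarrow> (f, s *\<^sub>R f) \<in> T \<and> G f \<in> L" for f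
    by (simp add: E_def eigenspace_def extension_of_plane_def scaleC_of_real G_def)
  have T_cs: "(f, s *\<^sub>R f) \<in> T \<Longrightarrow> (c *\<^sub>C f, s *\<^sub>R (c *\<^sub>C f)) \<in> T" for f c
    using T_scaleC[of f "s *\<^sub>R f" c] by (simp add: scaleC_of_real[symmetric] scaleC_scaleC mult.commute)
  have G_add': "G (f + g) = G f + G g" if "f \<in> E" "g \<in> E" for f g
    using that G_add unfolding E_iff by blast
  have G_scale': "G (c *\<^sub>C f) = c *\<^sub>C G f" if "f \<in> E" for f c
    using that G_scaleC unfolding E_iff by blast
  have E: "csubspace E"
  proof (rule csubspaceI)
    show "0 \<in> E"
      using csubspaceD(1)[OF T_csubspace] G_D[OF DD(1)] csubspaceD(1)[OF L] by (simp add: E_iff zero_prod_def)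
    show "x + y \<in> E" if "x \<in> E" "y \<in> E" for x y
      using that G_add'[OF that] T_add[of x "s *\<^sub>R x" y "s *\<^sub>R y"] csubspaceD(2)[OF L]
      by (simp add: E_iff scaleR_add_right)
    show "c *\<^sub>C x \<in> E" if "x \<in> E" for c x
      using that G_scale'[OF that] T_cs csubspaceD(3)[OF L] by (simp add: E_iff)
  qed
  have lin: "clinear_on E G" using G_add' G_scale' by (simp add: clinear_on_def)
  have inj: "inj_on G E"
  proof (rule inj_onI)
    fix f g assume fg: "f \<in> E" "g \<in> E" "G f = G g"
    have d: "f - g \<in> E" by (rule csubspaceD(4)[OF E fg(1,2)])
    have "G (f - g) = 0" using clinear_on_diff[OF E lin fg(1,2)] fg(3) by simp
    then have "(f - g, s *\<^sub>R (f - g)) \<in> HF"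
      using d csubspaceD(1)[OF F_csubspace] by (intro F_D) (simp_all add: E_iff)
    then have "f - g = 0" by (rule eigen_HF_zero[OF s])
    then show "f = g" by simp
  qed
  have im: "G ` E = L \<inter> M s" by (auto simp: E_iff M_iff)
  show ec: "ecdim E = enat (cdim (L \<inter> M s))"
    using ecdim_clinear_on_image[OF E lin inj] ecdim_eq[OF path.fin2, of "L \<inter> M s"] im by simp
  have "E = {0} \<longleftrightarrow> G ` E = {0}"
  proof
    assume "G ` E = {0}"
    then show "E = {0}"
      using inj csubspaceD(1)[OF E] G_D[OF DD(1)] by (fastforce simp: inj_on_def)
  qed (simp add: G_D[OF DD(1)])
  then show "E \<noteq> {0} \<longleftrightarrow> L \<inter> M s \<noteq> {0}" using im by simp
qed

lemma morse_index_extension: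
  assumes L: "lagrangian L"
  shows "\<exists>m. morse_index (extension_of_plane S \<Gamma>\<^sub>0 \<Gamma>\<^sub>1 L) = enat m \<and> int m = duistermaat_index path.M0 L F"
proof -
  let ?E = "{s. s < 0 \<and> L \<inter> M s \<noteq> {0}}"
  note eig = eigenspace_extension[OF lagrangianD(1)[OF L]]
  have E: "{s \<in> {..<0}. eigenspace (extension_of_plane S \<Gamma>\<^sub>0 \<Gamma>\<^sub>1 L) (complex_of_real s) \<noteq> {0}} = ?E"
    by (simp only: lessThan_iff eig(2) cong: conj_cong)
  have "morse_index (extension_of_plane S \<Gamma>\<^sub>0 \<Gamma>\<^sub>1 L)
      = (\<Sum>s\<in>?E. ecdim (eigenspace (extension_of_plane S \<Gamma>\<^sub>0 \<Gamma>\<^sub>1 L) (complex_of_real s)))"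
    unfolding morse_index_def eigenvalue_count_def Let_def E
    using path.crossings_eq_duistermaat_index(1)[OF L] by simp
  also have "\<dots> = (\<Sum>s\<in>?E. enat (cdim (L \<inter> M s)))" by (rule sum.cong) (use eig(1) in auto)
  also have "\<dots> = enat (\<Sum>s\<in>?E. cdim (L \<inter> M s))" by (rule sum_enat)
  finally show ?thesis using path.crossings_eq_duistermaat_index(2)[OF L] by blast
qed

end

section \<open>Planes transversal to the vertical plane\<close>

text \<open>With \<open>F\<close> vertical and \<open>A\<close> a graph, the split form has the
  diagonal value \<open>\<langle>x, y - M\<^sub>0 x\<rangle>\<close> at \<open>(x, y)\<close>. On
  \<open>L\<close> this depends on \<open>x\<close> alone and is the negative of the form of the
  operator in question; the vertical vectors of \<open>L\<close> lie in the radical and do not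
  affect the index.\<close>

lemma frame_n_minus:
  fixes L :: "('k :: chilbert_space \<times> 'k) set" and M\<^sub>0 P \<Theta> :: "'k \<Rightarrow> 'k"
  assumes fin: "finite_cdim TYPE('k)"
    and A: "A = {(\<kappa>, M\<^sub>0 \<kappa>) |\<kappa>. True}" "lagrangian A" and M\<^sub>0: "clinear M\<^sub>0"
    and F: "F = {(0, y) |y. True}" and AF: "transversal A F"
    and P: "orthogonal_projector P" and \<Theta>: "selfadjoint_on (range P) \<Theta>"
    and L: "lagrangian_frame P (\<lambda>\<kappa>. P (\<Theta> (P \<kappa>)) + P \<kappa> - \<kappa>) L"
  shows "enat (form_n_minus L (\<lambda>u v. sympl (proj_along F A u) (proj_along A F v)))
    = n_plus_on (range P) (\<lambda>x. P (M\<^sub>0 (P x)) - \<Theta> x)"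
proof -
  note fin2 = finite_cdim_prod[OF fin fin]
  interpret M: Vector_Spaces.linear scaleC scaleC M\<^sub>0 by (rule M\<^sub>0)
  have "clinear P" and P_idem: "P (P x) = P x" and P_sym: "cinner (P x) y = cinner x (P y)" for x y
    using P by (auto simp: orthogonal_projector_def)
  then interpret P: Vector_Spaces.linear scaleC scaleC P by simp
  let ?V = "range P"
  have V: "csubspace ?V"
    by (auto intro!: csubspaceI simp: P.add[symmetric] P.scale[symmetric] image_iff) (metis P.zero)
  have P_id: "P x = x" if "x \<in> ?V" for x using that P_idem by auto
  have \<Theta>_lin: "clinear_on ?V \<Theta>" and \<Theta>_mem: "\<And>x. x \<in> ?V \<Longrightarrow> \<Theta> x \<in> ?V"
    and \<Theta>_sym: "\<And>x y. x \<in> ?V \<Longrightarrow> y \<in> ?V \<Longrightarrow> cinner (\<Theta> x) y = cinner x (\<Theta> y)"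
    using \<Theta> unfolding selfadjoint_on_def by blast+
  have M_sym: "cinner (M\<^sub>0 x) y = cinner x (M\<^sub>0 y)" for x y
    using lagrangianD(2)[OF A(2), of "(x, M\<^sub>0 x)" "(y, M\<^sub>0 y)"] A(1) by (auto simp: sympl_def)
  have \<Theta>_add: "\<And>x y. x \<in> ?V \<Longrightarrow> y \<in> ?V \<Longrightarrow> \<Theta> (x + y) = \<Theta> x + \<Theta> y"
    and \<Theta>_scale: "\<And>c x. x \<in> ?V \<Longrightarrow> \<Theta> (c *\<^sub>C x) = c *\<^sub>C \<Theta> x"
    using \<Theta>_lin unfolding clinear_on_def by blast+
  define B where "B x = P (M\<^sub>0 (P x)) - \<Theta> x" for x
  have B: "selfadjoint_on ?V B"
    unfolding selfadjoint_on_def clinear_on_def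
  proof (intro conjI ballI allI)
    show "B (x + y) = B x + B y" if "x \<in> ?V" "y \<in> ?V" for x y
      using \<Theta>_add[OF that] by (simp add: B_def P.add M.add)
    show "B (c *\<^sub>C x) = c *\<^sub>C B x" if "x \<in> ?V" for c x
      using \<Theta>_scale[OF that] by (simp add: B_def P.scale M.scale scaleC_diff_right)
    show "B ` ?V \<subseteq> ?V"
      using csubspaceD(4)[OF V _ \<Theta>_mem] by (auto simp: B_def)
    show "cinner (B x) y = cinner x (B y)" if "x \<in> ?V" "y \<in> ?V" for x y
      using that \<Theta>_sym[OF that] by (simp add: B_def cinner_simps P_sym M_sym)
  qed
  have B_add: "\<And>x y. x \<in> ?V \<Longrightarrow> y \<in> ?V \<Longrightarrow> B (x + y) = B x + B y"
    and B_scale: "\<And>c x. x \<in> ?V \<Longrightarrow> B (c *\<^sub>C x) = c *\<^sub>C B x"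
    and B_sym: "\<And>x y. x \<in> ?V \<Longrightarrow> y \<in> ?V \<Longrightarrow> cinner (B x) y = cinner x (B y)"
    using B unfolding selfadjoint_on_def clinear_on_def by blast+
  define r where "r x y = - cinner x (B y)" for x y
  have r_herm: "hermitian_on ?V r"
    unfolding hermitian_on_def
  proof (intro conjI ballI allI)
    fix x y assume xy: "x \<in> ?V" "y \<in> ?V"
    show "r x y = cnj (r y x)"
      using B_sym[OF xy] cinner_commute[of y "B x"] by (simp add: r_def)
  qed (simp_all add: V r_def B_add B_scale cinner_simps)
  let ?q = "\<lambda>u v. sympl (proj_along F A u) (proj_along A F v)"
  have Lag: "lagrangian L" and L_eq: "L = range (\<lambda>\<kappa>. (P \<kappa>, P (\<Theta> (P \<kappa>)) + P \<kappa> - \<kappa>))"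
    using L by (auto simp: lagrangian_frame_def)
  have val: "?q u u = r (fst u) (fst u)" and fstV: "fst u \<in> ?V" if u: "u \<in> L" for u
  proof -
    obtain \<kappa> where \<kappa>: "u = (P \<kappa>, P (\<Theta> (P \<kappa>)) + P \<kappa> - \<kappa>)" using u L_eq by auto
    define x where "x = P \<kappa>"
    have x: "x \<in> ?V" by (simp add: x_def)
    have u': "u = (x, P (\<Theta> x) + x - \<kappa>)" by (simp add: \<kappa> x_def)
    have "proj_along F A u = (x, M\<^sub>0 x)"
      by (rule proj_along_eqI[OF AF]) (auto simp: A F u')
    moreover have "proj_along A F u = (0, snd u - M\<^sub>0 x)"
      by (rule proj_along_eqI[OF transversal_commute[OF AF]]) (auto simp: A F u')
    ultimately have "?q u u = cinner x (snd u - M\<^sub>0 x)" by (simp add: sympl_def)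
    also have "\<dots> = cinner x (\<Theta> x) + cinner x (x - \<kappa>) - cinner x (M\<^sub>0 x)"
      using P_id[OF \<Theta>_mem[OF x]] by (simp add: u' cinner_simps)
    \<comment> \<open>\<open>x - \<kappa>\<close> lies in the kernel of the orthogonal projector and
      \<open>x\<close> in its range.\<close>
    also have "cinner x (x - \<kappa>) = 0"
      unfolding x_def P_sym by (simp add: P.diff P_idem)
    also have "cinner x (M\<^sub>0 x) = cinner x (P (M\<^sub>0 (P x)))"
      using P_sym[of x "M\<^sub>0 x"] P_id[OF x] by simp
    finally show "?q u u = r (fst u) (fst u)" by (simp add: u' r_def B_def cinner_simps)
    show "fst u \<in> ?V" using x u' by simp
  qed
  obtain W U where WU: "csubspace W" "csubspace U" "W \<subseteq> ?V" "U \<subseteq> ?V"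
    "\<forall>x\<in>?V. \<exists>w\<in>W. \<exists>u\<in>U. x = w + u" "negative_on W r" "nonneg_on U r"
    "\<forall>w\<in>W. \<forall>u\<in>U. r w u = 0" "form_n_minus ?V r = cdim W" "W \<inter> U \<subseteq> {0}"
    by (rule form_n_minus_decomposition[OF fin r_herm])
  \<comment> \<open>A section of the first projection of \<open>L\<close> over the range of
    \<open>P\<close>: the frame at \<open>\<kappa> = x\<close>, where
    \<open>P \<kappa> - \<kappa>\<close> vanishes.\<close>
  define l where "l x = (x, \<Theta> x)" for x
  have l_mem: "l x \<in> L" if "x \<in> ?V" for x
    unfolding L_eq l_def using that P_id[OF that] P_id[OF \<Theta>_mem[OF that]]
    by (intro image_eqI[of _ _ x]) auto
  have l_lin: "clinear_on W l"
    unfolding clinear_on_def l_def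
    using \<Theta>_add[OF subsetD[OF WU(3)] subsetD[OF WU(3)]] \<Theta>_scale[OF subsetD[OF WU(3)]]
    by (simp add: scaleC_Pair)
  have l_inj: "inj_on l W" by (auto simp: inj_on_def l_def)
  have "form_n_minus L ?q = cdim (l ` W)"
  proof (rule form_n_minus_eqI[where q = ?q and U = "{u \<in> L. fst u \<in> U}", OF fin2 lagrangianD(1)[OF Lag]])
    note LD = csubspaceD[OF lagrangianD(1)[OF Lag]]
    show "csubspace (l ` W)" by (rule csubspace_clinear_on_image[OF WU(1) l_lin l_inj])
    show "l ` W \<subseteq> L" using l_mem WU(3) by blast
    \<comment> \<open>The nonnegative part is the full preimage of \<open>U\<close> in
      \<open>L\<close>, so that it contains the vertical vectors of \<open>L\<close>.\<close>
    show "csubspace {u \<in> L. fst u \<in> U}"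
      by (rule csubspaceI) (simp_all add: LD csubspaceD[OF WU(2)] fst_scaleC)
    show "{u \<in> L. fst u \<in> U} \<subseteq> L" by blast
    show "nonneg_on {u \<in> L. fst u \<in> U} ?q" using WU(7) val by simp
    show "negative_on (l ` W) ?q"
    proof (intro ballI impI)
      fix u assume u: "u \<in> l ` W" "u \<noteq> 0"
      then obtain x where x: "x \<in> W" "u = l x" by blast
      have "l 0 = 0" using clinear_on_diff[OF WU(1) l_lin x(1) x(1)] by simp
      then have "x \<noteq> 0" using u(2) x(2) by auto
      then show "Re (?q u u) < 0"
        using WU(3,6) x val[OF l_mem, of x] by (auto simp: l_def)
    qed
    show "\<exists>w\<in>l ` W. \<exists>z\<in>{u \<in> L. fst u \<in> U}. u = w + z" if u: "u \<in> L" for u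
    proof -
      obtain w z where wz: "w \<in> W" "z \<in> U" "fst u = w + z" using WU(5) fstV[OF u] by blast
      have "l w \<in> L" using l_mem wz(1) WU(3) by blast
      then have "u - l w \<in> L" by (rule LD(4)[OF u])
      moreover have "fst (u - l w) \<in> U" using wz by (simp add: l_def)
      ultimately show ?thesis using wz(1)
        by (intro bexI[of _ "l w"] bexI[of _ "u - l w"]) auto
    qed
  qed
  also have "\<dots> = form_n_minus ?V r"
    using cdim_clinear_on_image[OF WU(1) l_lin l_inj] WU(9) by simp
  finally show ?thesis
    using n_plus_on_eq_form_n_minus[OF fin V B] by (simp add: r_def[abs_def] B_def[abs_def])
qed

theorem corollary7p1:
  fixes S :: "('h :: chilbert_space \<times> 'h) set"
    and \<Gamma>\<^sub>0 \<Gamma>\<^sub>1 :: "'h \<Rightarrow> 'k :: chilbert_space"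
    and n :: nat
    and H H\<^sub>F :: "('h \<times> 'h) set"
    and L F M_0minus :: "('k \<times> 'k) set"
  assumes "separable_space (euclidean :: 'h topology)"
    and "linear_operator S" and "closed S" and "densely_defined S"
    and "symmetric_op S" and "nonnegative_op S"
    and "has_defect_numbers S n n"
    and "boundary_triplet n S \<Gamma>\<^sub>0 \<Gamma>\<^sub>1"
    and "H\<^sub>F = friedrichs S"
    and "F = (\<lambda>f. (\<Gamma>\<^sub>0 f, \<Gamma>\<^sub>1 f)) ` Domain H\<^sub>F"
    and "lagrangian L"
    and "H = extension_of_plane S \<Gamma>\<^sub>0 \<Gamma>\<^sub>1 L"
    and "M_0minus = left_graph_limit (cauchy_data S \<Gamma>\<^sub>0 \<Gamma>\<^sub>1) 0"
  shows "(\<exists>m. morse_index H = enat m \<and> int m = duistermaat_index M_0minus L F) \<and>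
    (\<forall>M\<^sub>0 P \<Theta>.
       Domain H\<^sub>F = {f \<in> Domain (adj S). \<Gamma>\<^sub>0 f = 0} \<longrightarrow>
       clinear M\<^sub>0 \<longrightarrow> M_0minus = {(\<kappa>, M\<^sub>0 \<kappa>) | \<kappa>. True} \<longrightarrow>
       orthogonal_projector P \<longrightarrow> selfadjoint_on (range P) \<Theta> \<longrightarrow>
       lagrangian_frame P (\<lambda>\<kappa>. P (\<Theta> (P \<kappa>)) + P \<kappa> - \<kappa>) L \<longrightarrow>
       morse_index H = n_plus_on (range P) (\<lambda>x. P (M\<^sub>0 (P x)) - \<Theta> x))"
proof -
  interpret B: boundary_setting S \<Gamma>\<^sub>0 \<Gamma>\<^sub>1 n
    using assms(2,5,6,8) by unfold_locales
  have HF: "H\<^sub>F = B.HF" using assms(9) B.friedrichs_eq by simp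
  have F: "F = B.F" unfolding assms(10) HF B.F_def B.G_def[abs_def] ..
  note M0 = assms(13)
  note L = assms(11)
  obtain m where m: "morse_index H = enat m" "int m = duistermaat_index M_0minus L F"
    unfolding assms(12) F M0 using B.morse_index_extension[OF L] by blast
  have "morse_index H = n_plus_on (range P) (\<lambda>x. P (M\<^sub>0 (P x)) - \<Theta> x)"
    if dom: "Domain H\<^sub>F = {f \<in> Domain (adj S). \<Gamma>\<^sub>0 f = 0}"
      and M\<^sub>0: "clinear M\<^sub>0" and graph: "M_0minus = {(\<kappa>, M\<^sub>0 \<kappa>) | \<kappa>. True}"
      and P: "orthogonal_projector P" "selfadjoint_on (range P) \<Theta>"
      and frame: "lagrangian_frame P (\<lambda>\<kappa>. P (\<Theta> (P \<kappa>)) + P \<kappa> - \<kappa>) L"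
    for M\<^sub>0 P \<Theta>
  proof -
    interpret M: Vector_Spaces.linear scaleC scaleC M\<^sub>0 by (rule M\<^sub>0)
    \<comment> \<open>The condition on the domain makes \<open>F\<close> vertical; that it is the
      whole vertical plane follows from surjectivity of the boundary map.\<close>
    have Fv: "F = {(0, y) |y. True}"
    proof (intro equalityI subsetI)
      fix u assume "u \<in> F"
      then show "u \<in> {(0, y) |y. True}" unfolding assms(10) dom by auto
    next
      fix u :: "'k \<times> 'k" assume "u \<in> {(0, y) |y. True}"
      then obtain y where u: "u = (0, y)" by blast
      obtain f f' where f: "(f, f') \<in> adj S" "B.G f = u" by (rule B.G_surj)
      then have "f \<in> Domain H\<^sub>F" unfolding dom using u by (auto simp: B.G_def)
      then show "u \<in> F" unfolding assms(10) using f(2) by (auto simp: B.G_def)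
    qed
    have Mlag: "lagrangian M_0minus" unfolding M0 by (rule B.path.M0_lagrangian)
    \<comment> \<open>A graph meets the vertical plane only in 0, so the outer planes are
      transversal and the index reduces to the negative index of one form.\<close>
    have disj: "M_0minus \<inter> F = {0}"
      unfolding graph Fv by (auto simp: zero_prod_def M.zero)
    have T: "transversal M_0minus F"
      using transversal_lagrangian[OF B.finite_K Mlag B.F_lagrangian] disj F by simp
    have "duistermaat_index M_0minus L F
        = int (form_n_minus L (\<lambda>u v. sympl (proj_along F M_0minus u) (proj_along M_0minus F v)))"
      unfolding F M0 by (rule B.path.duistermaat_index_transversal[OF L])
        (use disj in \<open>simp add: F M0\<close>)
    then show ?thesis
      using m frame_n_minus[OF B.finite_K graph Mlag M\<^sub>0 Fv T P frame] by simp
  qed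
  then show ?thesis using m by blast
qed

end
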